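(* (i) Let $N$ be a positive integer. Then $${}_{14}W_{13}\left(q;y,yq,z,zq,\frac{q^2}{ad},\frac{dq}{a},q^2,\frac{aq^{N+2}}{yz},\frac{aq^{N+3}}{yz},q^{-N},q^{1-N};q^2,q^2\right)$$ $$-\,aq\,\frac{\left(1-\frac da\right)\left(1-\frac{q}{ad}\right)(1-q^3)(1-q^{-N})(1-y)\left(1-\frac{aq^{2+N}}{yz}\right)(1-z)}{(1-ad)(1-q)\left(1-\frac{aq}{d}\right)(1-q^{2+N})\left(1-\frac{q^2}{y}\right)\left(1-\frac{q^2}{z}\right)\left(1-\frac{yzq^{-N}}{a}\right)}$$ $$\times\,{}_{14}W_{13}\left(q^3;yq,yq^2,zq,zq^2,\frac{q^3}{ad},\frac{dq^2}{a},q^2,\frac{aq^{N+3}}{yz},\frac{aq^{N+4}}{yz},q^{1-N},q^{2-N};q^2,q^2\right)$$ $$=\frac{\left(q^2,\frac{q^2}{yz},\frac{aq}{y},\frac{aq}{z};q\right)_N}{\left(\frac{q^2}{y},\frac{q^2}{z},\frac{aq}{yz},aq;q\right)_N}\;{}_{10}W_{9}\left(a;y,z,d,\frac qd,-a,\frac{aq^{N+2}}{yz},q^{-N};q,-a\right).$$ (ii) If $|q|<1$ and $|a|<1$, then $${}_{7}\phi_{6}\left[\begin{matrix}q^{5/2},\,-q^{5/2},\,y,\,\frac qy,\,\frac{q^2}{ad},\,\frac{dq}{a},\,q^2\\ q^{1/2},\,-q^{1/2},\,q^2y,\,\frac{q^3}{y},\,qad,\,\frac{q^2a}{d}\end{matrix};q^2,a^2\right]$$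 $$-\frac{a^2\left(1-\frac da\right)\left(1-\frac{q}{ad}\right)(1-q^3)\left(1-\frac qy\right)(1-y)}{(1-ad)(1-q)\left(1-\frac{aq}{d}\right)\left(1-\frac{q^2}{y}\right)(1-qy)}\;{}_{7}\phi_{6}\left[\begin{matrix}q^{7/2},\,-q^{7/2},\,yq,\,\frac{q^2}{y},\,\frac{q^3}{ad},\,\frac{dq^2}{a},\,q^2\\ q^{3/2},\,-q^{3/2},\,q^3y,\,\frac{q^4}{y},\,q^2ad,\,\frac{q^3a}{d}\end{matrix};q^2,a^2\right]$$ $$=\frac{(q,q^2;q)_\infty\,(ady,\,adq/y,\,ayq/d,\,q^2a/(dy);q^2)_\infty}{(ad,\,aq/d,\,yq,\,q^2/y;q)_\infty}.$$
   Context: For a base $t$ and $n\ge0$ or $n=\infty$ (the latter for $|t|<1$), $(x;t)_n=\prod_{i=0}^{n-1}(1-xt^i)$ and $(x_1,\dots,x_m;t)_n=\prod_{j=1}^m(x_j;t)_n$. The basic hypergeometric series with base $t$ is ${}_{r+1}\phi_r\left[\begin{matrix}a_1,\dots,a_{r+1}\\ b_1,\dots,b_r\end{matrix};t,x\right]=\sum_{n\ge0}\frac{(a_1,\dots,a_{r+1};t)_n}{(t,b_1,\dots,b_r;t)_n}x^n$, where the sum is stopped once an upper parameter of the form $t^{-M}$ ($M\ge 0$ an integer) makes the terms vanish, i.e. it runs over $0\le n\le M$. Further, ${}_{r+1}W_r(a_1;a_4,\dots,a_{r+1};t,x)={}_{r+1}\phi_r\left[\begin{matrix}a_1,\,t\sqrt{a_1},\,-t\sqrt{a_1},\,a_4,\dots,a_{r+1}\\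 \sqrt{a_1},\,-\sqrt{a_1},\,a_1t/a_4,\dots,a_1t/a_{r+1}\end{matrix};t,x\right]$. Here $q,a,d,y,z$ are nonzero complex numbers such that none of the denominators vanish; square roots (including $q^{1/2}$) are fixed choices. *)

theory Defs
  imports "HOL-Analysis.Analysis"
begin

definition qpoch :: "complex \<Rightarrow> complex \<Rightarrow> nat \<Rightarrow> complex" where
  "qpoch x t n = (\<Prod>i<n. 1 - x * t ^ i)"

(* Meaningful for norm t < 1, where the product converges. *)
definition qpoch_inf :: "complex \<Rightarrow> complex \<Rightarrow> complex" where
  "qpoch_inf x t = (\<Prod>i. 1 - x * t ^ i)"

definition qpochs :: "complex list \<Rightarrow> complex \<Rightarrow> nat \<Rightarrow> complex" where
  "qpochs xs t n = (\<Prod>x\<leftarrow>xs. qpoch x t n)"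

definition qpochs_inf :: "complex list \<Rightarrow> complex \<Rightarrow> complex" where
  "qpochs_inf xs t = (\<Prod>x\<leftarrow>xs. qpoch_inf x t)"

definition phi_term :: "complex list \<Rightarrow> complex list \<Rightarrow> complex \<Rightarrow> complex \<Rightarrow> nat \<Rightarrow> complex" where
  "phi_term as bs t x n = qpochs as t n / qpochs (t # bs) t n * x ^ n"

(* Basic hypergeometric series with upper parameters as and lower parameters bs, for
   length as = Suc (length bs).  If t^(-M) is an upper parameter, the sum is stopped at the
   least such M; otherwise it is the infinite series. *)
definition phi :: "complex list \<Rightarrow> complex list \<Rightarrow> complex \<Rightarrow> complex \<Rightarrow> complex" where
  "phi as bs t x =
     (if \<exists>M::nat. t powi (- int M) \<in> set as
      then \<Sum>n\<le>(LEAST M::nat. t powi (- int M) \<in> set as). phi_term as bs t x n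
      else \<Sum>n. phi_term as bs t x n)"

(* The denominators of the terms with index in I do not vanish (division by 0 yields 0 in HOL,
   so this has to be required separately). *)
definition phi_denoms_nonzero :: "complex list \<Rightarrow> complex \<Rightarrow> nat set \<Rightarrow> bool" where
  "phi_denoms_nonzero bs t I \<longleftrightarrow> (\<forall>n\<in>I. qpochs (t # bs) t n \<noteq> 0)"

(* In the following definitions rt is the chosen square root function, and the list cs holds
   the parameters a_4, ..., a_(r+1). *)
definition W_upper :: "(complex \<Rightarrow> complex) \<Rightarrow> complex \<Rightarrow> complex list \<Rightarrow> complex \<Rightarrow> complex list" where
  "W_upper rt a1 cs t = [a1, t * rt a1, - t * rt a1] @ cs"

definition W_lower :: "(complex \<Rightarrow> complex) \<Rightarrow> complex \<Rightarrow> complex list \<Rightarrow> complex \<Rightarrow> complex list" where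
  "W_lower rt a1 cs t = [rt a1, - rt a1] @ map (\<lambda>c. a1 * t / c) cs"

definition W :: "(complex \<Rightarrow> complex) \<Rightarrow> complex \<Rightarrow> complex list \<Rightarrow> complex \<Rightarrow> complex \<Rightarrow> complex" where
  "W rt a1 cs t x = phi (W_upper rt a1 cs t) (W_lower rt a1 cs t) t x"

end

theory Submission
  imports Defs
begin

text \<open>
  Both parts rest on the sums over all \<open>k\<close> whose even and odd terms are the two series on the left.

  For (i), Jackson's sum expresses the well-poised kernel with base parameter \<open>a\<close> as a
  combination of the kernels with base parameter \<open>q\<close> (the Bailey lemma for the change
  \<open>a \<rightarrow> q\<close>). Inserting this on the right and interchanging the summations leaves a terminating
  well-poised sum over \<open>n \<le> k\<close>, a form of the q-Whipple sum. It satisfies a first-order recurrence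
  \<open>(k + 1, d) \<rightarrow> (k, d q)\<close>, and its product value depends on the parity of \<open>k\<close>, which
  creates the base \<open>q\<^sup>2\<close>. Jackson's sum and this recurrence are both proved by telescoping.

  For (ii), both sides are functions of \<open>u = y + q/y\<close>, and the left-hand side is a partial
  fraction expansion. Truncating the products on the right gives a polynomial of degree \<open>2M\<close>
  in \<open>u\<close>, which Lagrange interpolation at \<open>y = q\<^sup>-\<^sup>k\<close>, \<open>k \<le> 2M\<close>, expands
  exactly. Tannery's theorem then allows \<open>M \<rightarrow> \<infinity>\<close>.
\<close>

section \<open>Finite q-shifted factorials\<close>

text \<open>Both parts meet in one sequence, \<open>whipple_value\<close>. In (i) it is
  \<open>a^k\<close> times the inner sum left after the interchange; in (ii) it is the value of the
  truncated numerator at \<open>y = q^(-k)\<close>, up to a signed power of \<open>q\<close> and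
  factors that tend to infinite products. Hence the same even and odd formulas produce the two
  series in both parts. In (i) the parameter \<open>a*q^(N+2)/(y*z)\<close> is dictated by Jackson's
  sum: with it the last parameter of that sum, which the balancing condition fixes, becomes
  \<open>q/a\<close>, independent of the summation indices. The obstacle is vanishing denominators.
  Only the displayed ones are assumed nonzero, while the argument meets others, such as
  \<open>(q; q)_(2N+1)\<close> and \<open>(aq^(-k); q)_n\<close>. Auxiliary identities are therefore
  cross-multiplied or rewritten with \<open>q/a\<close>, and \<open>(q; q)_(2N+1)\<close> is shown
  to be nonzero from the displayed factors, with one exceptional case.\<close>

lemma qpoch_0 [simp]: "qpoch x t 0 = 1"
  by (simp add: qpoch_def)

lemma qpoch_Suc: "qpoch x t (Suc n) = qpoch x t n * (1 - x * t ^ n)"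
  by (simp add: qpoch_def)

lemma qpoch_add: "qpoch x t (m + n) = qpoch x t m * qpoch (x * t ^ m) t n"
  by (induction n) (simp_all add: qpoch_Suc power_add mult.assoc)

lemma qpoch_Suc_left: "qpoch x t (Suc n) = (1 - x) * qpoch (x * t) t n"
  using qpoch_add[of x t 1 n] by (simp add: qpoch_Suc)

lemma qpoch_eq_0_iff: "qpoch x t n = 0 \<longleftrightarrow> (\<exists>i<n. x * t ^ i = 1)"
  by (auto simp: qpoch_def)

lemma qpoch_nonzeroD: "qpoch x t n \<noteq> 0 \<Longrightarrow> i < n \<Longrightarrow> x * t ^ i \<noteq> 1"
  by (auto simp: qpoch_eq_0_iff)

lemma qpoch_nonzero_le: "qpoch x t n \<noteq> 0 \<Longrightarrow> m \<le> n
  \<Longrightarrow> qpoch x t m \<noteq> 0"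
  by (auto simp: qpoch_eq_0_iff)

text \<open>Apply \<open>1 - s = - s * (1 - 1/s)\<close> to every factor and read the product
  backwards.\<close>

lemma qpoch_reverse:
  assumes "x \<noteq> 0" "t \<noteq> 0"
  shows "qpoch x t n = (\<Prod>i<n. - (x * t^i)) * qpoch (t / (x * t^n)) t n"
proof -
  have "qpoch (t / (x * t^n)) t n = (\<Prod>i<n. 1 - t / (x * t^n) * t^(n - Suc i))"
    unfolding qpoch_def by (rule prod.nat_diff_reindex[symmetric])
  also have "\<dots> = (\<Prod>i<n. 1 - 1 / (x * t^i))"
  proof (intro prod.cong refl)
    fix i assume "i \<in> {..<n}"
    then have "n = (n - Suc i) + 1 + i" by simp
    then have "t^n = t^(n - Suc i) * t * t^i" by (metis power_add power_one_right)
    then show "1 - t / (x * t^n) * t^(n - Suc i) = 1 - 1 / (x * t^i)"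
      using assms by (simp add: field_simps)
  qed
  finally have *: "qpoch (t / (x * t^n)) t n = (\<Prod>i<n. 1 - 1 / (x * t^i))" .
  have "1 - x * t^i = - (x * t^i) * (1 - 1 / (x * t^i))" for i
    using assms by (simp add: field_simps)
  then show ?thesis
    unfolding * by (simp only: qpoch_def prod.distrib[symmetric])
qed

text \<open>Two reversals, cross-multiplied so that no product has to be nonzero. It serves to
  exchange products that start at negative powers of \<open>q\<close> for products that do
  not.\<close>

lemma qpoch_ratio_reverse:
  assumes "x \<noteq> 0" "y \<noteq> 0" "t \<noteq> 0"
  shows "qpoch x t n * qpoch (t / (y * t^n)) t n = (x / y)^n * (qpoch y t n * qpoch (t / (x * t^n)) t n)"
proof -
  have *: "(\<Prod>i<n. - (x * t^i)) = (x / y)^n * (\<Prod>i<n. - (y * t^i))"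
  proof -
    have "(x / y)^n = (\<Prod>i<n. x / y)" by simp
    then show ?thesis using assms by (simp only: prod.distrib[symmetric]) simp
  qed
  show ?thesis unfolding qpoch_reverse[OF assms(1,3)] qpoch_reverse[OF assms(2,3)] * by simp
qed

lemma qpoch_double: "qpoch x q (2*n) = qpoch x (q^2) n * qpoch (x*q) (q^2) n"
  by (induction n) (simp_all add: qpoch_Suc mult_ac power2_eq_square power_mult_distrib mult_2 mult_2_right
    power_add)

lemma qpoch_square: "qpoch x t n * qpoch (-x) t n = qpoch (x^2) (t^2) n"
proof -
  have "(1 - x * t^i) * (1 - (-x) * t^i) = 1 - x^2 * (t^2)^i" for i
  proof -
    have "(t^2)^i = (t^i)^2" by (simp add: power_mult[symmetric] mult.commute)
    then show ?thesis by (simp add: algebra_simps power2_eq_square)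
  qed
  then show ?thesis unfolding qpoch_def prod.distrib[symmetric] by simp
qed

text \<open>Each quotient of shifted products telescopes to its two end factors. With
  \<open>r^2 = a\<close> this is the very-well-poised factor
  \<open>(1 - a*t^(2*n)) / (1 - a)\<close>, in a form free of divisions.\<close>

lemma qpoch_sqrt_pair:
  "qpoch (r*t) t n * qpoch (-(r*t)) t n * (1 - r^2) = qpoch r t n * qpoch (-r) t n * (1 - r^2 * t^(2*n))"
proof -
  have r: "qpoch (s*t) t n * (1-s) = qpoch s t n * (1 - s*t^n)" for s
    using qpoch_Suc_left[of s t n] qpoch_Suc[of s t n] by (simp add: mult_ac)
  have a: "(1-r)*(1-(-r)) = 1 - r^2" "(1-r*t^n)*(1-(-r)*t^n) = 1 - r^2 * t^(2*n)"
    by (auto simp: power_mult algebra_simps power2_eq_square power_mult_distrib)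
  show ?thesis
    unfolding a[symmetric] using arg_cong2[of _ _ _ _ "(*)", OF r[of r] r[of "-r"]] by (simp add: mult_ac)
qed

section \<open>A terminating q-Whipple sum\<close>

text \<open>The telescoping step of \<open>whipple_term_step_Suc\<close> without the common factors,
  where \<open>p = q^(j+1)\<close> and \<open>L = q^(k+1)\<close>: the terms of levels
  \<open>k+1\<close> and \<open>k\<close> on the left, the difference of consecutive partial sums on
  the right.\<close>

lemma whipple_certificate:
  fixes a d L p :: complex
  assumes "a \<noteq> 0" "d \<noteq> 0" "p \<noteq> 0"
  shows "(1-a*p^2) * ((1-a*L/d)*(1-L*p)*(1-L/(a*p))*(1-p/d)*(1-a*d*p)
            + (1-L/(a*d))*(1-d*p)*(1-a*p/d)*(1-L/p)*(1-a*L*p))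
    = (1-L/d) * ((1-a^2*p^2)*(1-d*p)*(1-p/d)*(1-L*p)*(1-L/p)
            + (1-p^2)*(1-a*p/d)*(1-a*d*p)*(1-a*L*p)*(1-L/(a*p)))"
proof -
  \<comment> \<open>With the inverses as variables the claim is a polynomial identity modulo the
    relations \<open>h\<close>.\<close>
  define b e r where "b = 1/a" and "e = 1/d" and "r = 1/p"
  have h: "a*b = 1" "d*e = 1" "p*r = 1" using assms by (auto simp: b_def e_def r_def)
  have "(1-a*p^2) * ((1-a*L*e)*(1-L*p)*(1-L*b*r)*(1-p*e)*(1-a*d*p)
            + (1-L*b*e)*(1-d*p)*(1-a*p*e)*(1-L*r)*(1-a*L*p))
    = (1-L*e) * ((1-a^2*p^2)*(1-d*p)*(1-p*e)*(1-L*p)*(1-L*r)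
            + (1-p^2)*(1-a*p*e)*(1-a*d*p)*(1-a*L*p)*(1-L*b*r))"
    using h by algebra
  then show ?thesis by (simp add: b_def e_def r_def divide_inverse mult.assoc)
qed

text \<open>
  Multiplied by \<open>(ad, aq/d; q)\<^sub>k\<close>, so that the recurrence may shift \<open>d\<close> without
  meeting zero denominators; similarly \<open>(q/a; q)\<^sub>k\<^sub>-\<^sub>n\<close> stands for the usual
  \<open>1/(aq\<^sup>-\<^sup>k; q)\<^sub>n\<close>, which may be undefined for \<open>a = q\<^sup>j\<close>.
\<close>
definition whipple_term :: "complex \<Rightarrow> complex \<Rightarrow> complex \<Rightarrow> nat
  \<Rightarrow> nat \<Rightarrow> complex" where
  "whipple_term a d q k n = (-1)^n * qpoch (a^2) (q^2) n / qpoch (q^2) (q^2) n * (1 - a * q^(2*n))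
     * qpoch d q n * qpoch (q/d) q n * qpoch (a*d*q^n) q (k-n) * qpoch (a*q^(n+1)/d) q (k-n)
     * qpoch q q (k+n) * qpoch (q/a) q (k-n) / (qpoch q q (k-n) * qpoch (a*q) q (k+n))"

text \<open>Closed form of the sum over \<open>n <= m\<close>, for \<open>m <= k\<close>, of the
  terms at \<open>(k+1, d)\<close> minus \<open>(d - q^(k+1)/a) * (1 - a*q^k/d)\<close> times the
  terms at \<open>(k, q*d)\<close>.\<close>

definition whipple_partial :: "complex \<Rightarrow> complex \<Rightarrow> complex \<Rightarrow> nat
  \<Rightarrow> nat \<Rightarrow> complex" where
  "whipple_partial a d q k m = (1-d) * (1 - q^(k+1)/d)
    * (-1)^m * qpoch (a^2) (q^2) (Suc m) / qpoch (q^2) (q^2) m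
     * qpoch (d*q) q m * qpoch (q/d) q m * qpoch (a*d*q^(m+1)) q (k-m) * qpoch (a*q^(m+1)/d) q (k-m)
     * qpoch q q (k+1+m) * qpoch (q/a) q (k-m) / (qpoch q q (k-m) * qpoch (a*q) q (k+1+m))"

lemma whipple_term_step_0:
  assumes nz: "a \<noteq> 0" "d \<noteq> 0" "q \<noteq> 0"
    and q: "qpoch q q (Suc k) \<noteq> 0" and aq: "qpoch (a*q) q (Suc k) \<noteq> 0"
  shows "whipple_term a d q (Suc k) 0 - (d - q^(k+1)/a) * (1 - a*q^k/d) * whipple_term a (q*d) q k 0
    = whipple_partial a d q k 0"
proof -
  define L where "L = q^(k+1)"
  \<comment> \<open>Replacing \<open>d\<close> by \<open>q*d\<close> turns
    \<open>(aq/d; q)_k\<close> into \<open>(a/d; q)_k\<close>; the factor \<open>1 - a*q^k/d\<close>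
    of the recurrence completes the latter to \<open>k+1\<close> factors.\<close>
  have *: "qpoch (a*q/d) q k * (1-a/d) = (1 - a*q^k/d) * qpoch (a/d) q k"
    using qpoch_Suc_left[of "a/d" q k] qpoch_Suc[of "a/d" q k] by (simp add: mult_ac)
  define Z where "Z = qpoch (a/d) q k"
  define Z2 where "Z2 = qpoch (a*q/d) q k"
  define W where "W = qpoch (a*d*q) q k * qpoch (q/a) q k / qpoch (a*q) q k / (1-a*L)"
  have n1: "qpoch q q k \<noteq> 0" "1 - L \<noteq> 0" "qpoch (a*q) q k \<noteq> 0" "1 - a*L \<noteq> 0"
    using q aq by (auto simp: qpoch_Suc L_def mult_ac)
  have s: "qpoch (a*d) q (Suc k) = (1-a*d) * qpoch (a*d*q) q k" "qpoch (a*q/d) q (Suc k) = Z2 * (1-a*L/d)"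
    "qpoch q q (Suc k) = qpoch q q k * (1-L)" "qpoch (q/a) q (Suc k) = qpoch (q/a) q k * (1-L/a)"
    "qpoch (a*q) q (Suc k) = qpoch (a*q) q k * (1-a*L)"
    by (simp_all add: qpoch_Suc_left[of "a*d"]) (simp_all add: qpoch_Suc Z2_def L_def mult_ac)
  have 1: "whipple_term a d q (Suc k) 0 = (1-a) * W * Z2 * (1-a*d)*(1-a*L/d)*(1-L/a)"
    unfolding whipple_term_def W_def using n1 by (simp add: s)
  have 2: "whipple_term a (q*d) q k 0 = (1-a) * W * Z * (1-a*L)"
    unfolding whipple_term_def W_def Z_def using n1 nz by (simp add: mult_ac)
  have 3: "whipple_partial a d q k 0 = (1-d) * (1-L/d) * (1-a^2) * W * Z2 * (1-L)"
    unfolding whipple_partial_def W_def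
    using n1 by (simp add: s qpoch_Suc[of _ _ 0] flip: L_def Z2_def) (simp add: mult_ac L_def)
  define b e where "b = 1/a" and "e = 1/d"
  have h: "a*b = 1" "d*e = 1" using nz by (auto simp: b_def e_def)
  have id: "(1-a) * ((1-a*L*e)*(1-L*b)*(1-a*d) - (d-L*b)*(1-a*e)*(1-a*L)) = (1-L*e)*(1-a^2)*(1-d)*(1-L)"
    using h by algebra
  have gen: "(1-a)*W*Z2*(1-a*d)*x*(1-y) - (d-y)*X*((1-a)*W*Z*(1-a*L))
      = (1-a)*W*(Z2*(1-a*d)*x*(1-y) - (d-y)*(X*Z)*(1-a*L))" for x y X
    by algebra
  have gen': "(1-a)*W*(Z2*u*x*(1-y) - (d-y)*(Z2*X) * v) = W*Z2*((1-a)*(x*(1-y)*u - (d-y)*X * v))"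
    for u v x y X by algebra
  have id': "(1-a) * ((1-a*L/d)*(1-L/a)*(1-a*d) - (d-L/a)*(1-a/d)*(1-a*L)) = (1-L/d)*(1-a^2)*(1-d)*(1-L)"
    using id by (simp add: b_def e_def)
  have "whipple_term a d q (Suc k) 0 - (d - q^(k+1)/a) * (1 - a*q^k/d) * whipple_term a (q*d) q k 0
    = (1-a) * W * (Z2 * (1-a*d)*(1-a*L/d)*(1-L/a) - (d-L/a) * ((1 - a*q^k/d) * Z) * (1-a*L))"
    unfolding 1 2 L_def[symmetric] by (rule gen)
  also have "(1 - a*q^k/d) * Z = Z2 * (1-a/d)" using * by (simp add: Z_def Z2_def)
  also have "(1-a) * W * (Z2 * (1-a*d)*(1-a*L/d)*(1-L/a) - (d-L/a) * (Z2 * (1-a/d)) * (1-a*L))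
     = W * Z2 * ((1-a) * ((1-a*L/d)*(1-L/a)*(1-a*d) - (d-L/a)*(1-a/d)*(1-a*L)))"
    by (rule gen')
  also have "\<dots> = whipple_partial a d q k 0" unfolding id' 3 by simp
  finally show ?thesis .
qed

text \<open>All four quantities are \<open>W * Z2\<close> times an expression in
  \<open>p = q^(j+1)\<close> and \<open>L = q^(k+1)\<close>, which leaves
  \<open>whipple_certificate\<close>.\<close>

lemma whipple_term_step_Suc:
  assumes nz: "a \<noteq> 0" "d \<noteq> 0" "q \<noteq> 0" and k: "k = Suc j + i"
    and q: "qpoch q q (Suc k) \<noteq> 0" and q2: "qpoch (q^2) (q^2) (Suc k) \<noteq> 0"
    and aq: "qpoch (a*q) q (2*k+2) \<noteq> 0"
  shows "whipple_term a d q (Suc k) (Suc j) - (d - q^(k+1)/a)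
    * (1 - a*q^k/d) * whipple_term a (q*d) q k (Suc j)
    = whipple_partial a d q k (Suc j) - whipple_partial a d q k j"
proof -
  define p r L where "p = q^(Suc j)" and "r = q^(Suc i)" and "L = q^(Suc k)"
  have L: "L = p * r" "L = q^(k+1)" by (simp_all add: L_def p_def r_def k power_add mult_ac)
  have r: "r = L/p" using nz by (simp add: L p_def)
  define U D E Z1 Z2 F G J V where "U = (-1)^Suc j * qpoch (a^2) (q^2) (Suc j) / qpoch (q^2) (q^2) (Suc j)"
    and "D = qpoch (d*q) q j" and "E = qpoch (q/d) q j" and "Z1 = qpoch (a*d*q*p) q i"
    and "Z2 = qpoch (a*q*p/d) q i" and "F = qpoch q q (k+Suc j)" and "G = qpoch (a*q) q (k+Suc j)"
    and "J = qpoch (q/a) q i" and "V = qpoch q q i"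
  have n: "V \<noteq> 0" "1 - r \<noteq> 0" "G \<noteq> 0" "1 - a*L*p \<noteq> 0" "1 - p^2 \<noteq> 0"
    "qpoch (q^2) (q^2) j \<noteq> 0"
    subgoal using q by (auto simp: V_def qpoch_eq_0_iff k)
    subgoal using q unfolding qpoch_eq_0_iff by (auto simp: r_def k)
    subgoal using aq unfolding qpoch_eq_0_iff G_def by (auto simp: k)
    subgoal proof -
        have "a * q * q ^ (k + Suc j) \<noteq> 1" by (rule qpoch_nonzeroD[OF aq]) (simp add: k)
        then show ?thesis by (simp add: L_def p_def power_add mult_ac)
      qed
    subgoal proof -
        have "q^2 * (q^2)^j \<noteq> 1" using q2 unfolding qpoch_eq_0_iff by (simp add: k)
        then show ?thesis by (simp add: p_def power_add mult_ac power_mult_distrib flip: power_mult)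
      qed
    subgoal using q2 by (auto simp: qpoch_eq_0_iff k)
    done
  define W where "W = (1-d) * U * D * E * Z1 * F * J / (V * G * (1-r) * (1-a*L*p))"
  have p2: "q^(2 * Suc j) = p^2" "q^2*(q^2)^j = p^2" "(q^2)^Suc j = p^2"
    by (simp_all add: p_def power_even_eq power2_eq_square power_mult_distrib mult_ac mult_2_right power_add)
  have Dd: "qpoch d q (Suc j) = (1-d)*D" by (simp add: D_def qpoch_Suc_left)
  have Ed: "qpoch (q/d) q (Suc j) = E*(1-p/d)" by (simp add: E_def qpoch_Suc p_def)
  have Ddq: "qpoch (q*d) q (Suc j) = D*(1-d*p)" by (simp add: D_def qpoch_Suc p_def mult_ac)
  have Edq: "qpoch (q/(q*d)) q (Suc j) = (1-1/d)*E" using nz by (simp add: E_def qpoch_Suc_left)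
  have Z1a: "qpoch (a*d*p) q (Suc i) = (1-a*d*p)*Z1" by (simp add: Z1_def qpoch_Suc_left mult_ac)
  have Z2a: "qpoch (a*q*p/d) q (Suc i) = Z2*(1-a*L/d)" by (simp add: Z2_def qpoch_Suc L r_def mult_ac)
  have Z2b: "qpoch (a*p/d) q (Suc i) = (1-a*p/d)*Z2" by (simp add: Z2_def qpoch_Suc_left mult_ac)
  have Z2c: "(1 - a*q^k/d) * qpoch (a*p/d) q i = (1-a*p/d)*Z2"
    using Z2b by (simp add: qpoch_Suc p_def k power_add mult_ac)
  have Fa: "qpoch q q (Suc (k+Suc j)) = F*(1-L*p)"
    by (simp add: F_def qpoch_Suc L_def p_def power_add mult_ac)
  have Ga: "qpoch (a*q) q (Suc (k+Suc j)) = G*(1-a*L*p)"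
    by (simp only: G_def qpoch_Suc L_def p_def) (simp add: power_add mult_ac)
  have Ja: "qpoch (q/a) q (Suc i) = J*(1-r/a)" by (simp add: J_def qpoch_Suc r_def)
  have Va: "qpoch q q (Suc i) = V*(1-r)" by (simp add: V_def qpoch_Suc r_def)
  have Uj: "(-1)^j * qpoch (a^2) (q^2) (Suc j) / qpoch (q^2) (q^2) j = - U * (1-p^2)"
    using n by (simp add: U_def qpoch_Suc p2)
  have Ua: "(-1)^(Suc j) * qpoch (a^2) (q^2) (Suc (Suc j)) / qpoch (q^2) (q^2) (Suc j) = U * (1-a^2*p^2)"
    unfolding U_def qpoch_Suc[of _ _ "Suc j"] p2 by simp
  have e1: "Suc k - Suc j = Suc i" "k - Suc j = i" "k - j = Suc i" by (auto simp: k)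
  have e2: "a*d*q^Suc j = a*d*p" "a*q^(Suc j+1)/d = a*q*p/d" "a*(q*d)*q^Suc j = a*d*q*p"
     "a*q^(Suc j+1)/(q*d) = a*p/d" "a*d*q^(Suc j+1) = a*d*q*p" "a*d*q^(j+1) = a*d*p" "a*q^(j+1)/d = a*p/d"
    using nz by (auto simp: p_def)
  have e3: "Suc k + Suc j = Suc (k + Suc j)" "k + 1 + Suc j = Suc (k + Suc j)" "k+1+j = k + Suc j" by auto
  have 1: "whipple_term a d q (Suc k) (Suc j) =
      W * Z2 * ((1-a*p^2)*((1-a*L/d)*(1-L*p)*(1-L/(a*p))*(1-p/d)*(1-a*d*p)))"
    unfolding whipple_term_def U_def[symmetric] e1 e2 e3 Dd Ed Z1a Z2a Fa Ga Ja Va p2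
    using n by (simp add: W_def r mult_ac)
  have 2: "(1 - a*q^k/d) * whipple_term a (q*d) q k (Suc j) =
      U * (1-a*p^2) * (D*(1-d*p)) * ((1-1/d)*E) * Z1 * ((1-a*p/d)*Z2) * F * J / (V*G)"
    unfolding whipple_term_def U_def[symmetric] e1 e2 e3 Ddq Edq Z1_def[symmetric] F_def[symmetric]
      J_def[symmetric] V_def[symmetric] G_def[symmetric] p2 Z2c[symmetric]
    by (simp add: mult_ac)
  have 2: "(d - q^(k+1)/a) * (1 - a*q^k/d) * whipple_term a (q*d) q k (Suc j) =
      - W * Z2 * ((1-a*p^2)*((1-L/(a*d))*(1-d*p)*(1-a*p/d)*(1-L/p)*(1-a*L*p)))"
  proof -
    \<comment> \<open>The shift of \<open>d\<close> produces \<open>1-1/d\<close> instead of the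
      common factor \<open>1-d\<close>. The sign picked up here turns the difference of terms into
      the sum in \<open>whipple_certificate\<close>.\<close>
    have x: "(d - L/a) * (1-1/d) = - ((1-d)*(1-L/(a*d)))" using nz by (simp add: field_simps)
    have "(d - q^(k+1)/a) * (1 - a*q^k/d) * whipple_term a (q*d) q k (Suc j) =
      ((d - L/a) * (1-1/d)) * (U * (1-a*p^2) * (D*(1-d*p)) * E * Z1 * ((1-a*p/d)*Z2) * F * J / (V*G))"
      unfolding mult.assoc 2[unfolded mult.assoc] L(2) by (simp add: mult_ac)
    also have "\<dots> = - W * Z2 * ((1-a*p^2)*((1-L/(a*d))*(1-d*p)*(1-a*p/d)*(1-L/p)*(1-a*L*p)))"
      unfolding x W_def r[symmetric] using n by (simp add: mult_ac)
    finally show ?thesis .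
  qed
  have 3: "whipple_partial a d q k (Suc j)
    = W * Z2 * ((1-L/d) * ((1-a^2*p^2)*(1-d*p)*(1-p/d)*(1-L*p)*(1-L/p)))"
  proof -
    have "whipple_partial a d q k (Suc j)
      = (1-d) * (1 - L/d) * (U * (1-a^2*p^2)) * (D*(1-d*p)) * (E*(1-p/d)) * Z1 * Z2
       * (F*(1-L*p)) * J / (V * (G*(1-a*L*p)))"
      unfolding whipple_partial_def Ua[symmetric] e1 e2 e3 Ddq[unfolded mult.commute[of q d]] Ed
        Z1_def[symmetric] Z2_def[symmetric] Fa Ga
        J_def[symmetric] V_def[symmetric] L(2) by simp
    also have "\<dots> = W * Z2 * (1-L/d) * ((1-a^2*p^2)*(1-d*p)*(1-p/d)*(1-L*p)*(1-r))"
      using n by (simp add: W_def mult_ac)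
    finally show ?thesis by (simp add: r)
  qed
  have 4: "whipple_partial a d q k j
    = - W * Z2 * ((1-L/d) * ((1-p^2)*(1-a*p/d)*(1-a*d*p)*(1-a*L*p)*(1-L/(a*p))))"
  proof -
    have "whipple_partial a d q k j
      = (1-d) * (1 - L/d) * ((-1)^j * qpoch (a^2) (q^2) (Suc j) / qpoch (q^2) (q^2) j)
       * D * E * ((1-a*d*p)*Z1) * ((1-a*p/d)*Z2) * F * (J*(1-r/a)) / (V*(1-r) * G)"
      unfolding whipple_partial_def e1 e2 e3 Z1a Z2b F_def[symmetric] G_def[symmetric] Ja Va
        D_def[symmetric] E_def[symmetric] L(2) by simp
    also have "\<dots> = - W * Z2 * (1-L/d) * ((1-p^2)*(1-a*p/d)*(1-a*d*p)*(1-a*L*p)*(1-r/a))"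
      unfolding Uj using n by (simp add: W_def mult_ac)
    finally show ?thesis by (simp add: r mult_ac)
  qed
  have gen: "W*Z2*(x*y) - (-W*Z2*(x*u)) = W*Z2*(x*(y+u))" for x y u by algebra
  have p0: "p \<noteq> 0" using nz by (simp add: p_def)
  have "whipple_term a d q (Suc k) (Suc j) - (d - q^(k+1)/a)
    * (1 - a*q^k/d) * whipple_term a (q*d) q k (Suc j)
     = W * Z2 * ((1-a*p^2) * ((1-a*L/d)*(1-L*p)*(1-L/(a*p))*(1-p/d)*(1-a*d*p)
            + (1-L/(a*d))*(1-d*p)*(1-a*p/d)*(1-L/p)*(1-a*L*p)))"
    unfolding 1 2 by (rule gen)
  also have "\<dots> = whipple_partial a d q k (Suc j) - whipple_partial a d q k j"
    unfolding whipple_certificate[OF nz(1,2) p0] 3 4 by (rule gen[symmetric])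
  finally show ?thesis .
qed

text \<open>The recurrence coefficients collected on the way from \<open>(k, d)\<close> down to
  \<open>(0, d*q^k)\<close>, each multiplied by \<open>a\<close>; hence the factor
  \<open>a^k\<close> in \<open>whipple_sum\<close>.\<close>

definition whipple_product :: "complex \<Rightarrow> complex \<Rightarrow> complex \<Rightarrow> nat
  \<Rightarrow> complex" where
  "whipple_product a d q k = (\<Prod>i<k. (a*d*q^i - q^(k-i)) * (1 - a * q^(k-1-i) / (d*q^i)))"

lemma whipple_product_0 [simp]: "whipple_product a d q 0 = 1" by (simp add: whipple_product_def)

lemma whipple_product_Suc: "whipple_product a d q (Suc k)
  = (a*d - q^(k+1)) * (1 - a*q^k/d) * whipple_product a (q*d) q k"
  by (simp add: whipple_product_def prod.lessThan_Suc_shift mult_ac del: prod.lessThan_Suc)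

text \<open>The one-step recurrence moves \<open>d\<close>; two steps in \<open>k\<close> can be
  compared at the same \<open>d\<close>. Of the four new factors, \<open>1 - a*d*q^k\<close> and
  \<open>1 - a*q^(k+1)/d\<close> cancel against \<open>(ad, aq/d; q)\<close>, and the others advance
  products of base \<open>q^2\<close>.\<close>

lemma whipple_product_Suc_Suc:
  assumes "a \<noteq> 0" "d \<noteq> 0" "q \<noteq> 0"
  shows "whipple_product a d q (Suc (Suc k))
    = whipple_product a d q k * (a*d - q^(k+2)) * (1 - a*q^(k+1)/d) * (1 - a*d*q^k) * (a/d - q^(k+1))"
  using assms
proof (induction k arbitrary: d)
  case 0
  then show ?case by (simp add: whipple_product_Suc field_simps)
next
  case (Suc k)
  have "whipple_product a d q (Suc (Suc (Suc k)))
    = (a*d - q^(k+3)) * (1 - a*q^(k+2)/d) * whipple_product a (q*d) q (Suc (Suc k))"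
    by (subst whipple_product_Suc) (simp add: numeral_eq_Suc)
  also have "whipple_product a (q*d) q (Suc (Suc k))
    = whipple_product a (q*d) q k * (a*(q*d) - q^(k+2)) * (1 - a*q^(k+1)/(q*d)) * (1 - a*(q*d)*q^k)
      * (a/(q*d) - q^(k+1))"
    using Suc.prems by (intro Suc.IH) auto
  also have "(a*d - q^(k+3)) * (1 - a*q^(k+2)/d) * \<dots> =
     ((a*d - q^(k+1)) * (1 - a*q^k/d) * whipple_product a (q*d) q k) * (a*d - q^(Suc k+2))
       * (1 - a*q^(Suc k+1)/d) * (1 - a*d*q^Suc k) * (a/d - q^(Suc k+1))"
  proof -
    define e r x where "e = 1/d" and "r = 1/q" and "x = q^k"
    have h: "d*e = 1" "q*r = 1" using Suc.prems by (auto simp: e_def r_def)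
    have "(a*d - x*q^3) * (1 - a*(x*q^2)*e) * (g * (a*(q*d) - x*q^2) * (1 - a*x*e) * (1 - a*(q*d)*x)
      * (a*r*e - x*q)) =
     ((a*d - x*q) * (1 - a*x*e) * g) * (a*d - x*q^3) * (1 - a*(x*q^2)*e) * (1 - a*d*(x*q))
       * (a*e - x*q^2)" for g
      using h by algebra
    then show ?thesis
      using Suc.prems by (simp add: e_def r_def x_def power_add eval_nat_numeral mult_ac)
  qed
  also have "(a*d - q^(k+1)) * (1 - a*q^k/d) * whipple_product a (q*d) q k = whipple_product a d q (Suc k)"
    by (rule whipple_product_Suc[symmetric])
  finally show ?case .
qed

lemma whipple_sum:
  assumes nz: "a \<noteq> 0" "d \<noteq> 0" "q \<noteq> 0"
    and "qpoch q q k \<noteq> 0" "qpoch (q^2) (q^2) k \<noteq> 0" "qpoch (a*q) q (2*k) \<noteq> 0"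
  shows "a^k * (\<Sum>n\<le>k. whipple_term a d q k n) = (1-a) * whipple_product a d q k"
  using assms
proof (induction k arbitrary: d)
  case 0
  then show ?case by (simp add: whipple_term_def)
next
  case (Suc k)
  have nz: "a \<noteq> 0" "d \<noteq> 0" "q \<noteq> 0" by fact+
  note P = Suc.prems(4-)
  have nz': "qpoch q q k \<noteq> 0" "qpoch (q^2) (q^2) k \<noteq> 0" "qpoch (a*q) q (2*k) \<noteq> 0"
     "qpoch (a*q) q (Suc k) \<noteq> 0" "qpoch (a*q) q (2*k+2) \<noteq> 0"
    using P unfolding qpoch_eq_0_iff by auto
  define c where "c = (d - q^(k+1)/a) * (1 - a*q^k/d)"
  have part: "(\<Sum>n\<le>m. whipple_term a d q (Suc k) n - c * whipple_term a (q*d) q k n)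
    = whipple_partial a d q k m" if "m \<le> k" for m
    using that
  proof (induction m)
    case 0
    then show ?case using whipple_term_step_0[OF nz P(1) nz'(4)] by (simp add: c_def)
  next
    case (Suc m)
    then obtain i where k: "k = Suc m + i" by (metis le_add_diff_inverse)
    show ?case using whipple_term_step_Suc[OF nz k P(1,2) nz'(5)] Suc
      by (simp add: c_def)
  qed
  \<comment> \<open>The term \<open>n = k+1\<close> has no counterpart at level \<open>k\<close>. It
    cancels the accumulated partial sum, so that the recurrence for the full sums is
    homogeneous.\<close>
  have last: "whipple_term a d q (Suc k) (Suc k) = - whipple_partial a d q k k"
  proof -
    have n: "1 - q^(2*Suc k) \<noteq> 0" "1 - a*q^(2*Suc k) \<noteq> 0"
      using qpoch_nonzeroD[OF P(2), of k] qpoch_nonzeroD[OF nz'(5), of "2*k+1"]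
      by (auto simp: power_mult power2_eq_square power_mult_distrib algebra_simps power_add mult_2_right)
    have e: "Suc k + Suc k = Suc (k + 1 + k)" by simp
    have s: "qpoch d q (Suc k) = (1-d) * qpoch (d*q) q k" by (rule qpoch_Suc_left)
    have s': "qpoch (q/d) q (Suc k) = qpoch (q/d) q k * (1 - q^(k+1)/d)"
      "qpoch q q (Suc (k+1+k)) = qpoch q q (k+1+k) * (1 - q^(2*Suc k))"
      "qpoch (a*q) q (Suc (k+1+k)) = qpoch (a*q) q (k+1+k) * (1 - a*q^(2*Suc k))"
      "qpoch (q^2) (q^2) (Suc k) = qpoch (q^2) (q^2) k * (1 - q^(2*Suc k))"
      by (simp_all only: qpoch_Suc)
        (simp_all add: power_mult power2_eq_square power_mult_distrib mult_ac power_add)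
    show ?thesis
      unfolding whipple_term_def whipple_partial_def e s s' using n by simp
  qed
  have "(\<Sum>n\<le>Suc k. whipple_term a d q (Suc k) n) = c * (\<Sum>n\<le>k. whipple_term a (q*d) q k n)"
    using part[of k] last by (simp add: sum_subtractf sum_distrib_left algebra_simps)
  then have "a ^ Suc k * (\<Sum>n\<le>Suc k. whipple_term a d q (Suc k) n)
    = a * c * (a^k * (\<Sum>n\<le>k. whipple_term a (q*d) q k n))"
    by simp
  also have "\<dots> = a * c * ((1-a) * whipple_product a (q*d) q k)"
    using nz nz' by (subst Suc.IH) auto
  also have "\<dots> = (1-a) * whipple_product a d q (Suc k)"
    using nz by (simp add: whipple_product_Suc c_def field_simps)
  finally show ?case .
qed

section \<open>Jackson's summation\<close>

text \<open>The telescoping step for Jackson's sum without the common factors, where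
  \<open>p = q^k\<close>, \<open>Q = q^(n+1)\<close> and \<open>b\<close>, \<open>c\<close>,
  \<open>e\<close> are the inverses of \<open>B\<close>, \<open>C\<close>, \<open>D\<close>.\<close>

lemma jackson_certificate:
  fixes A b c e Q p :: complex
  defines "M \<equiv> A * b * c * e"
  shows "p * (1 - A*p^2) *
      ((1-Q)*(1-A*Q*b)*(1-A*Q*c)*(1-A*Q*e) * (p-M*Q)*(1-A*M*Q*p)
       - (1-A*Q*b*c)*(1-A*Q*b*e)*(1-A*Q*c*e)*(1-A*M*Q) * (p-Q)*(1-A*Q*p))
    = - Q*(1-A*M*Q^2) * (A*(b-p)*(c-p)*(e-p)*(1-A*p)*(1-A*M*Q*p)*(p-Q)
       - (1-p)*(1-A*p*b)*(1-A*p*c)*(1-A*p*e)*(p-M*Q)*(1-A*Q*p))"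
proof -
  \<comment> \<open>Both sides are symmetric in \<open>b\<close>, \<open>c\<close>,
    \<open>e\<close>; passing to elementary symmetric functions keeps the polynomial identity
    small.\<close>
  define u r w where "u = b+c+e" and "r = b*c+b*e+c*e" and "w = b*c*e"
  have M: "M = A*w" by (simp add: M_def w_def)
  have 1: "(1-Q)*(1-A*Q*b)*(1-A*Q*c)*(1-A*Q*e) = (1-Q)*(1-A*Q*u+A^2*Q^2*r-A^3*Q^3*w)"
    unfolding u_def r_def w_def by algebra
  have 2: "(1-A*Q*b*c)*(1-A*Q*b*e)*(1-A*Q*c*e) = 1-A*Q*r+A^2*Q^2*u*w-A^3*Q^3*w^2"
    unfolding u_def r_def w_def by algebra
  have 3: "A*(b-p)*(c-p)*(e-p) = A*(w-p*r+p^2*u-p^3)"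
    unfolding u_def r_def w_def by algebra
  have 4: "(1-p)*(1-A*p*b)*(1-A*p*c)*(1-A*p*e) = (1-p)*(1-A*p*u+A^2*p^2*r-A^3*p^3*w)"
    unfolding u_def r_def w_def by algebra
  show ?thesis unfolding 1 2 3 4 M by algebra
qed

text \<open>
  The fourth free parameter and \<open>q\<^sup>-\<^sup>n\<close> are hidden in the factors depending on
  \<open>n - k\<close> and \<open>n + k\<close>. In this form the terms for \<open>n\<close> and \<open>n + 1\<close> differ by a simple factor.
\<close>
definition jackson_term :: "complex \<Rightarrow> complex \<Rightarrow> complex \<Rightarrow> complex
  \<Rightarrow> complex \<Rightarrow> nat \<Rightarrow> nat \<Rightarrow> complex" where
  "jackson_term A B C D q n k = (let M = A/(B*C*D) in
     qpoch A q k * (1 - A * q^(2*k)) * qpoch B q k * qpoch C q k * qpoch D q k * (M*q)^k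
     / (qpoch q q k * qpoch (A*q/B) q k * qpoch (A*q/C) q k * qpoch (A*q/D) q k)
     * (qpoch (M*q) q (n-k) * qpoch (A*M*q) q (n+k) / (qpoch q q (n-k) * qpoch (A*q) q (n+k))))"

text \<open>Closed form of the sum over \<open>k <= m\<close>, for \<open>m <= n\<close>, of
  \<open>c1\<close> times the terms for \<open>n+1\<close> minus \<open>c2\<close> times the terms
  for \<open>n\<close>, with \<open>c1\<close> and \<open>c2\<close> as in
  \<open>jackson_term_step\<close>.\<close>

definition jackson_partial :: "complex \<Rightarrow> complex \<Rightarrow> complex \<Rightarrow> complex
  \<Rightarrow> complex \<Rightarrow> nat \<Rightarrow> nat \<Rightarrow> complex" where
  "jackson_partial A B C D q n m = (let M = A/(B*C*D) in
     - (q^(n+1)) * (1 - A*M*(q^(n+1))^2) * M^(Suc m)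
     * (qpoch A q (Suc m) * qpoch B q (Suc m) * qpoch C q (Suc m) * qpoch D q (Suc m)
     / (qpoch q q m * qpoch (A*q/B) q m * qpoch (A*q/C) q m * qpoch (A*q/D) q m))
     * (qpoch (M*q) q (n-m) * qpoch (A*M*q) q (n+1+m) / (qpoch q q (n-m) * qpoch (A*q) q (n+1+m))))"

text \<open>\<open>c1\<close> and \<open>c2\<close> are the factors that the denominator and the
  numerator of the product side of \<open>jackson_sum\<close> gain from \<open>n\<close> to
  \<open>n+1\<close>. After removal of the common factor \<open>W / p\<close> the claim is
  \<open>jackson_certificate\<close>.\<close>

lemma jackson_term_step:
  fixes A B C D q :: complex and n k :: nat
  defines "c1 \<equiv> (1-q^(n+1)) * (1-A*q^(n+1)/B) * (1-A*q^(n+1)/C) * (1-A*q^(n+1)/D)"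
    and "c2 \<equiv> (1-A*q^(n+1)/(B*C)) * (1-A*q^(n+1)/(B*D)) * (1-A*q^(n+1)/(C*D))
      * (1-A*(A/(B*C*D))*q^(n+1))"
  assumes nz: "q \<noteq> 0" "B \<noteq> 0" "C \<noteq> 0" "D \<noteq> 0" and n: "n = k + i"
    and q: "qpoch q q (Suc n) \<noteq> 0" and Aq: "qpoch (A*q) q (2*n+2) \<noteq> 0"
    and BCD: "qpoch (A*q/B) q n \<noteq> 0" "qpoch (A*q/C) q n \<noteq> 0" "qpoch (A*q/D) q n \<noteq> 0"
  shows "c1 * jackson_term A B C D q (Suc n) k - c2 * jackson_term A B C D q n k
    = jackson_partial A B C D q n k - (if k = 0 then 0 else jackson_partial A B C D q n (k-1))"
proof -
  define M b c e where "M = A/(B*C*D)" and "b = 1/B" and "c = 1/C" and "e = 1/D"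
  define p r Q where "p = q^k" and "r = q^(Suc i)" and "Q = q^(Suc n)"
  have M: "M = A*b*c*e" by (simp add: M_def b_def c_def e_def)
  have Q: "Q = p * r" by (simp add: Q_def p_def r_def n power_add mult_ac)
  have p0: "p \<noteq> 0" using nz by (simp add: p_def)
  have r: "r = Q/p" using p0 by (simp add: Q)
  define Y1 Y2 Y3 Y4 where "Y1 = qpoch (M*q) q i" and "Y2 = qpoch (A*M*q) q (n+k)"
    and "Y3 = qpoch q q i" and "Y4 = qpoch (A*q) q (n+k)"
  define R where "R = qpoch A q k * qpoch B q k * qpoch C q k * qpoch D q k
     / (qpoch q q k * qpoch (A*q/B) q k * qpoch (A*q/C) q k * qpoch (A*q/D) q k)"
  have nz': "Y3 \<noteq> 0" "1 - r \<noteq> 0" "Y4 \<noteq> 0" "1 - A*Q*p \<noteq> 0"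
    subgoal using q by (auto simp: Y3_def qpoch_eq_0_iff n)
    subgoal using qpoch_nonzeroD[OF q, of i] by (simp add: r_def n)
    subgoal using Aq by (auto simp: Y4_def qpoch_eq_0_iff n)
    subgoal using qpoch_nonzeroD[OF Aq, of "n+k"] by (simp add: Q_def p_def n power_add mult_ac)
    done
  have s: "Suc n - k = Suc i" "n - k = i" "Suc n + k = Suc (n+k)" "n + 1 + k = Suc (n + k)"
    by (simp_all add: n)
  have s1: "qpoch (M*q) q (Suc i) = Y1*(1-M*r)" "qpoch q q (Suc i) = Y3*(1-r)"
     "qpoch (A*M*q) q (Suc (n+k)) = Y2*(1-A*M*Q*p)" "qpoch (A*q) q (Suc (n+k)) = Y4*(1-A*Q*p)"
     "q^(2*k) = p^2" "(M*q)^k = M^k * p"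
    by (simp_all only: qpoch_Suc Y1_def Y2_def Y3_def Y4_def r_def Q_def p_def)
      (simp_all add: power_add mult_ac power_mult power2_eq_square power_mult_distrib mult_2_right mult_2)
  define W where "W = R * M^k * Y1 * Y2 / (Y3*Y4*(1-r)*(1-A*Q*p))"
  have 1: "jackson_term A B C D q (Suc n) k = W * p * (1-A*p^2) * ((1-M*r)*(1-A*M*Q*p))"
    unfolding jackson_term_def M_def[symmetric] Let_def s s1 W_def R_def by (simp add: mult_ac)
  have 2: "jackson_term A B C D q n k = W * p * (1-A*p^2) * ((1-r)*(1-A*Q*p))"
    unfolding jackson_term_def M_def[symmetric] Let_def s s1 W_def R_def
      Y1_def[symmetric] Y2_def[symmetric] Y3_def[symmetric] Y4_def[symmetric]
    using nz' by (simp add: mult_ac)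
  have c1: "c1 = (1-Q)*(1-A*Q*b)*(1-A*Q*c)*(1-A*Q*e)"
    by (simp add: c1_def Q_def b_def c_def e_def)
  have c2: "c2 = (1-A*Q*b*c)*(1-A*Q*b*e)*(1-A*Q*c*e)*(1-A*M*Q)"
    by (simp add: c2_def Q_def b_def c_def e_def M_def)
  have 3: "jackson_partial A B C D q n k
     = W / p * (- Q * (1-A*M*Q^2) * (A*(b-p)*(c-p)*(e-p)*(1-A*p)*(1-A*M*Q*p)*(p-Q)))"
  proof -
    have x: "M*((1-B*p)*(1-C*p)*(1-D*p)) = A*(b-p)*(c-p)*(e-p)"
      using nz by (simp add: M_def b_def c_def e_def field_simps)
    have "jackson_partial A B C D q n k =
      - Q * (1-A*M*Q^2) * (M*((1-B*p)*(1-C*p)*(1-D*p))) * M^k * R * (1-A*p) * (Y1*(Y2*(1-A*M*Q*p))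
        / (Y3*(Y4*(1-A*Q*p))))"
      unfolding jackson_partial_def M_def[symmetric] Let_def s s1 R_def Y1_def[symmetric] Y3_def[symmetric]
        qpoch_Suc[of _ _ k] p_def[symmetric] Q_def by (simp add: mult_ac)
    also have "\<dots> = W * (- Q * (1-A*M*Q^2) * (A*(b-p)*(c-p)*(e-p)*(1-A*p)*(1-A*M*Q*p)*(1-r)))"
      unfolding x W_def using nz' by (simp add: mult_ac)
    finally show ?thesis using p0 by (simp add: r field_simps)
  qed
  \<comment> \<open>For \<open>k = 0\<close> the factor \<open>1-p\<close> vanishes, so one formula
    also covers the absent partial sum.\<close>
  have 4: "(if k = 0 then 0 else jackson_partial A B C D q n (k-1))
     = W / p * (- Q * (1-A*M*Q^2) * ((1-p)*(1-A*p*b)*(1-A*p*c)*(1-A*p*e)*(p-M*Q)*(1-A*Q*p)))"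
  proof (cases k)
    case 0
    then show ?thesis by (simp add: p_def)
  next
    case (Suc j)
    have p: "q * q^j = p" by (simp add: p_def Suc)
    have "qpoch q q k \<noteq> 0" "qpoch (A*q/B) q k \<noteq> 0" "qpoch (A*q/C) q k \<noteq> 0"
      "qpoch (A*q/D) q k \<noteq> 0"
      using q BCD by (auto simp: qpoch_eq_0_iff n)
    then have nz2: "1-p \<noteq> 0" "1-A*p*b \<noteq> 0" "1-A*p*c \<noteq> 0" "1-A*p*e \<noteq> 0"
      by (auto simp: Suc qpoch_Suc b_def c_def e_def mult_ac p_def)
    have d: "qpoch q q k = qpoch q q j * (1-p)" "qpoch (A*q/B) q k = qpoch (A*q/B) q j * (1-A*p*b)"
     "qpoch (A*q/C) q k = qpoch (A*q/C) q j * (1-A*p*c)" "qpoch (A*q/D) q k = qpoch (A*q/D) q j * (1-A*p*e)"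
      unfolding Suc qpoch_Suc by (simp_all add: b_def c_def e_def p_def Suc mult_ac)
    have s': "n - j = Suc i" "n + 1 + j = n + k" "Suc j = k" using Suc n by auto
    have "jackson_partial A B C D q n j =
      - Q * (1-A*M*Q^2) * M^k * (R * ((1-p)*(1-A*p*b)*(1-A*p*c)*(1-A*p*e))) * (Y1*(1-M*r)*Y2 / (Y3*(1-r)*Y4))"
      unfolding jackson_partial_def M_def[symmetric] Let_def s' s1 R_def Y2_def[symmetric] Y4_def[symmetric]
        d Q_def
      using nz2 by (simp add: mult_ac)
    also have "\<dots> = W * (- Q * (1-A*M*Q^2) * ((1-p)*(1-A*p*b)*(1-A*p*c)*(1-A*p*e)*(1-M*r)*(1-A*Q*p)))"
      unfolding W_def using nz' by (simp add: mult_ac)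
    finally show ?thesis using p0 Suc by (simp add: r field_simps)
  qed
  have "c1 * jackson_term A B C D q (Suc n) k - c2 * jackson_term A B C D q n k
    = W * (1-A*p^2) * (c1*((p-M*Q)*(1-A*M*Q*p)) - c2*((p-Q)*(1-A*Q*p)))"
  proof -
    have pr: "p - M*Q = p*(1-M*r)" "p - Q = p*(1-r)" by (simp_all add: Q algebra_simps)
    have "c1*(W*p*x*(y*z)) - c2*(W*p*x*(u*t)) = W*x*(c1*((p*y)*z) - c2*((p*u)*t))" for x y z u t
      by algebra
    then show ?thesis unfolding 1 2 pr .
  qed
  also have "\<dots> = W / p * (p * (1-A*p^2) * (c1*(p-M*Q)*(1-A*M*Q*p) - c2*(p-Q)*(1-A*Q*p)))"
    using p0 by (simp add: mult.assoc)
  also note jackson_certificate[of p A Q b c e, folded M, folded c1 c2]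
  finally show ?thesis unfolding 3 4 by (simp only: right_diff_distrib)
qed

text \<open>Induction on \<open>n\<close>. The term \<open>k = n+1\<close> cancels the partial sum
  of the differences, which leaves \<open>c1\<close> times the sum for \<open>n+1\<close> equal to
  \<open>c2\<close> times the sum for \<open>n\<close>.\<close>

lemma jackson_sum:
  assumes nz: "q \<noteq> 0" "B \<noteq> 0" "C \<noteq> 0" "D \<noteq> 0"
    and "qpoch q q n \<noteq> 0" "qpoch (A*q) q (2*n) \<noteq> 0"
    and "qpoch (A*q/B) q n \<noteq> 0" "qpoch (A*q/C) q n \<noteq> 0" "qpoch (A*q/D) q n \<noteq> 0"
  shows "(\<Sum>k\<le>n. jackson_term A B C D q n k)
    = (1-A) * qpochs [A*q/(B*C), A*q/(B*D), A*q/(C*D), A*(A/(B*C*D))*q] q n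
      / qpochs [q, A*q/B, A*q/C, A*q/D] q n"
  using assms(5-)
proof (induction n)
  case 0
  then show ?case by (simp add: jackson_term_def qpochs_def Let_def)
next
  case (Suc n)
  note P = Suc.prems
  have n: "qpoch q q n \<noteq> 0" "qpoch (A*q) q (2*n) \<noteq> 0" "qpoch (A*q) q (2*n+2) \<noteq> 0"
    "qpoch (A*q/B) q n \<noteq> 0" "qpoch (A*q/C) q n \<noteq> 0" "qpoch (A*q/D) q n \<noteq> 0"
    using P unfolding qpoch_eq_0_iff by auto
  define c1 where "c1 = (1-q^(n+1)) * (1-A*q^(n+1)/B) * (1-A*q^(n+1)/C) * (1-A*q^(n+1)/D)"
  define c2 where "c2 = (1-A*q^(n+1)/(B*C)) * (1-A*q^(n+1)/(B*D)) * (1-A*q^(n+1)/(C*D))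
    * (1-A*(A/(B*C*D))*q^(n+1))"
  have c1: "c1 \<noteq> 0" using P unfolding qpoch_Suc c1_def by (simp add: mult_ac)
  have part: "(\<Sum>k\<le>m. c1 * jackson_term A B C D q (Suc n) k - c2 * jackson_term A B C D q n k)
    = jackson_partial A B C D q n m"
    if "m \<le> n" for m
    using that
  proof (induction m)
    case 0
    show ?case using jackson_term_step[OF nz add_0[symmetric] P(1) n(3-6)] by (simp add: c1_def c2_def)
  next
    case (Suc m)
    then obtain i where k: "n = Suc m + i" by (metis le_add_diff_inverse)
    show ?case using jackson_term_step[OF nz k P(1) n(3-6)] Suc by (simp add: c1_def c2_def)
  qed
  have last: "c1 * jackson_term A B C D q (Suc n) (Suc n) = - jackson_partial A B C D q n n"
  proof -
    define M where "M = A/(B*C*D)"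
    have e: "Suc n + Suc n = Suc (n+1+n)" by simp
    define w1 w2 w3 w4 w5 where "w1 = 1-q^(n+1)" and "w2 = 1-A*q^(n+1)/B" and "w3 = 1-A*q^(n+1)/C"
      and "w4 = 1-A*q^(n+1)/D" and "w5 = 1-A*q^(2*Suc n)"
    have s: "qpoch q q (Suc n) = qpoch q q n * w1" "qpoch (A*q/B) q (Suc n) = qpoch (A*q/B) q n * w2"
      "qpoch (A*q/C) q (Suc n) = qpoch (A*q/C) q n * w3" "qpoch (A*q/D) q (Suc n) = qpoch (A*q/D) q n * w4"
      "qpoch (A*M*q) q (Suc (n+1+n)) = qpoch (A*M*q) q (n+1+n) * (1-A*M*(q^(n+1))^2)"
      "qpoch (A*q) q (Suc (n+1+n)) = qpoch (A*q) q (n+1+n) * w5"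
      unfolding w1_def w2_def w3_def w4_def w5_def
      by (simp_all only: qpoch_Suc)
       (simp_all add: power_mult power2_eq_square power_mult_distrib mult_ac power_add)
    have c1w: "c1 = w1 * w2 * w3 * w4" by (simp add: c1_def w1_def w2_def w3_def w4_def)
    have "qpoch (A*q) q (Suc (n+1+n)) \<noteq> 0" using n(3) by (simp add: mult_2)
    then have "w1 \<noteq> 0" "w2 \<noteq> 0" "w3 \<noteq> 0" "w4 \<noteq> 0" "w5 \<noteq> 0"
      using c1 unfolding s c1w by auto
    then show ?thesis
      unfolding jackson_term_def jackson_partial_def M_def[symmetric] Let_def e s c1w w5_def[symmetric]
      by (simp add: power_mult_distrib mult_ac)
  qed
  have "c1 * (\<Sum>k\<le>Suc n. jackson_term A B C D q (Suc n) k)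
    = c2 * (\<Sum>k\<le>n. jackson_term A B C D q n k)"
    using part[of n] last by (simp add: sum_subtractf sum_distrib_left algebra_simps)
  then have "(\<Sum>k\<le>Suc n. jackson_term A B C D q (Suc n) k)
    = c2 / c1 * (\<Sum>k\<le>n. jackson_term A B C D q n k)"
    using c1 by (simp add: field_simps)
  also have "\<dots> = (1-A) * qpochs [A*q/(B*C), A*q/(B*D), A*q/(C*D), A*(A/(B*C*D))*q] q (Suc n)
      / qpochs [q, A*q/B, A*q/C, A*q/D] q (Suc n)"
    unfolding Suc.IH[OF n(1,2,4-6)] by (simp add: qpochs_def qpoch_Suc c1_def c2_def mult_ac)
  finally show ?case .
qed

section \<open>The Bailey lemma for the change of base parameter from \<open>a\<close> to
  \<open>q\<close>\<close>

definition bailey_kernel :: "complex \<Rightarrow> complex \<Rightarrow> complex \<Rightarrow> complex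
  \<Rightarrow> complex \<Rightarrow> nat \<Rightarrow> nat \<Rightarrow> complex" where
  "bailey_kernel b q y z w N k = qpochs [y, z, w, 1/q^N] q k / qpochs [b*q/y, b*q/z, b*q/w, b*q^(N+1)] q k"

text \<open>Back to the classical form with upper parameters \<open>q^(-R)\<close> and
  \<open>A*M*q^(R+1)\<close>: the products of length \<open>R-j\<close> are complements in products
  of length \<open>R\<close>, and their reversal produces
  \<open>(q^(-R); q)_j / (q^(-R)/M; q)_j\<close>.\<close>

lemma jackson_term_standard:
  fixes A B C D M q :: complex and R j :: nat
  defines "M \<equiv> A / (B*C*D)"
  assumes nz: "q \<noteq> 0" "M \<noteq> 0" and j: "j \<le> R"
    and R: "qpoch q q R \<noteq> 0" "qpoch (M*q) q R \<noteq> 0" and Aq: "qpoch (A*q) q R \<noteq> 0"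
  shows "jackson_term A B C D q R j * (qpoch q q R * qpoch (A*q) q R)
     = qpoch (M*q) q R * qpoch (A*M*q) q R *
      (qpoch A q j * (1 - A * q^(2*j)) * qpoch B q j * qpoch C q j * qpoch D q j * qpoch (1/q^R) q j
        * qpoch (A*M*q^(R+1)) q j * q^j
       / (qpoch q q j * qpoch (A*q/B) q j * qpoch (A*q/C) q j * qpoch (A*q/D) q j * qpoch (1/(M*q^R)) q j
         * qpoch (A*q^(R+1)) q j))"
proof -
  define P where "P = q^(R+1-j)"
  have R1: "q^(R+1) = P * q^j" unfolding P_def using j by (simp flip: power_add)
  have R2: "q^R = P * q^j / q" using R1 nz by (simp add: field_simps)
  have q0: "P \<noteq> 0" using nz by (simp add: P_def)
  have s1: "qpoch (x*q) q R = qpoch (x*q) q (R-j) * qpoch (x*P) q j" for x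
    using qpoch_add[of "x*q" q "R-j" j] j by (simp add: P_def Suc_diff_le mult_ac)
  have s2: "qpoch x q (R+j) = qpoch x q R * qpoch (x*q^R) q j" for x
    by (rule qpoch_add)
  have rev: "qpoch (1/q^R) q j * qpoch (M*P) q j = M^j * (qpoch (1/(M*q^R)) q j * qpoch P q j)"
    using qpoch_ratio_reverse[of "1/q^R" "1/(M*q^R)" q j] nz q0 by (simp add: R2)
  have c: "qpoch (M*P) q j \<noteq> 0" "qpoch P q j \<noteq> 0" "qpoch q q (R-j) \<noteq> 0"
    "qpoch (M*q) q (R-j) \<noteq> 0"
    using R s1[of M] s1[of 1] by auto
  define X1 X2 where "X1 = qpoch (1/q^R) q j" and "X2 = qpoch (1/(M*q^R)) q j"
  have "X1 = (\<Prod>i<j. - (1/q^R * q^i)) * qpoch P q j"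
    using qpoch_reverse[of "1/q^R" q j] nz q0 by (simp add: X1_def R2)
  then have "X1 \<noteq> 0" using c nz by simp
  then have X2: "X2 \<noteq> 0" using rev c unfolding X1_def[symmetric] X2_def[symmetric] by auto
  have main: "M^j * qpoch (M*q) q (R-j) / qpoch q q (R-j) * qpoch q q R = qpoch (M*q) q R * X1 / X2"
  proof -
    have "M^j * qpoch P q j * X2 = X1 * qpoch (M*P) q j" using rev unfolding X1_def X2_def
      by (simp add: mult_ac)
    then have "M^j * qpoch P q j = X1 * qpoch (M*P) q j / X2" using X2 by (simp add: field_simps)
    moreover have "M^j * qpoch (M*q) q (R-j) / qpoch q q (R-j) * qpoch q q R
      = qpoch (M*q) q (R-j) * (M^j * qpoch P q j)"
      using s1[of 1] c by simp
    ultimately show ?thesis using s1[of M] by simp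
  qed
  define Y where "Y = qpoch A q j * (1 - A * q^(2*j)) * qpoch B q j * qpoch C q j * qpoch D q j * q^j
     / (qpoch q q j * qpoch (A*q/B) q j * qpoch (A*q/C) q j * qpoch (A*q/D) q j)"
  have "jackson_term A B C D q R j * (qpoch q q R * qpoch (A*q) q R)
     = Y * (M^j * qpoch (M*q) q (R-j) / qpoch q q (R-j) * qpoch q q R)
       * (qpoch (A*M*q) q (R+j) * qpoch (A*q) q R / qpoch (A*q) q (R+j))"
    unfolding jackson_term_def Let_def M_def[symmetric] Y_def by (simp add: power_mult_distrib mult_ac)
  also have "qpoch (A*M*q) q (R+j) * qpoch (A*q) q R / qpoch (A*q) q (R+j)
    = qpoch (A*M*q) q R * qpoch (A*M*q^(R+1)) q j / qpoch (A*q^(R+1)) q j"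
    unfolding s2 using Aq by (simp add: mult_ac)
  finally show ?thesis unfolding main Y_def X1_def X2_def by (simp add: mult_ac)
qed

text \<open>After the shift of the summation index by \<open>n\<close>, this is Jackson's sum with
  \<open>A = q^(2*n+1)\<close>, with \<open>B\<close>, \<open>C\<close>, \<open>D\<close> equal to
  \<open>y\<close>, \<open>z\<close>, \<open>w\<close> times \<open>q^n\<close>, and with length
  \<open>N-n\<close>. The value of \<open>w\<close> makes its last parameter
  \<open>A*M*q^(R+1)\<close> equal to \<open>q/a\<close>, which is the first equation of
  \<open>par\<close>.\<close>

lemma bailey_kernel_sum:
  fixes a q y z :: complex and N n :: nat
  defines "w \<equiv> a*q^(N+2)/(y*z)"
  assumes nz: "q \<noteq> 0" "a \<noteq> 0" "y \<noteq> 0"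
    "z \<noteq> 0" and n: "n \<le> N" and a1: "a \<noteq> 1"
    and q: "qpoch q q (2*N+1) \<noteq> 0" and aq: "qpoch (a*q) q (2*N) \<noteq> 0"
    and yz: "qpoch (q^2/y) q N \<noteq> 0" "qpoch (q^2/z) q N \<noteq> 0" "qpoch (a*q/(y*z)) q N \<noteq> 0"
     "qpoch (a*q/y) q N \<noteq> 0" "qpoch (a*q/z) q N \<noteq> 0" "qpoch (y*z/q^(N+1)) q N \<noteq> 0"
  shows "(\<Sum>j\<le>N-n. bailey_kernel q q y z w N (n+j) * (1-q^(2*(n+j)+1)) * q^(n+j)
            * (qpoch q q (2*n+j) * qpoch (q/a) q j / (qpoch q q j * qpoch (a*q) q (2*n+j))))
     = (1-q) * a^n * (qpochs [q^2, q^2/(y*z), a*q/y, a*q/z] q N / qpochs [q^2/y, q^2/z, a*q/(y*z), a*q] q N)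
       * bailey_kernel a q y z w N n"
proof -
  define R where "R = N - n"
  have N: "N = n + R" using n by (simp add: R_def)
  define A B C D M where "A = q^(2*n+1)" and "B = y*q^n" and "C = z*q^n" and "D = w*q^n" and "M = A/(B*C*D)"
  have w0: "w \<noteq> 0" using nz by (simp add: w_def)
  note nz' = nz w0
  have M: "M = 1/(a*q^(N+n+1))"
    using nz by (simp add: M_def A_def B_def C_def D_def w_def N power_add mult_2 power2_eq_square)
  have par: "A*M*q^(R+1) = q/a" "1/(M*q^R) = a*q^(2*n+1)" "A*q^(R+1) = q^(N+n+2)"
    "A*q/B = q^2/y*q^n" "A*q/C = q^2/z*q^n" "A*q/D = q^2/w*q^n"
    "A*q/(B*C) = q^2/(y*z)" "A*q/(B*D) = z/(a*q^N)" "A*q/(C*D) = y/(a*q^N)" "A*(A/(B*C*D))*q = A*M*q"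
    "1/q^N*q^n = 1/q^R" "q*q^(N+1)*q^n = q^(N+n+2)"
    using nz' unfolding M unfolding A_def B_def C_def D_def w_def
    by (simp_all add: N power_add mult_2 mult_2_right power2_eq_square field_simps)
  have q_le: "qpoch q q m \<noteq> 0" if "m \<le> 2*N+1" for m using qpoch_nonzero_le[OF q that] .
  have aq_le: "qpoch (a*q) q m \<noteq> 0" if "m \<le> 2*N" for m using qpoch_nonzero_le[OF aq that] .
  \<comment> \<open>A zero factor would give \<open>a * q^m = 1\<close> with
    \<open>1 <= m <= 2*N\<close>.\<close>
  have MR: "qpoch (M*q) q R \<noteq> 0"
  proof -
    have "M*q*q^i \<noteq> 1" if "i < R" for i
    proof
      assume "M*q*q^i = 1"
      moreover have "q^(N+n+1) = q^(N+n-i) * q^(i+1)" using that by (simp add: N flip: power_add)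
      ultimately have "a * q^(N+n-i) = 1" using nz by (simp add: M field_simps)
      moreover have "q^(N+n-i) = q * q^(N+n-i-1)" using that N by (simp add: Suc_diff_Suc flip: power_Suc)
      ultimately have "a * q * q^(N+n-i-1) = 1" by (simp add: mult.assoc)
      moreover have "N+n-i-1 < 2*N" using that N by arith
      ultimately show False using qpoch_nonzeroD[OF aq] by blast
    qed
    then show ?thesis by (auto simp: qpoch_eq_0_iff)
  qed
  \<comment> \<open>Here the exponent may drop to 0, at \<open>i = R-1\<close>, and that case is
    excluded by \<open>a \<noteq> 1\<close>.\<close>
  have AMR: "qpoch (A*M*q) q R \<noteq> 0"
  proof -
    have "A*M*q*q^i \<noteq> 1" if "i < R" for i
    proof
      assume "A*M*q*q^i = 1"
      moreover have "R = (R-1-i) + (i+1)" using that by simp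
      then have "q^R = q^(R-1-i) * q^(i+1)" by (metis power_add)
      ultimately have *: "a * q^(R-1-i) = 1" using nz
        by (simp add: M A_def N power_add mult_2 mult_2_right field_simps)
      show False
      proof (cases "R-1-i")
        case 0
        with * a1 show False by simp
      next
        case (Suc m)
        with * qpoch_nonzeroD[OF aq, of m] N show False by (simp add: mult_ac)
      qed
    qed
    then show ?thesis by (auto simp: qpoch_eq_0_iff)
  qed
  have split: "qpoch x q N = qpoch x q n * qpoch (x*q^n) q R" for x
    unfolding N by (rule qpoch_add)
  have yzR: "qpoch (q^2/y*q^n) q R \<noteq> 0" "qpoch (q^2/z*q^n) q R \<noteq> 0"
    using yz(1,2) by (auto simp: split)
  \<comment> \<open>Up to nonzero factors, reversal turns this product into
    \<open>(aq/(yz); q)_R\<close>.\<close>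
  have wR: "qpoch (q^2/w*q^n) q R \<noteq> 0"
  proof -
    have "q / (q^2/w*q^n * q^R) = a*q/(y*z)"
      using nz by (simp add: w_def N power_add power2_eq_square)
    then show ?thesis
      using qpoch_reverse[of "q^2/w*q^n" q R] nz' qpoch_nonzero_le[OF yz(3), of R] N by simp
  qed
  have AqR: "qpoch (A*q) q R \<noteq> 0"
    using q_le[of "2*n+1+R"] N unfolding qpoch_add[of q q "2*n+1"] by (simp add: A_def mult_ac)
  define J where "J j = qpoch A q j
    * (1 - A * q^(2*j)) * qpoch B q j * qpoch C q j * qpoch D q j * qpoch (1/q^R) q j
      * qpoch (A*M*q^(R+1)) q j * q^j
       / (qpoch q q j * qpoch (A*q/B) q j * qpoch (A*q/C) q j * qpoch (A*q/D) q j * qpoch (1/(M*q^R)) q j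
         * qpoch (A*q^(R+1)) q j)" for j
  have J: "jackson_term A B C D q R j * (qpoch q q R * qpoch (A*q) q R)
    = qpoch (M*q) q R * qpoch (A*M*q) q R * J j"
    if "j \<le> R" for j
    unfolding J_def M_def
    by (rule jackson_term_standard) (use nz' that q_le N MR M_def M AqR in auto)
  have Jsum: "qpoch (M*q) q R * (\<Sum>j\<le>R. J j)
    = qpoch (A*q) q R * (1-A) * (qpoch (q^2/(y*z)) q R * qpoch (z/(a*q^N)) q R * qpoch (y/(a*q^N)) q R)
     / (qpoch (q^2/y*q^n) q R * qpoch (q^2/z*q^n) q R * qpoch (q^2/w*q^n) q R)"
  proof -
    have Aq2: "qpoch (A*q) q (2*R) \<noteq> 0"
      using q_le[of "2*n+1+2*R"] N unfolding qpoch_add[of q q "2*n+1"] by (simp add: A_def mult_ac)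
    have BCD0: "B \<noteq> 0" "C \<noteq> 0" "D \<noteq> 0" using nz' by (simp_all add: B_def C_def D_def)
    have qR: "qpoch q q R \<noteq> 0" using q_le N by simp
    have "qpoch (M*q) q R * qpoch (A*M*q) q R * (\<Sum>j\<le>R. J j)
      = (\<Sum>j\<le>R. jackson_term A B C D q R j) * (qpoch q q R * qpoch (A*q) q R)"
      using J by (simp add: sum_distrib_left sum_distrib_right)
    also have "\<dots> = (1-A) * qpochs [A*q/(B*C), A*q/(B*D), A*q/(C*D), A*(A/(B*C*D))*q] q R
      / qpochs [q, A*q/B, A*q/C, A*q/D] q R * (qpoch q q R * qpoch (A*q) q R)"
      using yzR wR by (subst jackson_sum[OF nz(1) BCD0 qR Aq2]) (simp_all add: par)
    also have "\<dots> = qpoch (A*M*q) q R * (qpoch (A*q) q R * (1-A)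
      * (qpoch (q^2/(y*z)) q R * qpoch (z/(a*q^N)) q R * qpoch (y/(a*q^N)) q R)
       / (qpoch (q^2/y*q^n) q R * qpoch (q^2/z*q^n) q R * qpoch (q^2/w*q^n) q R))"
      unfolding qpochs_def par using qR by (simp add: mult_ac)
    finally have "qpoch (A*M*q) q R * (qpoch (M*q) q R * (\<Sum>j\<le>R. J j)) = qpoch (A*M*q) q R *
       (qpoch (A*q) q R * (1-A) * (qpoch (q^2/(y*z)) q R * qpoch (z/(a*q^N)) q R * qpoch (y/(a*q^N)) q R)
       / (qpoch (q^2/y*q^n) q R * qpoch (q^2/z*q^n) q R * qpoch (q^2/w*q^n) q R))"
      by (simp only: mult.left_commute mult.assoc)
    then show ?thesis by (rule mult_left_cancel[OF AMR, THEN iffD1])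
  qed
  have summand: "bailey_kernel q q y z w N (n+j) * (1-q^(2*(n+j)+1)) * q^(n+j)
            * (qpoch q q (2*n+j) * qpoch (q/a) q j / (qpoch q q j * qpoch (a*q) q (2*n+j)))
     = bailey_kernel q q y z w N n * q^n * qpoch q q (2*n) / qpoch (a*q) q (2*n) * J j" for j
  proof -
    have e: "q*q/x = q^2/x" for x by (simp add: power2_eq_square)
    have f: "q*q^(2*n) = A" "a*q*q^(2*n) = a*q^(2*n+1)" "q^(2*(n+j)+1) = A*q^(2*j)" "q^(n+j) = q^n*q^j"
      by (simp_all add: A_def power_add mult_ac)
    have J': "J j = qpoch A q j * (1 - A * q^(2*j)) * qpoch B q j * qpoch C q j * qpoch D q j
      * qpoch (1/q^R) q j * qpoch (q/a) q j * q^j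
       / (qpoch q q j * qpoch (q^2/y*q^n) q j * qpoch (q^2/z*q^n) q j * qpoch (q^2/w*q^n) q j
         * qpoch (a*q^(2*n+1)) q j * qpoch (q^(N+n+2)) q j)"
      unfolding J_def par ..
    show ?thesis
      unfolding bailey_kernel_def qpochs_def list.map prod_list.Cons prod_list.Nil qpoch_add[of _ _ n j]
        qpoch_add[of _ _ "2*n" j]
        e f par J' B_def[symmetric] C_def[symmetric] D_def[symmetric] by (simp add: mult_ac)
  qed
  have Jsum': "(\<Sum>j\<le>R. J j)
    = qpoch (A*q) q R * (1-A) * (qpoch (q^2/(y*z)) q R * qpoch (a*q/z*q^n) q R * qpoch (a*q/y*q^n) q R)
     / (qpoch (a*q/(y*z)) q R * qpoch (a*q^(2*n+1)) q R * qpoch (q^2/y*q^n) q R * qpoch (q^2/z*q^n) q R)"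
  proof -
    \<comment> \<open>Two products on Jackson's side still start at \<open>q^(-N)\<close>. Reversal
      removes them, and the power factors of the two reversals, \<open>(1/(y*q^n))^R\<close> and
      \<open>(y*q^n)^R\<close>, cancel.\<close>
    have 1: "qpoch (z/(a*q^N)) q R * qpoch (a*q/(y*z)) q R
      = (1/(y*q^n))^R * (qpoch (q^2/w*q^n) q R * qpoch (a*q/z*q^n) q R)"
    proof -
      have "q / (q^2/w*q^n*q^R) = a*q/(y*z)" "q/(z/(a*q^N)*q^R) = a*q/z*q^n" "z/(a*q^N)/(q^2/w*q^n)
        = 1/(y*q^n)"
        using nz by (simp_all add: w_def N power_add power2_eq_square field_simps)
      then show ?thesis using qpoch_ratio_reverse[of "z/(a*q^N)" "q^2/w*q^n" q R] nz' by simp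
    qed
    have 2: "qpoch (y/(a*q^N)) q R * qpoch (a*q^(2*n+1)) q R
      = (y*q^n)^R * (qpoch (M*q) q R * qpoch (a*q/y*q^n) q R)"
    proof -
      have "q / (M*q*q^R) = a*q^(2*n+1)" "q/(y/(a*q^N)*q^R) = a*q/y*q^n" "y/(a*q^N)/(M*q) = y*q^n"
        using nz unfolding M by (simp_all add: N power_add mult_2 mult_2_right power2_eq_square field_simps)
      then show ?thesis using qpoch_ratio_reverse[of "y/(a*q^N)" "M*q" q R] nz' M by simp
    qed
    have "(1/(y*q^n))^R * (y*q^n)^R = 1" using nz by (simp flip: power_mult_distrib)
    moreover have gen: "\<lbrakk>g*h = r*(k*l); g'*h' = s*(k'*l'); r * s
      = 1\<rbrakk> \<Longrightarrow> g*g'*(h*h') = k*k'*(l*l')"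
      for g h k l g' h' k' l' r s :: complex by algebra
    ultimately have 3: "qpoch (z/(a*q^N)) q R * qpoch (y/(a*q^N)) q R
      * (qpoch (a*q/(y*z)) q R * qpoch (a*q^(2*n+1)) q R)
       = qpoch (q^2/w*q^n) q R * qpoch (M*q) q R * (qpoch (a*q/z*q^n) q R * qpoch (a*q/y*q^n) q R)"
      using 1 2 by blast
    have n3: "qpoch (a*q/(y*z)) q R \<noteq> 0" "qpoch (a*q^(2*n+1)) q R \<noteq> 0"
      using qpoch_nonzero_le[OF yz(3), of R] aq_le[of "2*n+R"] N unfolding qpoch_add[of "a*q" q "2*n"]
        by (simp_all add: mult_ac)
    from 3 have 4: "qpoch (z/(a*q^N)) q R * qpoch (y/(a*q^N)) q R
       = qpoch (q^2/w*q^n) q R * qpoch (M*q) q R * (qpoch (a*q/z*q^n) q R * qpoch (a*q/y*q^n) q R)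
         / (qpoch (a*q/(y*z)) q R * qpoch (a*q^(2*n+1)) q R)"
      using n3 by (simp add: field_simps)
    have "qpoch (M*q) q R * (\<Sum>j\<le>R. J j)
      = qpoch (A*q) q R * (1-A) * (qpoch (q^2/(y*z)) q R * (qpoch (z/(a*q^N)) q R * qpoch (y/(a*q^N)) q R))
     / (qpoch (q^2/y*q^n) q R * qpoch (q^2/z*q^n) q R * qpoch (q^2/w*q^n) q R)"
      using Jsum by (simp add: mult_ac)
    also have "\<dots> = qpoch (M*q) q R * (qpoch (A*q) q R * (1-A)
      * (qpoch (q^2/(y*z)) q R * qpoch (a*q/z*q^n) q R * qpoch (a*q/y*q^n) q R)
     / (qpoch (a*q/(y*z)) q R * qpoch (a*q^(2*n+1)) q R * qpoch (q^2/y*q^n) q R * qpoch (q^2/z*q^n) q R))"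
      unfolding 4 using wR by (simp add: mult_ac)
    finally show ?thesis by (rule mult_left_cancel[OF MR, THEN iffD1])
  qed
  define U where "U = qpoch y q n * qpoch z q n * qpoch w q n * qpoch (1/q^N) q n"
  define Y1 Z1 W1 Q1 where "Y1 = qpoch (q^2/y) q n" and "Z1 = qpoch (q^2/z) q n" and "W1 = qpoch (q^2/w) q n"
    and "Q1 = qpoch (q^(N+2)) q n"
  define Y2 Z2 W2 Q2 where "Y2 = qpoch (a*q/y) q n" and "Z2 = qpoch (a*q/z) q n" and "W2 = qpoch (a*q/w) q n"
    and "Q2 = qpoch (a*q*q^N) q n"
  define S1 V1 where "S1 = qpoch (q^2/(y*z)*q^R) q n" and "V1 = qpoch (a*q/(y*z)*q^R) q n"
  \<comment> \<open>This exchanges \<open>q^2/w\<close> for \<open>aq/w\<close>, the lower parameter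
    in the kernel of base \<open>a\<close>. It also turns \<open>q^n\<close> into \<open>a^n\<close>
    and supplies the missing factors of \<open>(q^2/(yz); q)_N\<close> and
    \<open>(aq/(yz); q)_N\<close>.\<close>
  have rev: "W1 * S1 = (q/a)^n * (W2 * V1)"
  proof -
    have "q / (a*q/w*q^n) = q^2/(y*z)*q^R" "q/(q^2/w*q^n) = a*q/(y*z)*q^R" "(q^2/w)/(a*q/w) = q/a"
      using nz by (simp_all add: w_def N power_add power2_eq_square)
    then show ?thesis
      using qpoch_ratio_reverse[of "q^2/w" "a*q/w" q n] nz' by (simp add: W1_def W2_def S1_def V1_def)
  qed
  have kq: "bailey_kernel q q y z w N n = U / (Y1*Z1*W1*Q1)"
    by (simp add: bailey_kernel_def qpochs_def U_def Y1_def Z1_def W1_def Q1_def power2_eq_square mult_ac)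
  have ka: "bailey_kernel a q y z w N n = U / (Y2*Z2*W2*Q2)"
    by (simp add: bailey_kernel_def qpochs_def U_def Y2_def Z2_def W2_def Q2_def mult_ac)
  have split': "qpoch x q N = qpoch x q R * qpoch (x*q^R) q n" for x
    using qpoch_add[of x q R n] by (simp add: N add.commute)
  \<comment> \<open>Splitting \<open>(q; q)_(N+n+1)\<close> in two ways absorbs the factor
    \<open>1-A\<close> of Jackson's sum and yields \<open>1-q\<close>.\<close>
  have "qpoch q q (Suc (N+n)) = (1-q) * (qpoch (q^2) q N * Q1)"
    by (simp add: qpoch_Suc_left qpoch_add Q1_def power_add power2_eq_square mult_ac)
  moreover have "qpoch q q (Suc (N+n)) = qpoch q q (2*n) * ((1-A) * qpoch (A*q) q R)"
  proof -
    have "Suc (N+n) = 2*n + Suc R" using N by simp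
    then show ?thesis
      unfolding qpoch_add[of q q "2*n" "Suc R", folded \<open>Suc (N+n)
        = 2*n + Suc R\<close>] qpoch_Suc_left[of "q*q^(2*n)"]
      by (simp add: A_def mult_ac)
  qed
  ultimately have qq: "qpoch q q (2*n) * ((1-A) * qpoch (A*q) q R) = (1-q) * (qpoch (q^2) q N * Q1)" by simp
  have aqq: "qpoch (a*q) q (2*n) * qpoch (a*q^(2*n+1)) q R = qpoch (a*q) q N * Q2"
  proof -
    have e: "2*n+R = N+n" using N by simp
    show ?thesis using qpoch_add[of "a*q" q "2*n" R] qpoch_add[of "a*q" q N n] unfolding e Q2_def
      by (simp add: power_add mult_ac)
  qed
  have aw: "a*q/w = y*z/q^(N+1)" using nz by (simp add: w_def)
  have nz3: "W1 \<noteq> 0" "V1 \<noteq> 0" "W2 \<noteq> 0" "Q1 \<noteq> 0" "Y2 \<noteq> 0" "Z2 \<noteq> 0"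
    "qpoch (a*q) q (2*n) * qpoch (a*q^(2*n+1)) q R \<noteq> 0"
  proof -
    show V1: "V1 \<noteq> 0" using yz(3) unfolding split' V1_def by simp
    show "W1 \<noteq> 0"
    proof -
      have "q/(q^2/w*q^n) = a*q/(y*z)*q^R" using nz by (simp add: w_def N power_add power2_eq_square)
      then have "W1 = (\<Prod>i<n. - (q^2/w * q^i)) * V1"
        using qpoch_reverse[of "q^2/w" q n] nz' by (simp add: W1_def V1_def)
      with V1 nz' show ?thesis by simp
    qed
    show "W2 \<noteq> 0" using yz(6) n unfolding W2_def aw by (rule qpoch_nonzero_le)
    show "Q1 \<noteq> 0" using q_le[of "Suc (N+n)"] n
      by (auto simp: qpoch_Suc_left qpoch_add Q1_def power_add power2_eq_square mult_ac)
    show "Y2 \<noteq> 0" "Z2 \<noteq> 0" using yz(4,5) unfolding split Y2_def Z2_def by auto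
    show "qpoch (a*q) q (2*n) * qpoch (a*q^(2*n+1)) q R \<noteq> 0"
      using aq_le[of "2*n+R"] N unfolding qpoch_add[of "a*q" q "2*n"] by (simp add: mult_ac)
  qed
  have "(\<Sum>j\<le>N-n. bailey_kernel q q y z w N (n+j) * (1-q^(2*(n+j)+1)) * q^(n+j)
            * (qpoch q q (2*n+j) * qpoch (q/a) q j / (qpoch q q j * qpoch (a*q) q (2*n+j))))
    = bailey_kernel q q y z w N n * q^n * qpoch q q (2*n) / qpoch (a*q) q (2*n) * (\<Sum>j\<le>R. J j)"
    unfolding summand sum_distrib_left R_def ..
  also have "\<dots> = U / (Y1*Z1*W1*Q1) * q^n * (qpoch q q (2*n) * ((1-A) * qpoch (A*q) q R))
    / (qpoch (a*q) q (2*n) * qpoch (a*q^(2*n+1)) q R)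
     * (qpoch (q^2/(y*z)) q R * qpoch (a*q/z*q^n) q R * qpoch (a*q/y*q^n) q R
     / (qpoch (a*q/(y*z)) q R * qpoch (q^2/y*q^n) q R * qpoch (q^2/z*q^n) q R))"
    unfolding Jsum' kq by (simp add: mult_ac)
  also have "\<dots> = U / (Y1*Z1) * (q^n / W1) * ((1-q) * qpoch (q^2) q N)
    / (qpoch (a*q) q (2*n) * qpoch (a*q^(2*n+1)) q R)
     * (qpoch (q^2/(y*z)) q R * qpoch (a*q/z*q^n) q R * qpoch (a*q/y*q^n) q R
     / (qpoch (a*q/(y*z)) q R * qpoch (q^2/y*q^n) q R * qpoch (q^2/z*q^n) q R))"
    unfolding qq using nz3 by (simp add: mult_ac)
  also have "q^n / W1 = a^n * S1 / (W2 * V1)"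
    using rev nz3 nz by (simp add: field_simps power_divide)
  also have "U / (Y1*Z1) * (a^n * S1 / (W2 * V1)) * ((1-q) * qpoch (q^2) q N)
    / (qpoch (a*q) q (2*n) * qpoch (a*q^(2*n+1)) q R)
     * (qpoch (q^2/(y*z)) q R * qpoch (a*q/z*q^n) q R * qpoch (a*q/y*q^n) q R
     / (qpoch (a*q/(y*z)) q R * qpoch (q^2/y*q^n) q R * qpoch (q^2/z*q^n) q R))
    = (1-q) * a^n * (qpoch (q^2) q N * (qpoch (q^2/(y*z)) q R * S1) * (Y2 * qpoch (a*q/y*q^n) q R)
      * (Z2 * qpoch (a*q/z*q^n) q R)
         / ((Y1 * qpoch (q^2/y*q^n) q R) * (Z1 * qpoch (q^2/z*q^n) q R)
           * (qpoch (a*q/(y*z)) q R * V1) * qpoch (a*q) q N))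
       * (U / (Y2*Z2*W2*Q2))"
    unfolding aqq using nz3 by (simp add: mult_ac)
  also have "\<dots> = (1-q) * a^n
    * (qpochs [q^2, q^2/(y*z), a*q/y, a*q/z] q N / qpochs [q^2/y, q^2/z, a*q/(y*z), a*q] q N)
       * bailey_kernel a q y z w N n"
    unfolding ka qpochs_def list.map prod_list.Cons prod_list.Nil split[of "q^2/y"] split[of
      "q^2/z"] split[of "a*q/y"] split[of "a*q/z"]
      split'[of "q^2/(y*z)"] split'[of
        "a*q/(y*z)"] Y1_def[symmetric] Z1_def[symmetric] Y2_def[symmetric] Z2_def[symmetric]
      S1_def[symmetric] V1_def[symmetric] by (simp add: mult_ac)
  finally show ?thesis .
qed

section \<open>The terminating quadratic transformation\<close>

definition whipple_value :: "complex \<Rightarrow> complex \<Rightarrow> complex \<Rightarrow> nat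
  \<Rightarrow> complex" where
  "whipple_value a d q k = whipple_product a d q k / (qpoch (a*d) q k * qpoch (a*q/d) q k)"

lemma whipple_value_even:
  assumes nz: "a \<noteq> 0" "d \<noteq> 0" "q \<noteq> 0"
    and "qpoch (a*d) q (2*n) \<noteq> 0" "qpoch (a*q/d) q (2*n) \<noteq> 0"
  shows "whipple_value a d q (2*n) = a^(2*n) * qpoch (q^2/(a*d)) (q^2) n * qpoch (d*q/a) (q^2) n
     / (qpoch (a*d*q) (q^2) n * qpoch (a*q^2/d) (q^2) n)"
  using assms(4-)
proof (induction n)
  case 0
  then show ?case by (simp add: whipple_value_def)
next
  case (Suc n)
  have e: "2 * Suc n = Suc (Suc (2*n))" by simp
  have frac: "c \<noteq> 0 \<Longrightarrow> h \<noteq> 0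
    \<Longrightarrow> g * (k * h * c * l) / (c * r * (h * p)) = g * (k * l) / (r * p)"
    for c g h k l p r :: complex by simp
  define x where "x = q^(2*n)"
  have x: "(q^2)^n = x" by (simp add: x_def power_mult)
  have nz1: "qpoch (a*d) q (2*n) \<noteq> 0" "qpoch (a*q/d) q (2*n) \<noteq> 0"
    "1 - a*d*x \<noteq> 0" "1 - a*d*(q*x) \<noteq> 0" "1 - a*q/d*x \<noteq> 0" "1 - a*q/d*(q*x) \<noteq> 0"
    using Suc.prems unfolding e qpoch_Suc power_Suc x_def[symmetric] by auto
  have "whipple_value a d q (2 * Suc n)
    = whipple_value a d q (2*n) * ((a*d - q^2*x) * (1 - a*q/d*x) * (1 - a*d*x) * (a/d - q*x))
     / ((1 - a*d*x) * (1 - a*d*(q*x)) * ((1 - a*q/d*x) * (1 - a*q/d*(q*x))))"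
    unfolding e whipple_value_def whipple_product_Suc_Suc[OF nz] qpoch_Suc
      by (simp add: x_def power_add power2_eq_square mult_ac)
  also have "\<dots> = whipple_value a d q (2*n) * ((a*d - q^2*x) * (a/d - q*x))
    / ((1 - a*d*(q*x)) * (1 - a*q/d*(q*x)))"
    using nz1(3,5) by (rule frac)
  also have "(a*d - q^2*x) * (a/d - q*x) = a^2 * (1 - q^2/(a*d)*x) * (1 - d*q/a*x)"
    using nz by (simp add: field_simps power2_eq_square)
  finally show ?case
    unfolding Suc.IH[OF nz1(1,2)] qpoch_Suc x by (simp add: power2_eq_square mult_ac)
qed

text \<open>The factor in front is the value at \<open>k = 1\<close>; it becomes part of the
  coefficient of the second series.\<close>

lemma whipple_value_odd:
  assumes nz: "a \<noteq> 0" "d \<noteq> 0" "q \<noteq> 0"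
    and "qpoch (a*d) q (2*n+1) \<noteq> 0" "qpoch (a*q/d) q (2*n+1) \<noteq> 0"
  shows "whipple_value a d q (2*n+1) = - (a^2 * (1-d/a) * (1-q/(a*d)) / ((1-a*d) * (1-a*q/d)))
    * (a^(2*n) * qpoch (q^3/(a*d)) (q^2) n * qpoch (d*q^2/a) (q^2) n
     / (qpoch (a*d*q^2) (q^2) n * qpoch (a*q^3/d) (q^2) n))"
  using assms(4-)
proof (induction n)
  case 0
  have "(a*d - q) * (1 - a/d) = - (a^2 * (1-d/a) * (1-q/(a*d)))"
    using nz by (simp add: field_simps power2_eq_square)
  then show ?case by (simp add: whipple_value_def whipple_product_Suc qpoch_Suc mult_ac)
next
  case (Suc n)
  have e: "2 * Suc n + 1 = Suc (Suc (2*n+1))" by simp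
  have frac: "c \<noteq> 0 \<Longrightarrow> h \<noteq> 0
    \<Longrightarrow> g * (k * h * c * l) / (c * r * (h * p)) = g * (k * l) / (r * p)"
    for c g h k l p r :: complex by simp
  define x where "x = q^(2*n+1)"
  have x: "q*(q^2)^n = x" by (simp_all add: x_def power_mult)
  have x2: "q^3/y*(q^2)^n = q^2/y*x" "y*q^2*(q^2)^n = y*(q*x)" "a*q^3/d*(q^2)^n
    = a*q/d*(q*x)" "y*q^2/a*(q^2)^n = y*q/a*x" for y
    unfolding x[symmetric] by (simp_all add: power2_eq_square power3_eq_cube mult_ac)
  have nz1: "qpoch (a*d) q (2*n+1) \<noteq> 0" "qpoch (a*q/d) q (2*n+1) \<noteq> 0"
    "1 - a*d*x \<noteq> 0" "1 - a*d*(q*x) \<noteq> 0" "1 - a*q/d*x \<noteq> 0" "1 - a*q/d*(q*x) \<noteq> 0"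
    using Suc.prems unfolding e qpoch_Suc[of _ _ "2*n+1"] qpoch_Suc[of _ _ "Suc (2*n+1)"] power_Suc[of _
      "2*n+1"] x_def[symmetric] by auto
  have "whipple_value a d q (2 * Suc n + 1)
    = whipple_value a d q (2*n+1) * ((a*d - q^2*x) * (1 - a*q/d*x) * (1 - a*d*x) * (a/d - q*x))
     / ((1 - a*d*x) * (1 - a*d*(q*x)) * ((1 - a*q/d*x) * (1 - a*q/d*(q*x))))"
    unfolding e whipple_value_def whipple_product_Suc_Suc[OF nz] qpoch_Suc[of _ _ "2*n+1"] qpoch_Suc[of _ _
      "Suc (2*n+1)"]
    by (simp add: x_def power_add power2_eq_square mult_ac)
  also have "\<dots> = whipple_value a d q (2*n+1) * ((a*d - q^2*x) * (a/d - q*x))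
    / ((1 - a*d*(q*x)) * (1 - a*q/d*(q*x)))"
    using nz1(3,5) by (rule frac)
  also have "(a*d - q^2*x) * (a/d - q*x) = a^2 * (1 - q^2/(a*d)*x) * (1 - d*q/a*x)"
    using nz by (simp add: field_simps power2_eq_square)
  finally show ?case
    unfolding Suc.IH[OF nz1(1,2)] qpoch_Suc[of _ "q^2"] x2 by (simp add: power2_eq_square mult_ac)
qed

text \<open>The part of the general term on the right that is free of \<open>y\<close>,
  \<open>z\<close> and \<open>N\<close>. Its parameter pairs \<open>a\<close>, \<open>-a\<close> and
  \<open>q\<close>, \<open>-q\<close> merge into the \<open>a^2\<close>, \<open>q^2\<close> products
  of base \<open>q^2\<close> in \<open>whipple_term\<close>.\<close>

definition vwp_term :: "complex \<Rightarrow> complex \<Rightarrow> complex \<Rightarrow> nat \<Rightarrow>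
  complex" where
  "vwp_term a d q n = (1 - a*q^(2*n)) / (1-a) * qpochs [a, d, q/d, -a] q n / qpochs [q, a*q/d, a*d, -q] q n"

lemma vwp_whipple_sum:
  assumes nz: "a \<noteq> 0" "d \<noteq> 0" "q \<noteq> 0" and a1: "a \<noteq> 1"
    and q: "qpoch q q k \<noteq> 0" "qpoch (-q) q k \<noteq> 0" "qpoch (a*q) q (2*k) \<noteq> 0"
    and d: "qpoch (a*d) q k \<noteq> 0" "qpoch (a*q/d) q k \<noteq> 0"
  shows "(\<Sum>n\<le>k. (-1)^n * vwp_term a d q n * (qpoch q q (k+n) * qpoch (q/a) q (k-n)
    / (qpoch q q (k-n) * qpoch (a*q) q (k+n))))
    = whipple_value a d q k / a^k"
proof -
  have q2: "qpoch (q^2) (q^2) k \<noteq> 0" using q(1,2) by (simp flip: qpoch_square)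
  have *: "(-1)^n * vwp_term a d q n * (qpoch q q (k+n) * qpoch (q/a) q (k-n)
    / (qpoch q q (k-n) * qpoch (a*q) q (k+n)))
     = whipple_term a d q k n / ((1-a) * (qpoch (a*d) q k * qpoch (a*q/d) q k))" if "n \<le> k" for n
  proof -
    obtain i where k: "k = n + i" using \<open>n \<le> k\<close> le_Suc_ex by blast
    have s: "qpoch (a*d) q k = qpoch (a*d) q n * qpoch (a*d*q^n) q i"
      "qpoch (a*q/d) q k = qpoch (a*q/d) q n * qpoch (a*q^(n+1)/d) q i"
      unfolding k qpoch_add by (simp_all add: mult_ac)
    have nz2: "qpoch (a*d*q^n) q i \<noteq> 0" "qpoch (a*q^(n+1)/d) q i \<noteq> 0"
      using d unfolding s by auto
    have "vwp_term a d q n = (1 - a*q^(2*n))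
      / (1-a) * ((qpoch a q n * qpoch (-a) q n) * (qpoch d q n * qpoch (q/d) q n))
        / ((qpoch q q n * qpoch (-q) q n) * (qpoch (a*q/d) q n * qpoch (a*d) q n))"
      unfolding vwp_term_def qpochs_def by (simp add: mult_ac)
    moreover have "k - n = i" using k by simp
    ultimately show ?thesis
      unfolding whipple_term_def qpoch_square s using nz2 by (simp add: mult_ac)
  qed
  have "(\<Sum>n\<le>k. (-1)^n * vwp_term a d q n * (qpoch q q (k+n) * qpoch (q/a) q (k-n)
    / (qpoch q q (k-n) * qpoch (a*q) q (k+n))))
     = (\<Sum>n\<le>k. whipple_term a d q k n) / ((1-a) * (qpoch (a*d) q k * qpoch (a*q/d) q k))"
    unfolding sum_divide_distrib by (intro sum.cong refl *) simp
  also have "(\<Sum>n\<le>k. whipple_term a d q k n) = (1-a) * whipple_product a d q k / a^k"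
    using whipple_sum[OF nz q(1) q2 q(3)] nz by (simp add: field_simps)
  finally show ?thesis using a1 by (simp add: whipple_value_def mult_ac)
qed

lemma sum_triangle_shift:
  "(\<Sum>k\<le>N. \<Sum>n\<le>k. f k n)
    = (\<Sum>n\<le>N. \<Sum>j\<le>N-n. f (n+j) n)" for f :: "nat \<Rightarrow> nat \<Rightarrow> complex"
  by (induction N) (simp_all add: Suc_diff_le sum.distrib)

text \<open>The arguments are explained by the two inner sums: \<open>(q/a)^k\<close> joins
  Jackson's \<open>q^k\<close> with the \<open>a^(-k)\<close> of the Whipple sum, and
  \<open>(-a)^n\<close> joins the \<open>a^n\<close> of \<open>bailey_kernel_sum\<close> with the
  sign in the Whipple sum.\<close>

lemma bailey_transformation:
  fixes a d q y z :: complex and N :: nat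
  defines "w \<equiv> a*q^(N+2)/(y*z)"
  assumes nz: "q \<noteq> 0" "a \<noteq> 0" "d \<noteq> 0" "y \<noteq> 0"
    "z \<noteq> 0" and a1: "a \<noteq> 1"
    and q: "qpoch q q (2*N+1) \<noteq> 0" "qpoch (-q) q N \<noteq> 0" and aq: "qpoch (a*q) q (2*N) \<noteq> 0"
    and d: "qpoch (a*d) q N \<noteq> 0" "qpoch (a*q/d) q N \<noteq> 0"
    and yz: "qpoch (q^2/y) q N \<noteq> 0" "qpoch (q^2/z) q N \<noteq> 0" "qpoch (a*q/(y*z)) q N \<noteq> 0"
     "qpoch (a*q/y) q N \<noteq> 0" "qpoch (a*q/z) q N \<noteq> 0" "qpoch (y*z/q^(N+1)) q N \<noteq> 0"
  shows "(\<Sum>k\<le>N. (1-q^(2*k+1))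
    / (1-q) * whipple_value a d q k * (q/a)^k * bailey_kernel q q y z w N k)
     = qpochs [q^2, q^2/(y*z), a*q/y, a*q/z] q N / qpochs [q^2/y, q^2/z, a*q/(y*z), a*q] q N
       * (\<Sum>n\<le>N. vwp_term a d q n * bailey_kernel a q y z w N n * (-a)^n)"
proof -
  define pref where "pref = qpochs [q^2, q^2/(y*z), a*q/y, a*q/z] q N / qpochs [q^2/y, q^2/z, a*q/(y*z),
    a*q] q N"
  define K where "K = bailey_kernel q q y z w N"
  define c where "c k n = qpoch q q (k+n) * qpoch (q/a) q (k-n)
    / (qpoch q q (k-n) * qpoch (a*q) q (k+n))" for k n
  have q1: "1 - q \<noteq> 0" using qpoch_nonzeroD[OF q(1), of 0] by simp
  have 1: "(1-q^(2*k+1)) * whipple_value a d q k * (q/a)^k * K k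
     = (\<Sum>n\<le>k. (-1)^n * vwp_term a d q n * (K k * (1-q^(2*k+1)) * q^k * c k n))" if "k \<le> N" for k
  proof -
    have "whipple_value a d q k / a^k = (\<Sum>n\<le>k. (-1)^n * vwp_term a d q n * c k n)"
      unfolding c_def by (rule vwp_whipple_sum[symmetric])
        (use nz a1 that qpoch_nonzero_le[OF q(1), of k] qpoch_nonzero_le[OF q(2),
          of k] qpoch_nonzero_le[OF aq, of "2*k"]
           qpoch_nonzero_le[OF d(1), of k] qpoch_nonzero_le[OF d(2), of k] in auto)
    note sum = this
    have "(1-q^(2*k+1)) * whipple_value a d q k * (q/a)^k * K k
      = (1-q^(2*k+1)) * q^k * K k * (\<Sum>n\<le>k. (-1)^n * vwp_term a d q n * c k n)"
      unfolding sum[symmetric] by (simp add: power_divide)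
    then show ?thesis by (simp add: sum_distrib_left mult_ac)
  qed
  have 2: "(\<Sum>j\<le>N-n. K (n+j) * (1-q^(2*(n+j)+1)) * q^(n+j) * c (n+j) n)
    = (1-q) * a^n * pref * bailey_kernel a q y z w N n"
    if "n \<le> N" for n
  proof -
    have e: "c (n+j) n = qpoch q q (2*n+j) * qpoch (q/a) q j / (qpoch q q j * qpoch (a*q) q (2*n+j))" for j
    proof -
      have "n + j + n = 2*n+j" by simp
      then show ?thesis unfolding c_def \<open>n + j + n = 2*n+j\<close> by simp
    qed
    show ?thesis unfolding e K_def w_def pref_def
      by (rule bailey_kernel_sum[OF nz(1,2,4,5) that a1 q(1) aq yz])
  qed
  have "(\<Sum>k\<le>N. (1-q^(2*k+1)) * whipple_value a d q k * (q/a)^k * K k)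
     = (\<Sum>k\<le>N. \<Sum>n\<le>k. (-1)^n * vwp_term a d q n * (K k * (1-q^(2*k+1)) * q^k * c k n))"
    by (intro sum.cong refl 1) simp
  also have "\<dots> = (\<Sum>n\<le>N. (-1)^n * vwp_term a d q n * (\<Sum>j\<le>N-n. K (n+j)
    * (1-q^(2*(n+j)+1)) * q^(n+j) * c (n+j) n))"
    unfolding sum_triangle_shift sum_distrib_left ..
  also have "\<dots> = (\<Sum>n\<le>N. (-1)^n * vwp_term a d q n
    * ((1-q) * a^n * pref * bailey_kernel a q y z w N n))"
    by (intro sum.cong refl) (simp only: 2 atMost_iff)
  also have "\<dots> = (1-q) * (pref * (\<Sum>n\<le>N. vwp_term a d q n * bailey_kernel a q y z w N n
    * (-a)^n))"
    by (simp add: sum_distrib_left mult_ac power_minus[of a])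
  finally have *: "(\<Sum>k\<le>N. (1-q^(2*k+1)) * whipple_value a d q k * (q/a)^k * K k)
     = (1-q) * (pref * (\<Sum>n\<le>N. vwp_term a d q n * bailey_kernel a q y z w N n * (-a)^n))" .
  have "(\<Sum>k\<le>N. (1-q^(2*k+1)) / (1-q) * whipple_value a d q k * (q/a)^k * K k)
    = (\<Sum>k\<le>N. (1-q^(2*k+1)) * whipple_value a d q k * (q/a)^k * K k) / (1-q)"
    unfolding sum_divide_distrib by simp
  also have "\<dots> = pref * (\<Sum>n\<le>N. vwp_term a d q n * bailey_kernel a q y z w N n * (-a)^n)"
    unfolding * using q1 by simp
  finally show ?thesis unfolding pref_def K_def .
qed

section \<open>From basic hypergeometric series to the sums over all k\<close>

lemma qpochs_Nil [simp]: "qpochs [] t n = 1"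
  and qpochs_Cons [simp]: "qpochs (x # xs) t n = qpoch x t n * qpochs xs t n"
  by (simp_all add: qpochs_def)

lemma qpochs_eq_0_iff: "qpochs xs t n = 0 \<longleftrightarrow> (\<exists>x\<in>set xs. qpoch x t n = 0)"
  by (induction xs) auto

lemma phi_term_beyond:
  assumes "t \<noteq> 0" "t powi (- int M) \<in> set as" "M < n"
  shows "phi_term as bs t x n = 0"
proof -
  have "t powi (- int M) * t ^ M = 1" using assms(1) by (simp add: power_int_minus)
  then have "qpoch (t powi (- int M)) t n = 0" using assms(3) unfolding qpoch_eq_0_iff by blast
  then have "qpochs as t n = 0" using assms(2) unfolding qpochs_eq_0_iff by blast
  then show ?thesis by (simp add: phi_term_def)
qed

text \<open>\<open>phi\<close> stops at the least exponent, which an accidental value of some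
  parameter may make smaller than the intended \<open>M\<close>; the terms in between have vanishing
  numerators.\<close>

lemma phi_terminating:
  assumes "t \<noteq> 0" "t powi (- int M) \<in> set as"
  shows "phi as bs t x = (\<Sum>n\<le>M. phi_term as bs t x n)"
proof -
  define L where "L = (LEAST M::nat. t powi (- int M) \<in> set as)"
  have L: "t powi (- int L) \<in> set as" "L \<le> M"
    unfolding L_def using assms(2) by (rule LeastI, rule Least_le)
  have "(\<Sum>n\<le>M. phi_term as bs t x n) = (\<Sum>n\<le>L. phi_term as bs t x n)"
    using L phi_term_beyond[OF assms(1) L(1)] by (intro sum.mono_neutral_right) auto
  then show ?thesis unfolding phi_def L_def[symmetric] using assms(2) by auto
qed

lemma W_term:
  assumes "(rt a)^2 = a" "a \<noteq> 1" "qpochs (t # W_lower rt a cs t) t n \<noteq> 0"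
  shows "phi_term (W_upper rt a cs t) (W_lower rt a cs t) t x n
    = (1 - a * t^(2*n)) / (1-a) * qpoch a t n * qpochs cs t n
      / (qpoch t t n * qpochs (map (\<lambda>c. a*t/c) cs) t n) * x^n"
proof -
  define r where "r = rt a"
  have nz: "qpoch r t n \<noteq> 0" "qpoch (-r) t n \<noteq> 0" using assms(3)
    by (simp_all add: W_lower_def r_def)
  have "r^2 = a" using assms(1) by (simp add: r_def)
  then have "qpoch (r*t) t n * qpoch (-r*t) t n * (1-a) = qpoch r t n * qpoch (-r) t n * (1 - a*t^(2*n))"
    using qpoch_sqrt_pair[of r t n] by simp
  then have "qpoch (t*r) t n * qpoch (-t*r) t n / (qpoch r t n * qpoch (-r) t n) = (1 - a*t^(2*n)) / (1-a)"
    using nz assms(2) by (simp add: field_simps)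
  then have e: "qpoch (t*r) t n * qpoch (-t*r) t n = (1 - a*t^(2*n)) / (1-a) * (qpoch r t n * qpoch (-r) t n)"
    using nz by (simp add: divide_eq_eq)
  have "phi_term (W_upper rt a cs t) (W_lower rt a cs t) t x n =
     qpoch a t n * (qpoch (t*r) t n * qpoch (-t*r) t n) * qpochs cs t n
     / (qpoch t t n * (qpoch r t n * qpoch (-r) t n) * qpochs (map (\<lambda>c. a*t/c) cs) t n) * x^n"
    unfolding phi_term_def by (simp add: W_upper_def W_lower_def r_def mult_ac)
  also have "\<dots> = (1 - a * t^(2*n)) / (1-a) * qpoch a t n * qpochs cs t n
    / (qpoch t t n * qpochs (map (\<lambda>c. a*t/c) cs) t n) * x^n"
    unfolding e using nz by simp
  finally show ?thesis .
qed

text \<open>Parameter pairs \<open>x\<close>, \<open>x*q\<close> of base \<open>q^2\<close> merge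
  into \<open>(x; q)_(2n)\<close>. The upper parameters \<open>q\<close> and \<open>q^2\<close>
  cancel against \<open>(q; q^2)_n\<close> and \<open>(q^2; q^2)_n\<close> below, and the power of
  \<open>a\<close> in \<open>whipple_value_even\<close> cancels against
  \<open>(q/a)^(2*n)\<close>.\<close>

lemma first_series_term:
  fixes a d q y z w :: complex and N n :: nat
  defines "cs \<equiv> [y, y*q, z, z*q, q^2/(a*d), d*q/a, q^2, w, w*q, 1/q^N, q/q^N]"
  assumes nz: "q \<noteq> 0" "a \<noteq> 0" "d \<noteq> 0" "y \<noteq> 0" "z \<noteq> 0" "w \<noteq> 0"
    and rt: "(rt q)^2 = q" and q1: "q \<noteq> 1"
    and den: "qpochs (q^2 # W_lower rt q cs (q^2)) (q^2) n \<noteq> 0"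
    and d: "qpoch (a*d) q (2*n) \<noteq> 0" "qpoch (a*q/d) q (2*n) \<noteq> 0"
  shows "phi_term (W_upper rt q cs (q^2)) (W_lower rt q cs (q^2)) (q^2) (q^2) n
    = (1 - q^(2*(2*n)+1)) / (1-q) * whipple_value a d q (2*n) * (q/a)^(2*n) * bailey_kernel q q y z w N (2*n)"
proof -
  have e: "q*q^2/y = q^2/y*q" "q*q^2/(y*q) = q^2/y" "q*q^2/z = q^2/z*q" "q*q^2/(z*q) = q^2/z"
     "q*q^2/(q^2/(a*d)) = a*d*q" "q*q^2/(d*q/a) = a*q^2/d" "q*q^2/q^2 = q"
     "q*q^2/w = q^2/w*q" "q*q^2/(w*q) = q^2/w" "q*q^2/(1/q^N) = q*q^(N+1)*q" "q*q^2/(q/q^N) = q*q^(N+1)"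
     "q/q^N = 1/q^N*q"
    using nz by (simp_all add: power2_eq_square)
  have f: "qpoch (q^2) (q^2) n \<noteq> 0" "qpoch q (q^2) n \<noteq> 0"
    using den nz by (simp_all add: cs_def W_lower_def)
  have g: "q * (q^2)^(2*n) = q^(2*(2*n)+1)" by (simp add: power_mult)
  have k: "bailey_kernel q q y z w N (2*n) =
    qpoch y (q^2) n * qpoch (y*q) (q^2) n * qpoch z (q^2) n * qpoch (z*q) (q^2) n * qpoch w (q^2) n
      * qpoch (w*q) (q^2) n
     * qpoch (1/q^N) (q^2) n * qpoch (1/q^N*q) (q^2) n /
     (qpoch (q^2/y) (q^2) n * qpoch (q^2/y*q) (q^2) n * qpoch (q^2/z) (q^2) n * qpoch (q^2/z*q) (q^2) n
     * qpoch (q^2/w) (q^2) n * qpoch (q^2/w*q) (q^2) n * qpoch (q*q^(N+1)) (q^2) n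
       * qpoch (q*q^(N+1)*q) (q^2) n)"
    unfolding bailey_kernel_def qpochs_Cons qpochs_Nil qpoch_double by (simp add: power2_eq_square mult_ac)
  show ?thesis
    unfolding W_term[of rt q, OF rt q1 den] whipple_value_even[OF nz(2,3,1) d] k
    unfolding cs_def list.map qpochs_Cons qpochs_Nil e(1-11) g unfolding e(12)
    using f nz by (simp add: power_divide mult_ac flip: power_mult)
qed

text \<open>The coefficient of the second series is minus the summand for \<open>k = 1\<close>;
  splitting the first factor off every product of length \<open>2*n+1\<close> leaves the pairs of
  base \<open>q^2\<close>.\<close>

lemma second_series_term:
  fixes a d q y z w :: complex and N n :: nat
  defines "cs \<equiv> [y*q, y*q^2, z*q, z*q^2, q^3/(a*d), d*q^2/a, q^2, w*q, w*q^2, q/q^N, q^2/q^N]"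
  assumes nz: "q \<noteq> 0" "a \<noteq> 0" "d \<noteq> 0" "y \<noteq> 0" "z \<noteq> 0" "w \<noteq> 0"
    and rt: "(rt (q^3))^2 = q^3" and q1: "q^3 \<noteq> 1"
    and den: "qpochs (q^2 # W_lower rt (q^3) cs (q^2)) (q^2) n \<noteq> 0"
    and d: "qpoch (a*d) q (2*n+1) \<noteq> 0" "qpoch (a*q/d) q (2*n+1) \<noteq> 0"
  shows "a*q * ((1 - d/a) * (1 - q/(a*d)) * (1 - q^3) * (1 - 1/q^N) * (1 - y) * (1 - w) * (1 - z))
       / ((1 - a*d) * (1 - q) * (1 - a*q/d) * (1 - q^(2+N)) * (1 - q^2/y) * (1 - q^2/z) * (1 - q^2/w))
       * phi_term (W_upper rt (q^3) cs (q^2)) (W_lower rt (q^3) cs (q^2)) (q^2) (q^2) n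
    = - ((1 - q^(2*(2*n+1)+1)) / (1-q) * whipple_value a d q (2*n+1)
      * (q/a)^(2*n+1) * bailey_kernel q q y z w N (2*n+1))"
proof -
  have e: "q^3*q^2/(y*q) = q^2/y*q*q" "q^3*q^2/(y*q^2) = q^2/y*q" "q^3*q^2/(z*q)
    = q^2/z*q*q" "q^3*q^2/(z*q^2) = q^2/z*q"
     "q^3*q^2/(q^3/(a*d)) = a*d*q^2" "q^3*q^2/(d*q^2/a) = a*q^3/d" "q^3*q^2/q^2 = q^3"
     "q^3*q^2/(w*q) = q^2/w*q*q" "q^3*q^2/(w*q^2) = q^2/w*q" "q^3*q^2/(q/q^N)
       = q^(2+N)*q*q" "q^3*q^2/(q^2/q^N) = q^(2+N)*q"
     "q/q^N = 1/q^N*q" "q^2/q^N = 1/q^N*q*q" "y*q^2 = y*q*q" "z*q^2 = z*q*q" "w*q^2 = w*q*q"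
    using nz by (simp_all add: power2_eq_square power3_eq_cube power_add)
  have f: "qpoch (q^2) (q^2) n \<noteq> 0" "qpoch (q^3) (q^2) n \<noteq> 0"
    using den unfolding cs_def W_lower_def list.map e(1-11) by simp_all
  have g: "q^3 * (q^2)^(2*n) = q^(2*(2*n+1)+1)" by (simp add: power_mult[symmetric] power_add power3_eq_cube)
  have s: "qpoch x q (2*n+1) = (1-x) * (qpoch (x*q) (q^2) n * qpoch (x*q*q) (q^2) n)" for x
    using qpoch_Suc_left[of x q "2*n"] by (simp add: qpoch_double)
  have k: "bailey_kernel q q y z w N (2*n+1) =
    ((1-y) * (1-z) * (1-w) * (1-1/q^N))
      * (qpoch (y*q) (q^2) n * qpoch (y*q*q) (q^2) n * qpoch (z*q) (q^2) n * qpoch (z*q*q) (q^2) n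
     * qpoch (w*q) (q^2) n * qpoch (w*q*q) (q^2) n * qpoch (1/q^N*q) (q^2) n * qpoch (1/q^N*q*q) (q^2) n) /
     (((1-q^2/y) * (1-q^2/z) * (1-q^2/w) * (1-q^(2+N)))
       * (qpoch (q^2/y*q) (q^2) n * qpoch (q^2/y*q*q) (q^2) n * qpoch (q^2/z*q) (q^2) n
         * qpoch (q^2/z*q*q) (q^2) n
     * qpoch (q^2/w*q) (q^2) n * qpoch (q^2/w*q*q) (q^2) n * qpoch (q^(2+N)*q) (q^2) n
       * qpoch (q^(2+N)*q*q) (q^2) n))"
    unfolding bailey_kernel_def qpochs_Cons qpochs_Nil s by (simp add: power2_eq_square mult_ac)
  define u where "u = 1 - q^3"
  have u: "u \<noteq> 0" using q1 by (simp add: u_def)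
  show ?thesis
    unfolding W_term[of rt "q^3", OF rt q1 den] whipple_value_odd[OF nz(2,3,1) d] k
    unfolding cs_def list.map qpochs_Cons qpochs_Nil e(1-11) g u_def[symmetric] unfolding e(12-)
    using f nz u by (simp add: power_divide power2_eq_square power_mult_distrib power_mult mult_ac
      mult_2_right power_add)
qed

text \<open>For \<open>N = 0\<close> the truncated \<open>(N-1) div 2\<close> would add a spurious
  \<open>f 1\<close>.\<close>

lemma sum_even_odd:
  fixes f :: "nat \<Rightarrow> complex"
  assumes "N > 0"
  shows "(\<Sum>k\<le>N. f k) = (\<Sum>n\<le>N div 2. f (2*n)) + (\<Sum>n\<le>(N-1) div 2. f (2*n+1))"
proof -
  have "(\<Sum>k\<le>Suc m. f k) = (\<Sum>n\<le>Suc m div 2. f (2*n))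
    + (\<Sum>n\<le>m div 2. f (2*n+1))" for m
  proof (induction m)
    case (Suc m)
    show ?case
    proof (cases "even m")
      case True
      then obtain k where m: "m = 2*k" by (elim evenE)
      show ?thesis using Suc by (simp add: m)
    next
      case False
      then obtain k where m: "m = 2*k+1" by (elim oddE)
      show ?thesis using Suc by (simp add: m)
    qed
  qed simp
  from this[of "N-1"] assms show ?thesis by simp
qed

text \<open>
  The hypotheses of (i) exclude every \<open>q\<^sup>m = 1\<close> with \<open>1 \<le> m \<le> 2N + 1\<close>, except
  \<open>q\<^sup>3 = 1\<close> for \<open>N = 2\<close>. Then the right-hand side and the coefficient of the second
  series are zero.
\<close>
lemma first_series_cube_root_of_unity:
  fixes a d q y z w :: complex
  defines "cs \<equiv> [y, y*q, z, z*q, q^2/(a*d), d*q/a, q^2, w, w*q, 1/q^2, q/q^2]"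
  assumes nz: "q \<noteq> 0" "a \<noteq> 0" "d \<noteq> 0" "y \<noteq> 0" "z \<noteq> 0" and w: "w
    = a*q^4/(y*z)"
    and q3: "q^3 = 1" and q1: "q \<noteq> 1" and rt: "(rt q)^2 = q"
    and den: "qpochs (q^2 # W_lower rt q cs (q^2)) (q^2) 1 \<noteq> 0"
  shows "(\<Sum>n\<le>1. phi_term (W_upper rt q cs (q^2)) (W_lower rt q cs (q^2)) (q^2) (q^2) n) = 0"
proof -
  have w0: "w \<noteq> 0" using nz by (simp add: w)
  have one: "qpoch x t 1 = 1 - x" for x t by (simp add: qpoch_def)
  have e: "q*q^2/c = 1/c" for c using q3 by (simp add: power2_eq_square power3_eq_cube mult_ac)
  have frac: "(1-c) = - c * (1-1/c)" if "c \<noteq> 0" for c :: complex using that by (simp add: field_simps)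
  define P where "P = qpochs (map (\<lambda>c. q*q^2/c) cs) (q^2) 1"
  have P: "P \<noteq> 0" using den by (simp add: W_lower_def P_def)
  have q2: "1 - q^2 \<noteq> 0" using den by (simp add: one[simplified])
  \<comment> \<open>Since \<open>q^3 = 1\<close>, each lower parameter is \<open>1/c\<close> for an
    upper one \<open>c\<close>, and \<open>1-c = -c * (1-1/c)\<close>. The eleven parameters
    multiply to \<open>q^13\<close>, so the term of index 1 becomes \<open>-(q^3) = -1\<close> and
    cancels the term of index 0.\<close>
  have cs: "qpochs cs (q^2) 1 = - q * P"
  proof -
    have list: "0 \<notin> set xs \<Longrightarrow> qpochs xs t 1
      = (-1)^length xs * prod_list xs * qpochs (map (\<lambda>c. 1/c) xs) t 1" for xs t
    proof (induction xs)
      case (Cons x xs)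
      then show ?case using frac[of x] by (simp add: one[simplified] mult_ac)
    qed simp
    have "qpochs cs (q^2) 1 = (-1)^length cs * prod_list cs * P"
      unfolding P_def e by (rule list) (use nz w0 in \<open>simp add: cs_def\<close>)
    also have "(-1)^length cs * prod_list cs
      = - (y * (y*q) * z * (z*q) * (q^2/(a*d)) * (d*q/a) * q^2 * w * (w*q) * (1/q^2) * (q/q^2))"
      using nz by (simp add: cs_def power2_eq_square power4_eq_xxxx)
    also have "y * (y*q) * z * (z*q) * (q^2/(a*d)) * (d*q/a) * q^2 * w * (w*q) * (1/q^2) * (q/q^2) = q^13"
      using nz by (simp add: w power2_eq_square field_simps eval_nat_numeral)
    also have "q^13 = (q^3)^4 * q" by (simp add: eval_nat_numeral)
    finally show ?thesis using q3 by simp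
  qed
  have q5: "q * (q^2)^(2*1) = q^2"
  proof -
    have "q * (q^2)^(2*1) = q^3 * q^2" by (simp add: eval_nat_numeral)
    then show ?thesis using q3 by simp
  qed
  have t0: "phi_term (W_upper rt q cs (q^2)) (W_lower rt q cs (q^2)) (q^2) (q^2) 0 = 1"
  proof -
    have "qpochs xs t 0 = 1" for xs t by (induction xs) simp_all
    then show ?thesis by (simp add: phi_term_def)
  qed
  have "phi_term (W_upper rt q cs (q^2)) (W_lower rt q cs (q^2)) (q^2) (q^2) 1
     = (1 - q^2) / (1-q) * (1-q) * (- q * P) / ((1-q^2) * P) * q^2"
    unfolding W_term[of rt q, OF rt q1 den] cs P_def[symmetric] q5 one by simp
  also have "\<dots> = - (q^3)" using P q2 q1 by (simp add: power2_eq_square power3_eq_cube)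
  finally show ?thesis using t0 q3 by simp
qed

text \<open>Powers up to \<open>q^N\<close> come from \<open>(q; q)_N\<close>, and those from
  \<open>q^(N+2)\<close> on from the coefficient and the lower parameters that belong to the
  terminating ones. The gap \<open>q^(N+1)\<close> is closed by \<open>(-q; q)_N\<close> for odd
  \<open>N\<close>, by the square roots of \<open>q\<close> for \<open>N\<close> divisible by 4, and
  by those of \<open>q^3\<close> otherwise; only \<open>N = 2\<close> escapes the last argument,
  because then no factor is available.\<close>

lemma qpoch_nonzero_double:
  fixes q r r3 :: complex
  assumes N: "N > 0" and qN: "qpoch q q N \<noteq> 0" "qpoch (-q) q N \<noteq> 0"
    and q2: "1 - q^(2+N) \<noteq> 0" "qpoch (q^(N+3)) (q^2) (N div 2) \<noteq> 0"
    and q4: "qpoch (q^(N+4)) (q^2) ((N-1) div 2) \<noteq> 0"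
    and r: "r^2 = q" "qpoch r (q^2) (N div 2) \<noteq> 0" "qpoch (-r) (q^2) (N div 2) \<noteq> 0"
    and r3: "r3^2 = q^3" "qpoch r3 (q^2) ((N-1) div 2) \<noteq> 0"
      "qpoch (-r3) (q^2) ((N-1) div 2) \<noteq> 0"
    and corner: "\<not> (N = 2 \<and> q^3 = 1)"
  shows "qpoch q q (2*N+1) \<noteq> 0"
proof -
  have le: "q^m \<noteq> 1" if "0 < m" "m \<le> N" for m
    using qpoch_nonzeroD[OF qN(1), of "m-1"] that by (cases m) auto
  have le': "q^m \<noteq> -1" if "0 < m" "m \<le> N" for m
    using qpoch_nonzeroD[OF qN(2), of "m-1"] that by (cases m) auto
  have sq: "s^2 * (q^2)^(2*i) \<noteq> 1" if "qpoch s (q^2) M \<noteq> 0" "qpoch (-s) (q^2) M \<noteq> 0"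
    "i < M" for s i M
  proof
    assume "s^2 * (q^2)^(2*i) = 1"
    then have "(s * (q^2)^i)^2 = 1" by (simp add: power_mult_distrib mult.commute flip: power_mult)
    then have "s * (q^2)^i = 1 \<or> - s * (q^2)^i = 1" unfolding power2_eq_1_iff by auto
    then show False using qpoch_nonzeroD[OF that(1,3)] qpoch_nonzeroD[OF that(2,3)] by blast
  qed
  have mid: "q^(N+1) \<noteq> 1"
  proof (cases "even N")
    case False
    then obtain j where j: "N = 2*j+1" by (elim oddE)
    show ?thesis
    proof
      assume "q^(N+1) = 1"
      then have "(q^(j+1))^2 = 1" by (simp add: j mult.commute flip: power_mult power_Suc)
      then have "q^(j+1) = 1 \<or> q^(j+1) = -1" unfolding power2_eq_1_iff .
      then show False using le[of "j+1"] le'[of "j+1"] j by auto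
    qed
  next
    case True
    then obtain M where M: "N = 2*M" by (elim evenE)
    show ?thesis
    proof (cases "even M")
      case True
      then obtain i where i: "M = 2*i" by (elim evenE)
      have "q^(N+1) = r^2 * (q^2)^(2*i)" unfolding r(1) by (simp add: M i flip: power_mult)
      then show ?thesis using sq[OF r(2,3), of i] M i N by simp
    next
      case False
      then obtain i where i: "M = 2*i+1" by (elim oddE)
      have *: "q^(N+1) = r3^2 * (q^2)^(2*i)" unfolding r3(1)
        by (simp add: M i power_add power3_eq_cube mult_ac flip: power_mult)
      show ?thesis
      proof (cases "i = 0")
        case True
        then show ?thesis using corner M i by (simp add: eval_nat_numeral)
      next
        case False
        then show ?thesis unfolding * using sq[OF r3(2,3), of i] M i by simp
      qed
    qed
  qed
  have ge: "q^(N+2+j) \<noteq> 1" if "j < N" for j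
  proof (cases "even j")
    case True
    then obtain i where i: "j = 2*i" by (elim evenE)
    show ?thesis
    proof (cases i)
      case 0
      then show ?thesis using q2(1) i by (simp add: add.commute)
    next
      case (Suc i')
      have "i' < (N-1) div 2" using that i Suc by simp
      moreover have "N+2+j = (N+4) + 2*i'" by (simp add: i Suc)
      then have "q^(N+2+j) = q^(N+4) * (q^2)^i'" by (simp only: power_add power_mult)
      ultimately show ?thesis using qpoch_nonzeroD[OF q4] by simp
    qed
  next
    case False
    then obtain i where i: "j = 2*i+1" by (elim oddE)
    have "i < N div 2" using that i by simp
    moreover have "N+2+j = (N+3) + 2*i" by (simp add: i)
    then have "q^(N+2+j) = q^(N+3) * (q^2)^i" by (simp only: power_add power_mult)
    ultimately show ?thesis using qpoch_nonzeroD[OF q2(2)] by simp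
  qed
  have "q * q^i \<noteq> 1" if "i < 2*N+1" for i
  proof -
    consider "i < N" | "i = N" | "i > N" by linarith
    then show ?thesis
    proof cases
      case 1
      then show ?thesis using le[of "Suc i"] by simp
    next
      case 2
      then show ?thesis using mid by simp
    next
      case 3
      then show ?thesis using ge[of "i - N - 1"] that by (simp flip: power_Suc)
    qed
  qed
  then show ?thesis by (auto simp: qpoch_eq_0_iff)
qed

lemma third_series_term:
  fixes a d q y z w :: complex and N n :: nat
  defines "cs \<equiv> [y, z, d, q/d, -a, w, 1/q^N]"
  assumes nz: "q \<noteq> 0" "a \<noteq> 0" "d \<noteq> 0"
    and rt: "(rt a)^2 = a" and a1: "a \<noteq> 1"
    and den: "qpochs (q # W_lower rt a cs q) q n \<noteq> 0"
  shows "phi_term (W_upper rt a cs q) (W_lower rt a cs q) q (-a) n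
    = vwp_term a d q n * bailey_kernel a q y z w N n * (-a)^n"
proof -
  have e: "a*q/(q/d) = a*d" "a*q/(-a) = -q" "a*q/(1/q^N) = a*q^(N+1)" using nz by simp_all
  show ?thesis
    unfolding W_term[of rt a, OF rt a1 den]
    unfolding vwp_term_def bailey_kernel_def cs_def list.map qpochs_Cons qpochs_Nil e
    by (simp add: mult_ac)
qed

lemma terminating_transformation:
  fixes q a d y z :: complex and rt :: "complex \<Rightarrow> complex" and N :: nat
  assumes rt: "\<forall>w. (rt w)^2 = w"
    and nz: "q \<noteq> 0" "a \<noteq> 0" "d \<noteq> 0" "y \<noteq> 0" "z \<noteq> 0"
    and N: "N > 0"
    and cs1: "cs1 = [y, y*q, z, z*q, q^2/(a*d), d*q/a, q^2, a*q^(N+2)/(y*z), a*q^(N+3)/(y*z),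
                q powi (- int N), q powi (1 - int N)]"
    and cs2: "cs2 = [y*q, y*q^2, z*q, z*q^2, q^3/(a*d), d*q^2/a, q^2, a*q^(N+3)/(y*z), a*q^(N+4)/(y*z),
                q powi (1 - int N), q powi (2 - int N)]"
    and cs3: "cs3 = [y, z, d, q/d, - a, a*q^(N+2)/(y*z), q powi (- int N)]"
    and den1: "phi_denoms_nonzero (W_lower rt q cs1 (q^2)) (q^2) {..N div 2}"
    and den2: "phi_denoms_nonzero (W_lower rt (q^3) cs2 (q^2)) (q^2) {..(N - 1) div 2}"
    and den3: "phi_denoms_nonzero (W_lower rt a cs3 q) q {..N}"
    and coef: "(1 - a*d) * (1 - q) * (1 - a*q/d) * (1 - q^(2+N)) * (1 - q^2/y) * (1 - q^2/z)
           * (1 - y*z*q powi (- int N)/a) \<noteq> 0"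
    and pref: "qpochs [q^2/y, q^2/z, a*q/(y*z), a*q] q N \<noteq> 0"
  shows "W rt q cs1 (q^2) (q^2)
         - a*q * ((1 - d/a) * (1 - q/(a*d)) * (1 - q^3) * (1 - q powi (- int N)) * (1 - y)
                    * (1 - a*q^(2+N)/(y*z)) * (1 - z))
               / ((1 - a*d) * (1 - q) * (1 - a*q/d) * (1 - q^(2+N)) * (1 - q^2/y) * (1 - q^2/z)
                    * (1 - y*z*q powi (- int N)/a))
           * W rt (q^3) cs2 (q^2) (q^2)
         = qpochs [q^2, q^2/(y*z), a*q/y, a*q/z] q N / qpochs [q^2/y, q^2/z, a*q/(y*z), a*q] q N
           * W rt a cs3 q (- a)"
proof -
  define w where "w = a*q^(N+2)/(y*z)"
  have w0: "w \<noteq> 0" using nz by (simp add: w_def)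
  have p: "q powi (- int N) = 1/q^N" "q powi (1 - int N) = q/q^N" "q powi (2 - int N) = q^2/q^N"
    using nz by (simp_all add: power_int_minus power_int_diff divide_inverse)
  have w: "a*q^(N+2)/(y*z) = w" "a*q^(N+3)/(y*z) = w*q" "a*q^(N+4)/(y*z) = w*q^2" "a*q^(2+N)/(y*z) = w"
    "y*z*(1/q^N)/a = q^2/w" "a*q/w = y*z/q^(N+1)"
    using nz by (simp_all add: w_def power_add power2_eq_square eval_nat_numeral)
  note cs1' = cs1[unfolded p w] and cs2' = cs2[unfolded p w] and cs3' = cs3[unfolded p w]
  have q0: "q^2 \<noteq> 0" using nz by simp
  have d1: "qpochs (q^2 # W_lower rt q cs1 (q^2)) (q^2) n \<noteq> 0" if "n \<le> N div 2" for n
    using den1 that unfolding phi_denoms_nonzero_def by simp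
  have d2: "qpochs (q^2 # W_lower rt (q^3) cs2 (q^2)) (q^2) n \<noteq> 0" if "n \<le> (N-1) div 2" for n
    using den2 that unfolding phi_denoms_nonzero_def by simp
  have d3: "qpochs (q # W_lower rt a cs3 q) q n \<noteq> 0" if "n \<le> N" for n
    using den3 that unfolding phi_denoms_nonzero_def by simp
  have q1: "q \<noteq> 1" using coef by auto
  have pow: "(q^2) powi (- int m) = 1/q^(2*m)" for m
    by (simp add: power_int_minus divide_inverse flip: power_mult)
  have phi1: "W rt q cs1 (q^2) (q^2)
    = (\<Sum>n\<le>N div 2. phi_term (W_upper rt q cs1 (q^2)) (W_lower rt q cs1 (q^2)) (q^2) (q^2) n)"
  proof -
    \<comment> \<open>Whichever of \<open>q^(-N)\<close> and \<open>q^(1-N)\<close> has an even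
      exponent terminates the series of base \<open>q^2\<close>.\<close>
    have "(q^2) powi (- int (N div 2)) \<in> {1/q^N, q/q^N}"
      using nz by (cases "even N") (auto simp: pow elim!: evenE oddE)
    then show ?thesis unfolding W_def by (intro phi_terminating q0) (auto simp: W_upper_def cs1')
  qed
  have phi2: "W rt (q^3) cs2 (q^2) (q^2)
    = (\<Sum>n\<le>(N-1) div 2. phi_term (W_upper rt (q^3) cs2 (q^2)) (W_lower rt (q^3) cs2 (q^2)) (q^2)
      (q^2) n)"
  proof -
    have "(q^2) powi (- int ((N-1) div 2)) \<in> {q/q^N, q^2/q^N}"
    proof (cases "even N")
      case True
      then obtain m where "N = 2 * Suc m" using N
        by (metis evenE gr0_implies_Suc mult_0_right neq0_conv not_gr0)
      then have "q^N = q^2 * q^(2*m)" "(N-1) div 2 = m" by (simp_all add: power2_eq_square)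
      then show ?thesis using nz by (simp add: pow)
    next
      case False
      then show ?thesis using nz by (auto simp: pow elim!: oddE)
    qed
    then show ?thesis unfolding W_def by (intro phi_terminating q0) (auto simp: W_upper_def cs2')
  qed
  have phi3: "W rt a cs3 q (-a) = (\<Sum>n\<le>N. phi_term (W_upper rt a cs3 q) (W_lower rt a cs3 q) q (-a)
    n)"
    unfolding W_def by (rule phi_terminating) (use nz in \<open>auto simp: W_upper_def cs3\<close>)
  have e3: "a*q/(q/d) = a*d" "a*q/(-a) = -q" "a*q/(1/q^N) = a*q*q^N" using nz by simp_all
  have D3: "qpoch q q N \<noteq> 0" "qpoch (rt a) q N \<noteq> 0" "qpoch (- rt a) q N \<noteq> 0"
    "qpoch (a*q/y) q N \<noteq> 0" "qpoch (a*q/z) q N \<noteq> 0"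
    "qpoch (a*q/d) q N \<noteq> 0" "qpoch (a*d) q N \<noteq> 0" "qpoch (-q) q N \<noteq> 0"
      "qpoch (y*z/q^(N+1)) q N \<noteq> 0" "qpoch (a*q*q^N) q N \<noteq> 0"
    using d3[of N] unfolding W_lower_def cs3' list.map e3 w by simp_all
  have a1: "a \<noteq> 1"
  proof
    assume "a = 1"
    then have "(rt a)^2 = 1" using rt by simp
    then have "rt a = 1 \<or> - rt a = 1" unfolding power2_eq_1_iff by auto
    then show False using D3(2,3) N by (auto simp: qpoch_eq_0_iff)
  qed
  have P: "qpoch (q^2/y) q N \<noteq> 0" "qpoch (q^2/z) q N \<noteq> 0" "qpoch (a*q/(y*z)) q N \<noteq> 0"
    "qpoch (a*q) q N \<noteq> 0"
    using pref by simp_all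
  have aq: "qpoch (a*q) q (2*N) \<noteq> 0" using P D3(10) by (simp add: mult_2 qpoch_add)
  show ?thesis
  proof (cases "N = 2 \<and> q^3 = 1")
    case True
    have "W rt q cs1 (q^2) (q^2) = 0"
    proof -
      have "2 div 2 = (1::nat)" by simp
      then show ?thesis
        unfolding phi1 using True nz q1 rt d1[of 1]
          by (simp only: cs1' w_def) (intro first_series_cube_root_of_unity, simp_all)
    qed
    moreover have "qpoch (q^2) q N = 0" using True
      by (auto simp: qpoch_eq_0_iff power2_eq_square power3_eq_cube mult_ac intro!: exI[of _ 1])
    ultimately show ?thesis using True by simp
  next
    case False
    have D1: "qpoch (rt q) (q^2) (N div 2) \<noteq> 0" "qpoch (- rt q) (q^2) (N div 2) \<noteq> 0"
      "qpoch (q^(N+3)) (q^2) (N div 2) \<noteq> 0"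
    proof -
      have "q*q^2/(1/q^N) = q^(N+3)" by (simp add: power_add power2_eq_square power3_eq_cube mult_ac)
      then show "qpoch (rt q) (q^2) (N div 2) \<noteq> 0" "qpoch (- rt q) (q^2) (N div 2) \<noteq> 0"
        "qpoch (q^(N+3)) (q^2) (N div 2) \<noteq> 0"
        using d1[of "N div 2"] unfolding W_lower_def cs1' list.map by simp_all
    qed
    have D2: "qpoch (rt (q^3)) (q^2) ((N-1) div 2) \<noteq> 0"
      "qpoch (- rt (q^3)) (q^2) ((N-1) div 2) \<noteq> 0" "qpoch (q^(N+4)) (q^2) ((N-1) div 2) \<noteq> 0"
    proof -
      have "q^3*q^2/(q/q^N) = q^(N+4)" using nz by (simp add: power_add eval_nat_numeral mult_ac)
      then show "qpoch (rt (q^3)) (q^2) ((N-1) div 2) \<noteq> 0"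
        "qpoch (- rt (q^3)) (q^2) ((N-1) div 2) \<noteq> 0" "qpoch (q^(N+4)) (q^2) ((N-1) div 2) \<noteq> 0"
        using d2[of "(N-1) div 2"] unfolding W_lower_def cs2' list.map by simp_all
    qed
    have qq: "qpoch q q (2*N+1) \<noteq> 0"
      by (rule qpoch_nonzero_double[OF N D3(1,8) _ D1(3) D2(3) _ D1(1,2) _ D2(1,2) False]) (use coef rt in
        auto)
    have q3: "q^3 \<noteq> 1" using qpoch_nonzeroD[OF qq, of 2] N
      by (simp add: power3_eq_cube power2_eq_square mult_ac)
    define f where "f k = (1-q^(2*k+1))
      / (1-q) * whipple_value a d q k * (q/a)^k * bailey_kernel q q y z w N k" for k
    define c where "c = a*q * ((1 - d/a) * (1 - q/(a*d)) * (1 - q^3) * (1 - 1/q^N) * (1 - y) * (1 - w)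
      * (1 - z))
       / ((1 - a*d) * (1 - q) * (1 - a*q/d) * (1 - q^(2+N)) * (1 - q^2/y) * (1 - q^2/z) * (1 - q^2/w))"
    have dd: "qpoch (a*d) q m \<noteq> 0" "qpoch (a*q/d) q m \<noteq> 0" if "m \<le> N" for m
      using qpoch_nonzero_le[OF D3(7) that] qpoch_nonzero_le[OF D3(6) that] by auto
    have S1: "W rt q cs1 (q^2) (q^2) = (\<Sum>n\<le>N div 2. f (2*n))"
      unfolding phi1 unfolding f_def cs1'
      by (intro sum.cong refl first_series_term) (use nz w0 q1 rt d1 dd cs1' in auto)
    have S2: "c * W rt (q^3) cs2 (q^2) (q^2) = - (\<Sum>n\<le>(N-1) div 2. f (2*n+1))"
      unfolding phi2 unfolding f_def cs2' c_def sum_distrib_left sum_negf[symmetric]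
      by (intro sum.cong refl second_series_term) (use nz w0 q3 rt d2 dd cs2' N in auto)
    have S3: "W rt a cs3 q (-a) = (\<Sum>n\<le>N. vwp_term a d q n * bailey_kernel a q y z w N n * (-a)^n)"
      unfolding phi3 unfolding cs3'
      by (intro sum.cong refl third_series_term) (use nz a1 rt d3 cs3' in auto)
    have "W rt q cs1 (q^2) (q^2) - c * W rt (q^3) cs2 (q^2) (q^2) = (\<Sum>k\<le>N. f k)"
      unfolding S1 S2 sum_even_odd[OF N] by simp
    also have "\<dots> = qpochs [q^2, q^2/(y*z), a*q/y, a*q/z] q N / qpochs [q^2/y, q^2/z, a*q/(y*z), a*q] q
      N * W rt a cs3 q (-a)"
      unfolding f_def S3 w_def
      by (rule bailey_transformation) (use nz a1 qq D3 aq P in auto)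
    finally show ?thesis unfolding c_def p w .
  qed
qed

section \<open>The nonterminating quadratic summation\<close>

lemma lagrange_interpolation:
  fixes p :: "complex poly" and u :: "nat \<Rightarrow> complex"
  assumes inj: "inj_on u {..m}" and deg: "degree p \<le> m"
  shows "poly p x = (\<Sum>k\<le>m. poly p (u k) * (\<Prod>i\<in>{..m}-{k}. (x - u i) / (u k - u i)))"
proof -
  define l where "l k = (\<Prod>i\<in>{..m}-{k}. smult (1 / (u k - u i)) [:- u i, 1:])" for k
  define L where "L = (\<Sum>k\<le>m. smult (poly p (u k)) (l k))"
  have l: "poly (l k) x = (\<Prod>i\<in>{..m}-{k}. (x - u i) / (u k - u i))" for k x
    by (simp add: l_def poly_prod divide_inverse algebra_simps)
  have "degree (l k) \<le> m" if "k \<le> m" for k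
  proof -
    have "degree (l k) \<le> (\<Sum>i\<in>{..m}-{k}. degree (smult (1 / (u k - u i)) [:- u i, 1:]))"
      unfolding l_def by (rule order_trans[OF degree_prod_sum_le]) (simp_all add: o_def)
    also have "\<dots> \<le> (\<Sum>i\<in>{..m}-{k}. 1)"
      by (intro sum_mono order_trans[OF degree_smult_le]) simp
    finally show ?thesis using that by simp
  qed
  then have degL: "degree L \<le> m" unfolding L_def
    by (intro degree_sum_le) (auto intro: order_trans[OF degree_smult_le])
  have lu: "poly (l k) (u j) = (if k = j then 1 else 0)" if "k \<le> m" "j \<le> m" for k j
  proof (cases "k = j")
    case True
    have "(u j - u i) / (u j - u i) = 1" if "i \<in> {..m} - {j}" for i
      using inj_on_eq_iff[OF inj, of j i] \<open>j \<le> m\<close> that by simp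
    then show ?thesis unfolding l using True by simp
  next
    case False
    then show ?thesis unfolding l using that by (auto intro!: prod_zero bexI[of _ j])
  qed
  have "poly L (u j) = poly p (u j)" if "j \<le> m" for j
    using that by (simp add: L_def poly_sum lu if_distrib cong: if_cong)
  then have "p = L"
    by (intro poly_eqI_degree[of "u ` {..m}"]) (use deg degL inj in \<open>auto simp: card_image\<close>)
  then have "poly p x = poly L x" by simp
  then show ?thesis by (simp add: L_def poly_sum l)
qed

section \<open>Infinite products\<close>

lemma has_prod_qpoch:
  assumes "norm t < 1"
  shows "(\<lambda>i. 1 - x * t ^ i) has_prod qpoch_inf x t"
proof -
  have "summable (\<lambda>i. norm (1 - x * t ^ i - 1))"
    using assms by (simp add: norm_mult norm_power summable_mult summable_geometric)
  then have "convergent_prod (\<lambda>i. 1 - x * t ^ i)"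
    by (intro abs_convergent_prod_imp_convergent_prod summable_imp_abs_convergent_prod)
  then show ?thesis unfolding qpoch_inf_def by (rule convergent_prod_has_prod)
qed

lemma qpoch_LIMSEQ: "norm t < 1 \<Longrightarrow> qpoch x t \<longlonglongrightarrow> qpoch_inf x t"
  using has_prod_imp_tendsto'[OF has_prod_qpoch[of t x]] by (simp add: qpoch_def[abs_def])

lemma qpoch_inf_eq_0_iff: "norm t < 1 \<Longrightarrow> qpoch_inf x t
  = 0 \<longleftrightarrow> (\<exists>n. qpoch x t n = 0)"
proof -
  assume t: "norm t < 1"
  have "(\<exists>i. x * t^i = 1) \<longleftrightarrow> (\<exists>n. \<exists>i<n. x * t^i = 1)" by blast
  then show ?thesis
    using has_prod_eq_0_iff[OF has_prod_qpoch[OF t, of x]] by (auto simp: qpoch_eq_0_iff image_iff)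
qed

lemma qpoch_bounded:
  assumes "norm t < 1"
  obtains B where "B > 0" "\<And>n. norm (qpoch x t n) \<le> B"
  using convergent_imp_Bseq[OF convergentI[OF qpoch_LIMSEQ[OF assms]]] unfolding Bseq_def by blast

lemma inverse_qpoch_bounded:
  assumes "norm t < 1" "qpoch_inf x t \<noteq> 0"
  obtains B where "B > 0" "\<And>n. norm (inverse (qpoch x t n)) \<le> B"
  using convergent_imp_Bseq[OF convergentI[OF tendsto_inverse[OF qpoch_LIMSEQ[OF assms(1)] assms(2)]]]
  unfolding Bseq_def by blast

lemma qpoch_inf_double:
  assumes "norm q < 1"
  shows "qpoch_inf x q = qpoch_inf x (q^2) * qpoch_inf (x*q) (q^2)"
proof (rule LIMSEQ_unique)
  have "norm (q^2) < 1" using assms by (simp add: norm_power power_less_one_iff)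
  then show "(\<lambda>n. qpoch x q (2*n)) \<longlonglongrightarrow> qpoch_inf x (q^2)
    * qpoch_inf (x*q) (q^2)"
    unfolding qpoch_double by (intro tendsto_mult qpoch_LIMSEQ)
  show "(\<lambda>n. qpoch x q (2*n)) \<longlonglongrightarrow> qpoch_inf x q"
    using LIMSEQ_subseq_LIMSEQ[OF qpoch_LIMSEQ[OF assms], of "\<lambda>n. 2*n"]
      by (simp add: strict_mono_def o_def)
qed

lemma qpoch_inf_shift:
  assumes "norm q < 1"
  shows "qpoch_inf x q = (1-x) * qpoch_inf (x*q) q"
proof (rule LIMSEQ_unique)
  show "(\<lambda>n. qpoch x q (Suc n)) \<longlonglongrightarrow> (1-x) * qpoch_inf (x*q) q"
    unfolding qpoch_Suc_left by (intro tendsto_mult tendsto_const qpoch_LIMSEQ assms)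
  show "(\<lambda>n. qpoch x q (Suc n)) \<longlonglongrightarrow> qpoch_inf x q"
    using qpoch_LIMSEQ[OF assms] by (rule LIMSEQ_Suc)
qed

definition interp_num :: "complex \<Rightarrow> complex \<Rightarrow> complex \<Rightarrow> nat
  \<Rightarrow> complex \<Rightarrow> complex" where
  "interp_num a d q M y = qpochs [a*d*y, a*d*q/y, a*y*q/d, q^2*a/(d*y)] (q^2) M"

text \<open>
  Since \<open>(1 - sy)(1 - sq/y) = 1 + s\<^sup>2q - s(y + q/y)\<close>, the numerator is a polynomial of
  degree \<open>2M\<close> in \<open>y + q/y\<close>.
\<close>
lemma interp_num_lagrange:
  assumes q: "q \<noteq> 0" "norm q < 1" and y: "y \<noteq> 0" and d: "d \<noteq> 0"
  shows "interp_num a d q M y = (\<Sum>k\<le>2*M. interp_num a d q M (1/q^k)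
     * (\<Prod>i\<in>{..2*M}-{k}. (1-y*q^i) * (1-q^(i+1)/y) / ((1-q^i/q^k) * (1-q^(i+1)*q^k))))"
proof -
  define lin where "lin s = [:1 + s^2*q, -s:]" for s
  have lin: "poly (lin s) (y + q/y) = (1 - s*y) * (1 - s*q/y)" if "y \<noteq> 0" for s y
    using that by (simp add: lin_def field_simps power2_eq_square)
  define p where "p = (\<Prod>i<M. lin (a*d*(q^2)^i) * lin (a*q/d*(q^2)^i))"
  have p: "poly p (y + q/y) = interp_num a d q M y" if "y \<noteq> 0" for y
  proof -
    have "poly p (y + q/y) = (\<Prod>i<M. (1 - a*d*(q^2)^i*y) * (1 - a*d*(q^2)^i*q/y)
      * ((1 - a*q/d*(q^2)^i*y) * (1 - a*q/d*(q^2)^i*q/y)))"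
      by (simp add: p_def poly_prod lin that)
    also have "\<dots> = interp_num a d q M y"
      unfolding interp_num_def qpochs_Cons qpochs_Nil qpoch_def prod.distrib[symmetric] mult_1_right
      by (intro prod.cong refl) (simp add: mult_ac power2_eq_square)
    finally show ?thesis .
  qed
  have "degree p \<le> (\<Sum>i<M. degree (lin (a*d*(q^2)^i) * lin (a*q/d*(q^2)^i)))"
    unfolding p_def by (rule order_trans[OF degree_prod_sum_le]) (simp_all add: o_def)
  also have "\<dots> \<le> (\<Sum>i<M. 2)"
  proof (rule sum_mono)
    have "degree (lin s * lin r) \<le> 2" for s r
      by (rule order_trans[OF degree_mult_le]) (simp add: lin_def)
    then show "degree (lin (a*d*(q^2)^i) * lin (a*q/d*(q^2)^i)) \<le> 2" for i .
  qed
  finally have deg: "degree p \<le> 2*M" by simp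
  define u where "u k = 1/q^k + q/(1/q^k)" for k :: nat
  have qn: "q^n \<noteq> 1" if "n > 0" for n
    using power_less_one_iff[of "norm q" n] q that by (auto simp flip: norm_power)
  \<comment> \<open>In \<open>x\<close>, the difference vanishes at \<open>q^(-i)\<close> and at
    \<open>q^(i+1)\<close>. Setting \<open>x = q^(-k)\<close> gives the differences of
    nodes.\<close>
  have diff: "x + q/x - u i = - ((1-x*q^i) * (1-q^(i+1)/x)) / q^i" if "x \<noteq> 0" for x i
    using that q by (simp add: u_def field_simps)
  have udiff: "u k - u i = - ((1-q^i/q^k) * (1-q^(i+1)*q^k)) / q^i" for k i
    using diff[of "1/q^k" i] q by (simp add: u_def[symmetric]) (simp add: u_def)
  \<comment> \<open>Distinct nodes coincide only if \<open>q^i = q^k\<close> or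
    \<open>q^(i+k+1) = 1\<close>, and both contradict \<open>0 < norm q < 1\<close>.\<close>
  have inj: "inj_on u {..2*M}"
  proof (rule inj_onI, rule ccontr)
    fix k i assume *: "u k = u i" "k \<noteq> i"
    have "q^(i+1)*q^k \<noteq> 1" using qn[of "i+1+k"] by (simp add: power_add mult_ac)
    moreover have "q^i \<noteq> q^k"
    proof
      assume e: "q^i = q^k"
      have "norm q ^ i = norm q ^ k" using arg_cong[OF e, of norm] by (simp add: norm_power)
      then show False using * q power_inject_exp'[of "norm q" i k] by simp
    qed
    ultimately show False using udiff[of k i] * q by simp
  qed
  have "interp_num a d q M y = (\<Sum>k\<le>2*M. poly p (u k) * (\<Prod>i\<in>{..2*M}-{k}. (y + q/y - u i)
    / (u k - u i)))"
    unfolding p[OF y, symmetric] by (rule lagrange_interpolation[OF inj deg])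
  also have "\<dots> = (\<Sum>k\<le>2*M. interp_num a d q M (1/q^k)
     * (\<Prod>i\<in>{..2*M}-{k}. (1-y*q^i) * (1-q^(i+1)/y) / ((1-q^i/q^k) * (1-q^(i+1)*q^k))))"
  proof -
    have "poly p (u k) = interp_num a d q M (1/q^k)" for k
      using p[of "1/q^k"] q by (simp add: u_def)
    then show ?thesis unfolding diff[OF y] udiff using q by simp
  qed
  finally show ?thesis .
qed

lemma prod_except:
  "(\<Prod>i\<in>{..k+j}-{k}. f i)
    = (\<Prod>i<k. f i) * (\<Prod>i<j. f (Suc k + i))" for f :: "nat \<Rightarrow> complex"
proof -
  have "(\<Prod>i\<in>{..k+j}-{k}. f i) = (\<Prod>i\<in>{..<k} \<union> {Suc k..<Suc k + j}. f i)"
    by (intro prod.cong) auto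
  also have "\<dots> = (\<Prod>i<k. f i) * (\<Prod>i\<in>{Suc k..<Suc k + j}. f i)"
    by (intro prod.union_disjoint) auto
  also have "(\<Prod>i\<in>{Suc k..<Suc k + j}. f i) = (\<Prod>i<j. f (Suc k + i))"
    using prod.shift_bounds_nat_ivl[of f 0 "Suc k" j] by (simp add: lessThan_atLeast0 add.commute)
  finally show ?thesis .
qed

text \<open>Equal to \<open>(-1)^k q^(-k(k+1)/2)\<close>.\<close>
definition node_sign :: "complex \<Rightarrow> nat \<Rightarrow> complex" where
  "node_sign q k = (\<Prod>i<k. - (q^i / q^k))"

text \<open>The omitted index \<open>i = k\<close> is exactly the factor
  \<open>1 - q^(2*k+1)\<close> missing from \<open>(q; q)_(m+1+k)\<close>; it reappears as the
  very-well-poised factor of the expansion.\<close>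

lemma node_denominator:
  assumes "q \<noteq> 0" "k \<le> m"
  shows "(\<Prod>i\<in>{..m}-{k}. (1-q^i/q^k) * (1-q^(i+1)*q^k)) * (1 - q^(2*k+1))
    = node_sign q k * qpoch q q (m-k) * qpoch q q (m+1+k)"
proof -
  obtain j where m: "m = k + j" using assms(2) le_Suc_ex by blast
  have 1: "(\<Prod>i<k. 1-q^i/q^k) = node_sign q k * qpoch q q k"
    using qpoch_reverse[of "1/q^k" q k] assms(1) by (simp add: node_sign_def qpoch_def)
  have 2: "(\<Prod>i<j. 1-q^(Suc k+i)/q^k) = qpoch q q j"
    using assms(1) by (simp add: qpoch_def power_add)
  have 3: "(\<Prod>i<k. 1-q^(i+1)*q^k) = qpoch (q^(k+1)) q k"
    by (simp add: qpoch_def mult_ac)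
  have 4: "(\<Prod>i<j. 1-q^(Suc k+i+1)*q^k) = qpoch (q^(2*k+2)) q j"
    by (simp add: qpoch_def power_add mult_ac mult_2_right)
  have "m + 1 + k = k + (k + Suc j)" using m by simp
  then have "qpoch q q (m+1+k) = qpoch q q k * (qpoch (q^(k+1)) q k
    * ((1 - q^(2*k+1)) * qpoch (q^(2*k+2)) q j))"
    by (simp only: qpoch_add qpoch_Suc_left) (simp add: power_add mult_2 mult_2_right mult_ac)
  then show ?thesis unfolding m prod_except prod.distrib 1 2 3 4 using m by (simp add: mult_ac)
qed

lemma prod_even_odd: "(\<Prod>i<2*n. f i)
  = (\<Prod>i<n. f (2*i) * f (2*i+1))" for f :: "nat \<Rightarrow> complex"
  by (induction n) (simp_all add: mult_ac)

lemma prod_scale: "(\<Prod>i<n. c * f i) = c^n * (\<Prod>i<n. f i)" for f :: "nat \<Rightarrow> complex"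
  by (simp add: prod.distrib)

text \<open>The first \<open>n\<close> factors of \<open>(adq^(-2n); q^2)_M\<close> and of its
  analogue for \<open>aq/d\<close> have negative powers of \<open>q\<close>; reversed, they form the
  numerator of \<open>whipple_value_even\<close>. The products starting at \<open>adq^(2n+1)\<close>
  and \<open>aq^(2n+2)/d\<close> are completed from the left by its denominator.\<close>

lemma interp_num_node_even:
  assumes nz: "q \<noteq> 0" "a \<noteq> 0" "d \<noteq> 0" and n: "n \<le> M"
    and dd: "qpoch (a*d) q (2*n) \<noteq> 0" "qpoch (a*q/d) q (2*n) \<noteq> 0"
  shows "interp_num a d q M (1/q^(2*n)) = node_sign q (2*n) * whipple_value a d q (2*n)
     * (qpoch (a*d) (q^2) (M-n) * qpoch (a*d*q) (q^2) (M+n))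
       * (qpoch (a*q/d) (q^2) (M-n) * qpoch (a*q/d*q) (q^2) (M+n))"
proof -
  obtain j where M: "M = n + j" using n le_Suc_ex by blast
  have Q: "(q^2)^n = q^(2*n)" by (simp add: power_mult)
  have s1: "qpoch (x/q^(2*n)) (q^2) M = qpoch (x/q^(2*n)) (q^2) n * qpoch x (q^2) (M-n)" for x
    using qpoch_add[of "x/q^(2*n)" "q^2" n j] nz by (simp add: M Q)
  have s2: "qpoch x (q^2) n * qpoch (x*q^(2*n)) (q^2) M = qpoch x (q^2) (M+n)" for x
    using qpoch_add[of x "q^2" n M] by (simp add: Q add.commute)
  have nz2: "qpoch (a*d*q) (q^2) n \<noteq> 0" "qpoch (a*q/d*q) (q^2) n \<noteq> 0"
    using dd by (auto simp: qpoch_double)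
  have rev: "qpoch (a*d/q^(2*n)) (q^2) n * qpoch (a*q/d/q^(2*n)) (q^2) n
     = node_sign q (2*n) * (a^(2*n) * qpoch (q^2/(a*d)) (q^2) n * qpoch (d*q/a) (q^2) n)"
  proof -
    have "q^2/(a*d/q^(2*n)*(q^2)^n) = q^2/(a*d)" "q^2/(a*q/d/q^(2*n)*(q^2)^n) = d*q/a"
      unfolding Q using nz by (simp_all add: power2_eq_square)
    then have 1: "qpoch (a*d/q^(2*n)) (q^2) n
      = (\<Prod>i<n. - (a*d/q^(2*n)*(q^2)^i)) * qpoch (q^2/(a*d)) (q^2) n"
     and 2: "qpoch (a*q/d/q^(2*n)) (q^2) n = (\<Prod>i<n. - (a*q/d/q^(2*n)*(q^2)^i)) * qpoch (d*q/a) (q^2) n"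
      using qpoch_reverse[of "a*d/q^(2*n)" "q^2" n] qpoch_reverse[of "a*q/d/q^(2*n)" "q^2" n] nz by simp_all
    have "(\<Prod>i<n. - (a*d/q^(2*n)*(q^2)^i)) * (\<Prod>i<n. - (a*q/d/q^(2*n)*(q^2)^i))
      = (\<Prod>i<n. a^2 * ((- (q^(2*i)/q^(2*n))) * (- (q^(2*i+1)/q^(2*n)))))"
      unfolding prod.distrib[symmetric] using nz
        by (intro prod.cong refl) (simp add: power2_eq_square power_mult power_mult_distrib mult_ac)
    also have "\<dots> = a^(2*n) * node_sign q (2*n)"
      unfolding node_sign_def prod_even_odd prod_scale power_mult ..
    finally have *: "(\<Prod>i<n. - (a*d/q^(2*n)*(q^2)^i)) * (\<Prod>i<n. - (a*q/d/q^(2*n)*(q^2)^i))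
      = a^(2*n) * node_sign q (2*n)" .
    have gen: "x*x' = A*S \<Longrightarrow> (x*g)*(x'*h) = S*(A*g*h)" for x x' A S g h :: complex by algebra
    show ?thesis unfolding 1 2 by (rule gen[OF *])
  qed
  have e: "a*d*(1/q^(2*n)) = a*d/q^(2*n)" "a*d*q/(1/q^(2*n)) = a*d*q*q^(2*n)" "a*(1/q^(2*n))*q/d
    = a*q/d/q^(2*n)"
     "q^2*a/(d*(1/q^(2*n))) = a*q/d*q*q^(2*n)" by (simp_all add: power2_eq_square mult_ac)
  have "interp_num a d q M (1/q^(2*n)) = (qpoch (a*d/q^(2*n)) (q^2) n * qpoch (a*q/d/q^(2*n)) (q^2) n)
    * qpoch (a*d) (q^2) (M-n) * qpoch (a*d*q*q^(2*n)) (q^2) M * qpoch (a*q/d) (q^2) (M-n)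
      * qpoch (a*q/d*q*q^(2*n)) (q^2) M"
    unfolding interp_num_def qpochs_Cons qpochs_Nil e s1 by (simp add: mult_ac)
  also have "\<dots> = node_sign q (2*n) * whipple_value a d q (2*n)
     * (qpoch (a*d) (q^2) (M-n) * qpoch (a*d*q) (q^2) (M+n))
       * (qpoch (a*q/d) (q^2) (M-n) * qpoch (a*q/d*q) (q^2) (M+n))"
    unfolding rev whipple_value_even[OF nz(2,3,1) dd] s2[symmetric] using nz2
      by (simp add: power2_eq_square mult_ac)
  finally show ?thesis .
qed

text \<open>As for even nodes with the two residue classes exchanged: \<open>n+1\<close> factors
  have negative powers of \<open>q\<close>, and the tails start at \<open>adq\<close> and
  \<open>aq^2/d\<close>.\<close>

lemma interp_num_node_odd:
  assumes nz: "q \<noteq> 0" "a \<noteq> 0" "d \<noteq> 0" and n: "n < M"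
    and dd: "qpoch (a*d) q (2*n+1) \<noteq> 0" "qpoch (a*q/d) q (2*n+1) \<noteq> 0"
  shows "interp_num a d q M (1/q^(2*n+1)) = node_sign q (2*n+1) * whipple_value a d q (2*n+1)
     * (qpoch (a*d*q) (q^2) (M-Suc n) * qpoch (a*d) (q^2) (M+Suc n))
       * (qpoch (a*q/d*q) (q^2) (M-Suc n) * qpoch (a*q/d) (q^2) (M+Suc n))"
proof -
  obtain j where M: "M = Suc n + j" using n le_Suc_ex[of "Suc n" M] by auto
  have Q: "(q^2)^Suc n = q^(2*n+1)*q" by (simp add: power_mult power2_eq_square)
  have s1: "qpoch (x/q^(2*n+1)) (q^2) M
    = qpoch (x/q^(2*n+1)) (q^2) (Suc n) * qpoch (x*q) (q^2) (M-Suc n)" for x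
    using qpoch_add[of "x/q^(2*n+1)" "q^2" "Suc n" j] nz unfolding M Q by simp
  have s2: "qpoch x (q^2) (Suc n) * qpoch (x*q*q^(2*n+1)) (q^2) M = qpoch x (q^2) (M+Suc n)" for x
    using qpoch_add[of x "q^2" "Suc n" M] unfolding Q by (simp add: add.commute mult_ac)
  have nz2: "qpoch (a*d) (q^2) (Suc n) \<noteq> 0" "qpoch (a*q/d) (q^2) (Suc n) \<noteq> 0"
  proof -
    have "(q^2)^i = q^(2*i)" for i by (simp add: power_mult)
    then have "qpoch x q (2*n+1) \<noteq> 0 \<Longrightarrow> qpoch x (q^2) (Suc n) \<noteq> 0" for x
      unfolding qpoch_eq_0_iff by (metis Suc_eq_plus1 less_Suc_eq_le mult_le_mono2)
    then show "qpoch (a*d) (q^2) (Suc n) \<noteq> 0" "qpoch (a*q/d) (q^2) (Suc n) \<noteq> 0"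
      using dd by blast+
  qed
  have rev: "qpoch (a*d/q^(2*n+1)) (q^2) (Suc n) * qpoch (a*q/d/q^(2*n+1)) (q^2) (Suc n)
     = - node_sign q (2*n+1) * (a^(2*n+2) * qpoch (q/(a*d)) (q^2) (Suc n) * qpoch (d/a) (q^2) (Suc n))"
  proof -
    have "q^2/(a*d/q^(2*n+1)*(q^2)^Suc n) = q/(a*d)" "q^2/(a*q/d/q^(2*n+1)*(q^2)^Suc n) = d/a"
      unfolding Q using nz by (simp_all add: power2_eq_square)
    then have 1: "qpoch (a*d/q^(2*n+1)) (q^2) (Suc n)
      = (\<Prod>i<Suc n. - (a*d/q^(2*n+1)*(q^2)^i)) * qpoch (q/(a*d)) (q^2) (Suc n)"
     and 2: "qpoch (a*q/d/q^(2*n+1)) (q^2) (Suc n)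
       = (\<Prod>i<Suc n. - (a*q/d/q^(2*n+1)*(q^2)^i)) * qpoch (d/a) (q^2) (Suc n)"
      using qpoch_reverse[of "a*d/q^(2*n+1)" "q^2" "Suc n"] qpoch_reverse[of "a*q/d/q^(2*n+1)" "q^2"
        "Suc n"] nz by simp_all
    have "(\<Prod>i<Suc n. - (a*d/q^(2*n+1)*(q^2)^i)) * (\<Prod>i<Suc n. - (a*q/d/q^(2*n+1)*(q^2)^i))
      = (\<Prod>i<Suc n. a^2 * ((- (q^(2*i)/q^(2*n+1))) * (- (q^(2*i+1)/q^(2*n+1)))))"
      unfolding prod.distrib[symmetric] using nz
        by (intro prod.cong refl) (simp add: power2_eq_square power_mult power_mult_distrib mult_ac)
    also have "\<dots> = a^(2*n+2) * (\<Prod>i<2*Suc n. - (q^i/q^(2*n+1)))"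
    proof -
      have "a^(2*n+2) = (a^2)^Suc n" by (simp add: power_mult power2_eq_square)
      then show ?thesis unfolding prod_even_odd prod_scale by simp
    qed
    \<comment> \<open>There is one factor more than in \<open>node_sign\<close>, namely
      \<open>-1\<close> for \<open>i = 2*n+1\<close>.\<close>
    also have "(\<Prod>i<2*Suc n. - (q^i/q^(2*n+1))) = - node_sign q (2*n+1)"
    proof -
      have "2 * Suc n = Suc (2*n+1)" by simp
      then show ?thesis unfolding node_sign_def using nz by (simp only: prod.lessThan_Suc) simp
    qed
    finally have *: "(\<Prod>i<Suc n. - (a*d/q^(2*n+1)*(q^2)^i))
      * (\<Prod>i<Suc n. - (a*q/d/q^(2*n+1)*(q^2)^i)) = a^(2*n+2) * - node_sign q (2*n+1)" .
    have gen: "x*x' = A*S \<Longrightarrow> (x*g)*(x'*h) = S*(A*g*h)" for x x' A S g h :: complex by algebra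
    show ?thesis unfolding 1 2 by (rule gen[OF *])
  qed
  have g: "whipple_value a d q (2*n+1)
    = - (a^(2*n+2) * qpoch (q/(a*d)) (q^2) (Suc n) * qpoch (d/a) (q^2) (Suc n)
      / (qpoch (a*d) (q^2) (Suc n) * qpoch (a*q/d) (q^2) (Suc n)))"
    unfolding whipple_value_odd[OF nz(2,3,1) dd] qpoch_Suc_left
    using nz by (simp add: power2_eq_square power3_eq_cube mult_ac)
  have e: "a*d*(1/q^(2*n+1)) = a*d/q^(2*n+1)" "a*d*q/(1/q^(2*n+1)) = a*d*q*q^(2*n+1)" "a*(1/q^(2*n+1))*q/d
    = a*q/d/q^(2*n+1)"
     "q^2*a/(d*(1/q^(2*n+1))) = a*q/d*q*q^(2*n+1)" by (simp_all add: power2_eq_square mult_ac)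
  have "interp_num a d q M (1/q^(2*n+1))
    = (qpoch (a*d/q^(2*n+1)) (q^2) (Suc n) * qpoch (a*q/d/q^(2*n+1)) (q^2) (Suc n))
    * qpoch (a*d*q) (q^2) (M-Suc n) * qpoch (a*d*q*q^(2*n+1)) (q^2) M * qpoch (a*q/d*q) (q^2) (M-Suc n)
      * qpoch (a*q/d*q*q^(2*n+1)) (q^2) M"
    unfolding interp_num_def qpochs_Cons qpochs_Nil e s1 by (simp add: mult_ac)
  also have "\<dots> = node_sign q (2*n+1) * whipple_value a d q (2*n+1)
     * (qpoch (a*d*q) (q^2) (M-Suc n) * qpoch (a*d) (q^2) (M+Suc n))
       * (qpoch (a*q/d*q) (q^2) (M-Suc n) * qpoch (a*q/d) (q^2) (M+Suc n))"
    unfolding rev g s2[symmetric] using nz2 by (simp add: mult_ac)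
  finally show ?thesis .
qed

text \<open>The \<open>M\<close>-dependent part of the numerator at the node \<open>k\<close>. It
  always consists of \<open>2*M\<close> factors and tends to \<open>(x; q)_infinity\<close> for
  fixed \<open>k\<close>.\<close>

definition interp_tail :: "complex \<Rightarrow> complex \<Rightarrow> nat \<Rightarrow> nat \<Rightarrow>
  complex" where
  "interp_tail x q M k = (if even k then qpoch x (q^2) (M - k div 2) * qpoch (x*q) (q^2) (M + k div 2)
     else qpoch (x*q) (q^2) (M - Suc (k div 2)) * qpoch x (q^2) (M + Suc (k div 2)))"

text \<open>Away from zero denominators it telescopes to
  \<open>(1-y) * (1-q/y) / ((1-y*q^k) * (1-q^(k+1)/y))\<close>. It is invariant under exchange of
  \<open>y\<close> and \<open>q/y\<close>, and its denominator is the linear factor of the node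
  \<open>k\<close> in \<open>y + q/y\<close>.\<close>

definition symmetric_quotient :: "complex \<Rightarrow> complex \<Rightarrow> nat \<Rightarrow> complex" where
  "symmetric_quotient q y k = qpoch y q k * qpoch (q/y) q k / (qpoch (y*q) q k * qpoch (q^2/y) q k)"

lemma interp_num_node:
  assumes nz: "q \<noteq> 0" "a \<noteq> 0" "d \<noteq> 0" and k: "k \<le> 2*M"
    and dd: "qpoch (a*d) q k \<noteq> 0" "qpoch (a*q/d) q k \<noteq> 0"
  shows "interp_num a d q M (1/q^k)
    = node_sign q k * whipple_value a d q k * interp_tail (a*d) q M k * interp_tail (a*q/d) q M k"
proof (cases "even k")
  case True
  then obtain n where n: "k = 2*n" by (elim evenE)
  show ?thesis using interp_num_node_even[of q a d n M] assms by (simp add: n interp_tail_def)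
next
  case False
  then obtain n where n: "k = 2*n+1" by (elim oddE)
  then have "n < M" using k by simp
  then show ?thesis using interp_num_node_odd[OF nz, of n M] dd n by (simp add: interp_tail_def)
qed

text \<open>Dividing the interpolation formula by the \<open>2*M\<close> factors with indices
  \<open>1..2*M\<close> turns the product over \<open>i \<noteq> k\<close> into
  \<open>symmetric_quotient\<close>; \<open>node_sign\<close> cancels between the value at the node
  and the node differences.\<close>

lemma finite_partial_fractions:
  assumes q: "q \<noteq> 0" "norm q < 1" and nz: "a \<noteq> 0" "d \<noteq> 0" "y \<noteq> 0"
    and dd: "\<And>n. qpoch (a*d) q n \<noteq> 0" "\<And>n. qpoch (a*q/d) q n \<noteq> 0"
    and yy: "\<And>n. qpoch (y*q) q n \<noteq> 0" "\<And>n. qpoch (q^2/y) q n \<noteq> 0"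
  shows "interp_num a d q M y / (qpoch (y*q) q (2*M) * qpoch (q^2/y) q (2*M))
    = (\<Sum>k\<le>2*M. (1-q^(2*k+1)) * whipple_value a d q k * symmetric_quotient q y k
        * (interp_tail (a*d) q M k * interp_tail (a*q/d) q M k
          * (inverse (qpoch q q (2*M-k)) * inverse (qpoch q q (2*M+1+k)))))"
proof -
  have qn: "q^n \<noteq> 1" if "n > 0" for n
    using power_less_one_iff[of "norm q" n] q that by (auto simp flip: norm_power)
  have *: "interp_num a d q M (1/q^k) * (\<Prod>i\<in>{..2*M}-{k}. (1-y*q^i) * (1-q^(i+1)/y)
    / ((1-q^i/q^k) * (1-q^(i+1)*q^k)))
    = (qpoch (y*q) q (2*M) * qpoch (q^2/y) q (2*M))
      * ((1-q^(2*k+1)) * whipple_value a d q k * symmetric_quotient q y k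
        * (interp_tail (a*d) q M k * interp_tail (a*q/d) q M k
          * (inverse (qpoch q q (2*M-k)) * inverse (qpoch q q (2*M+1+k)))))"
    if k: "k \<le> 2*M" for k
  proof -
    obtain j where m: "2*M = k + j" using k le_Suc_ex by blast
    have 1: "(\<Prod>i\<in>{..2*M}-{k}. (1-y*q^i) * (1-q^(i+1)/y))
      = qpoch y q k * qpoch (y*q*q^k) q j * (qpoch (q/y) q k * qpoch (q^2/y*q^k) q j)"
      unfolding m prod_except prod.distrib qpoch_def by (simp add: power_add power2_eq_square mult_ac)
    have 2: "(\<Prod>i\<in>{..2*M}-{k}. (1-y*q^i) * (1-q^(i+1)/y))
      = (qpoch (y*q) q (2*M) * qpoch (q^2/y) q (2*M)) * symmetric_quotient q y k"
      unfolding 1 unfolding m qpoch_add symmetric_quotient_def using yy by simp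
    have s0: "node_sign q k \<noteq> 0" using q by (simp add: node_sign_def)
    have q1: "1 - q^(2*k+1) \<noteq> 0" using qn[of "2*k+1"] by simp
    have 3: "(\<Prod>i\<in>{..2*M}-{k}. (1-q^i/q^k) * (1-q^(i+1)*q^k))
      = node_sign q k * (qpoch q q (2*M-k) * qpoch q q (2*M+1+k)) / (1-q^(2*k+1))"
      using node_denominator[OF q(1) k] q1 by (simp add: field_simps)
    show ?thesis
      unfolding prod_dividef 2 3 interp_num_node[OF q(1) nz(1,2) k dd]
      using s0 q1 by (simp add: divide_inverse mult_ac)
  qed
  have "interp_num a d q M y = (\<Sum>k\<le>2*M. (qpoch (y*q) q (2*M) * qpoch (q^2/y) q (2*M))
    * ((1-q^(2*k+1)) * whipple_value a d q k * symmetric_quotient q y k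
        * (interp_tail (a*d) q M k * interp_tail (a*q/d) q M k
          * (inverse (qpoch q q (2*M-k)) * inverse (qpoch q q (2*M+1+k))))))"
    unfolding interp_num_lagrange[OF q nz(3,2)] by (intro sum.cong refl *) simp
  then show ?thesis unfolding sum_distrib_left[symmetric] using yy by simp
qed

section \<open>Uniform bounds and the passage to the limit\<close>

lemma Bseq_even_odd:
  fixes f :: "nat \<Rightarrow> complex"
  assumes "Bseq (\<lambda>n. f (2*n))" "Bseq (\<lambda>n. f (2*n+1))"
  shows "Bseq f"
proof -
  obtain K L where K: "\<And>n. norm (f (2*n)) \<le> K" and L: "\<And>n. norm (f (2*n+1)) \<le> L"
    using assms unfolding Bseq_def by blast
  have "norm (f n) \<le> max K L" for n
    using K[of "n div 2"] L[of "n div 2"] by (cases "even n") (auto simp: max_def elim!: evenE oddE)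
  then show ?thesis by (rule BseqI')
qed

lemma Bseq_qpoch: "norm t < 1 \<Longrightarrow> Bseq (qpoch x t)"
  by (intro convergent_imp_Bseq convergentI[OF qpoch_LIMSEQ])

lemma Bseq_inverse_qpoch: "norm t < 1 \<Longrightarrow> qpoch_inf x t \<noteq> 0
  \<Longrightarrow> Bseq (\<lambda>n. inverse (qpoch x t n))"
  by (intro convergent_imp_Bseq convergentI[OF tendsto_inverse[OF qpoch_LIMSEQ]])

lemma qpoch_square_base_nonzero:
  assumes "qpoch_inf x q \<noteq> 0" "norm q < 1"
  shows "qpoch_inf x (q^2) \<noteq> 0" "qpoch_inf (x*q) (q^2) \<noteq> 0"
  using assms qpoch_inf_double[OF assms(2), of x] by auto

text \<open>Apart from the power of \<open>a\<close>, the closed forms are quotients of convergent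
  products whose denominators have nonzero limits. This gives the majorant of order
  \<open>norm a ^ k\<close>.\<close>

lemma Bseq_whipple_value:
  assumes q: "q \<noteq> 0" "norm q < 1" and nz: "a \<noteq> 0" "d \<noteq> 0"
    and inf: "qpoch_inf (a*d) q \<noteq> 0" "qpoch_inf (a*q/d) q \<noteq> 0"
  shows "Bseq (\<lambda>k. whipple_value a d q k / a^k)"
proof (rule Bseq_even_odd)
  have q2: "norm (q^2) < 1" using q by (simp add: norm_power power_less_one_iff)
  have dd: "qpoch (a*d) q n \<noteq> 0" "qpoch (a*q/d) q n \<noteq> 0" for n
    using inf q(2) by (auto simp: qpoch_inf_eq_0_iff)
  have even: "whipple_value a d q (2*n) / a^(2*n) = qpoch (q^2/(a*d)) (q^2) n * (qpoch (d*q/a) (q^2) n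
      * (inverse (qpoch (a*d*q) (q^2) n) * inverse (qpoch (a*q/d*q) (q^2) n)))" for n
    using whipple_value_even[OF nz q(1) dd, of n] nz by (simp add: divide_inverse power2_eq_square mult_ac)
  show "Bseq (\<lambda>n. whipple_value a d q (2*n) / a^(2*n))"
    unfolding even by (intro Bseq_mult Bseq_qpoch Bseq_inverse_qpoch q2 qpoch_square_base_nonzero(2) inf q(2))
  have sh: "qpoch_inf (x*q^2) (q^2) \<noteq> 0" if "qpoch_inf x q \<noteq> 0" for x
    using qpoch_inf_shift[OF q2, of x] qpoch_square_base_nonzero(1)[OF that q(2)] by auto
  have odd: "whipple_value a d q (2*n+1) / a^(2*n+1)
    = - (a^2 * (1-d/a) * (1-q/(a*d))
      / ((1-a*d) * (1-a*q/d))) / a * (qpoch (q^3/(a*d)) (q^2) n * (qpoch (d*q^2/a) (q^2) n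
      * (inverse (qpoch (a*d*q^2) (q^2) n) * inverse (qpoch (a*q/d*q^2) (q^2) n))))" for n
    unfolding whipple_value_odd[OF nz q(1) dd] using nz
      by (simp add: divide_inverse power2_eq_square power3_eq_cube mult_ac)
  show "Bseq (\<lambda>n. whipple_value a d q (2*n+1) / a^(2*n+1))"
    unfolding odd by (intro Bseq_mult Bfun_const Bseq_qpoch Bseq_inverse_qpoch q2 sh inf)
qed

lemma Bseq_symmetric_quotient:
  assumes q: "norm q < 1" and inf: "qpoch_inf (y*q) q \<noteq> 0" "qpoch_inf (q^2/y) q \<noteq> 0"
  shows "Bseq (symmetric_quotient q y)"
proof -
  have "symmetric_quotient q y = (\<lambda>k. qpoch y q k * (qpoch (q/y) q k
    * (inverse (qpoch (y*q) q k) * inverse (qpoch (q^2/y) q k))))"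
    by (simp add: symmetric_quotient_def fun_eq_iff divide_inverse mult_ac)
  then show ?thesis using assms by (auto intro!: Bseq_mult Bseq_qpoch Bseq_inverse_qpoch)
qed

lemma interp_tail_LIMSEQ:
  assumes "norm q < 1"
  shows "(\<lambda>M. interp_tail x q M k) \<longlonglongrightarrow> qpoch_inf x q"
proof -
  have q2: "norm (q^2) < 1" using assms by (simp add: norm_power power_less_one_iff)
  have m: "(\<lambda>M. qpoch x (q^2) (M - c)) \<longlonglongrightarrow> qpoch_inf x (q^2)" for x c
    by (rule filterlim_compose[OF qpoch_LIMSEQ[OF q2] filterlim_minus_const_nat_at_top])
  have p: "(\<lambda>M. qpoch x (q^2) (M + c)) \<longlonglongrightarrow> qpoch_inf x (q^2)" for x c
    using LIMSEQ_ignore_initial_segment[OF qpoch_LIMSEQ[OF q2]] .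
  show ?thesis unfolding interp_tail_def qpoch_inf_double[OF assms]
    using tendsto_mult[OF m[of x "k div 2"] p[of "x*q"
      "k div 2"]] tendsto_mult[OF p[of x "Suc (k div 2)"] m[of "x*q" "Suc (k div 2)"]]
    by (cases "even k") (auto simp: mult.commute)
qed

text \<open>Uniformity in both \<open>M\<close> and \<open>k\<close> is what Tannery's theorem
  requires.\<close>

lemma interp_tail_bounded:
  assumes "norm q < 1"
  obtains B where "B > 0" "\<And>M k. norm (interp_tail x q M k) \<le> B"
proof -
  have q2: "norm (q^2) < 1" using assms by (simp add: norm_power power_less_one_iff)
  obtain A B where AB: "A > 0" "\<And>n. norm (qpoch x (q^2) n) \<le> A" "B > 0"
    "\<And>n. norm (qpoch (x*q) (q^2) n) \<le> B"
    using qpoch_bounded[OF q2] by metis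
  have "norm (qpoch x (q^2) m * qpoch (x*q) (q^2) l) \<le> A * B" for m l
    using AB unfolding norm_mult by (intro mult_mono) (auto intro: less_imp_le)
  then have "norm (interp_tail x q M k) \<le> A * B" for M k
    unfolding interp_tail_def by (auto simp only: mult.commute[of "qpoch (x*q) (q^2) _"] split: if_splits)
  then show ?thesis using that[of "A*B"] AB by simp
qed

lemma partial_fraction_expansion:
  assumes q: "q \<noteq> 0" "norm q < 1" and a: "norm a < 1" and nz: "a \<noteq> 0" "d \<noteq> 0"
    "y \<noteq> 0"
    and inf: "qpoch_inf (a*d) q \<noteq> 0" "qpoch_inf (a*q/d) q \<noteq> 0" "qpoch_inf (y*q) q \<noteq> 0"
      "qpoch_inf (q^2/y) q \<noteq> 0"
  defines "f \<equiv> (\<lambda>k. (1-q^(2*k+1)) / (1-q) * whipple_value a d q k * symmetric_quotient q y k)"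
  shows "summable (\<lambda>k. norm (f k))"
    and "(\<Sum>k. f k) = qpochs_inf [q, q^2] q * qpochs_inf [a*d*y, a*d*q/y, a*y*q/d, q^2*a/(d*y)] (q^2)
           / qpochs_inf [a*d, a*q/d, y*q, q^2/y] q"
proof -
  have q1: "1 - q \<noteq> 0" using q(2) by auto
  have qq: "qpoch_inf q q \<noteq> 0"
  proof -
    have "q * q^i \<noteq> 1" for i
      using power_less_one_iff[of "norm q" "Suc i"] q by (auto simp flip: norm_power power_Suc)
    then show ?thesis using q(2) by (auto simp: qpoch_inf_eq_0_iff qpoch_eq_0_iff)
  qed
  have q2: "norm (q^2) < 1" using q by (simp add: norm_power power_less_one_iff)
  define g where "g k = (1-q^(2*k+1)) * whipple_value a d q k * symmetric_quotient q y k" for k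
  obtain K where K: "\<And>k. norm (g k) \<le> K * norm a ^ k"
  proof -
    have "Bseq (\<lambda>k. (1-q^(2*k+1)) * ((whipple_value a d q k / a^k) * symmetric_quotient q y k))"
    proof (intro Bseq_mult Bseq_whipple_value Bseq_symmetric_quotient q nz inf)
      have "norm (1 - q^(2*k+1)) \<le> 2" for k
        using norm_triangle_ineq4[of 1 "q^(2*k+1)"] power_le_one[of "norm q" "2*k+1"] q(2)
          by (simp add: norm_power norm_mult)
      then show "Bseq (\<lambda>k. 1 - q^(2*k+1))" by (rule BseqI')
    qed
    then obtain K where "\<And>k. norm ((1-q^(2*k+1))
      * ((whipple_value a d q k / a^k) * symmetric_quotient q y k)) \<le> K"
      unfolding Bseq_def by blast
    moreover have "g k = (1-q^(2*k+1))
      * ((whipple_value a d q k / a^k) * symmetric_quotient q y k) * a^k" for k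
      using nz by (simp add: g_def)
    ultimately have "norm (g k) \<le> K * norm a ^ k" for k
      by (simp only: norm_mult[of _ "a^k"] norm_power) (intro mult_right_mono, auto)
    then show ?thesis by (rule that)
  qed
  obtain B1 B2 B3 where B: "\<And>M k. norm (interp_tail (a*d) q M k) \<le> B1"
    "\<And>M k. norm (interp_tail (a*q/d) q M k) \<le> B2"
    "\<And>n. norm (inverse (qpoch q q n)) \<le> B3" "B1 > 0" "B2 > 0" "B3 > 0"
    using interp_tail_bounded[OF q(2)] inverse_qpoch_bounded[OF q(2) qq] by metis
  \<comment> \<open>Extension by zero beyond \<open>2*M\<close> makes the finite expansions series
    over all \<open>k\<close>.\<close>
  define F where "F k M = (if k \<le> 2*M then g k * (interp_tail (a*d) q M k * interp_tail (a*q/d) q M k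
      * (inverse (qpoch q q (2*M-k)) * inverse (qpoch q q (2*M+1+k)))) else 0)" for k M
  \<comment> \<open>The limit of the factors of \<open>F k M\<close> that depend on
    \<open>M\<close>; it does not depend on \<open>k\<close>.\<close>
  define c where "c = qpoch_inf (a*d) q * qpoch_inf (a*q/d) q
    * (inverse (qpoch_inf q q) * inverse (qpoch_inf q q))"
  have sumK: "summable (\<lambda>k. K * norm a ^ k * (B1 * B2 * (B3 * B3)))"
    using a by (intro summable_mult2 summable_mult summable_geometric) simp
  have lim: "(\<lambda>M. F k M) \<longlonglongrightarrow> g k * c" for k
  proof -
    have L: "(\<lambda>M. qpoch q q (2*M+i)) \<longlonglongrightarrow> qpoch_inf q q"
      "(\<lambda>M. qpoch q q (2*M-i)) \<longlonglongrightarrow> qpoch_inf q q" for i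
    proof -
      show "(\<lambda>M. qpoch q q (2*M+i)) \<longlonglongrightarrow> qpoch_inf q q"
        by (rule filterlim_compose[OF qpoch_LIMSEQ[OF q(2)]]) real_asymp
      show "(\<lambda>M. qpoch q q (2*M-i)) \<longlonglongrightarrow> qpoch_inf q q"
        by (rule filterlim_compose[OF qpoch_LIMSEQ[OF q(2)]]) real_asymp
    qed
    have "(\<lambda>M. g k * (interp_tail (a*d) q M k * interp_tail (a*q/d) q M k
      * (inverse (qpoch q q (2*M-k)) * inverse (qpoch q q (2*M+(1+k)))))) \<longlonglongrightarrow> g k * c"
      unfolding c_def by (intro tendsto_mult tendsto_const interp_tail_LIMSEQ[OF q(2)] tendsto_inverse L qq)
    moreover have "eventually (\<lambda>M. g k * (interp_tail (a*d) q M k * interp_tail (a*q/d) q M k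
      * (inverse (qpoch q q (2*M-k)) * inverse (qpoch q q (2*M+(1+k))))) = F k M) sequentially"
      using eventually_ge_at_top[of k] by eventually_elim (simp add: F_def)
    ultimately show ?thesis by (rule Lim_transform_eventually)
  qed
  have bound: "norm (F k M) \<le> K * norm a ^ k * (B1 * B2 * (B3 * B3))" for k M
  proof (cases "k \<le> 2*M")
    case True
    have "norm (F k M) \<le> (K * norm a ^ k) * (B1 * B2 * (B3 * B3))"
      unfolding F_def norm_mult if_P[OF True]
      by (intro mult_mono K B mult_nonneg_nonneg norm_ge_zero order_trans[OF norm_ge_zero K] order_trans[OF
        norm_ge_zero B(1)]
         order_trans[OF norm_ge_zero B(2)] order_trans[OF norm_ge_zero B(3)])
    then show ?thesis .
  next
    case False
    have "0 \<le> K * norm a ^ k" by (rule order_trans[OF norm_ge_zero K])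
    then show ?thesis using False B(4-6) by (simp add: F_def)
  qed
  have tannery: "(\<lambda>M. \<Sum>k. F k M) \<longlonglongrightarrow> (\<Sum>k. g k * c)"
  proof -
    have "eventually (\<lambda>(k, M). norm (F k M) \<le> K * norm a ^ k * (B1 * B2
      * (B3 * B3))) (at_top \<times>\<^sub>F sequentially)"
      using bound by (simp add: case_prod_unfold)
    from tannerys_theorem[OF lim this sumK] show ?thesis by simp
  qed
  have dd: "qpoch (a*d) q n \<noteq> 0" "qpoch (a*q/d) q n \<noteq> 0" "qpoch (y*q) q n \<noteq> 0"
    "qpoch (q^2/y) q n \<noteq> 0" for n
    using inf q(2) by (auto simp: qpoch_inf_eq_0_iff)
  have Fsum: "(\<Sum>k. F k M) = interp_num a d q M y / (qpoch (y*q) q (2*M) * qpoch (q^2/y) q (2*M))" for M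
  proof -
    have "(\<Sum>k. F k M) = (\<Sum>k\<le>2*M. F k M)" by (rule suminf_finite) (auto simp: F_def)
    then show ?thesis
      unfolding finite_partial_fractions[OF q nz dd] by (simp add: F_def g_def)
  qed
  have dbl: "(\<lambda>M. qpoch x q (2*M)) \<longlonglongrightarrow> qpoch_inf x q" for x
    by (rule filterlim_compose[OF qpoch_LIMSEQ[OF q(2)]]) real_asymp
  have "(\<lambda>M. \<Sum>k. F k M) \<longlonglongrightarrow> qpochs_inf [a*d*y, a*d*q/y, a*y*q/d,
    q^2*a/(d*y)] (q^2) / (qpoch_inf (y*q) q * qpoch_inf (q^2/y) q)"
    unfolding Fsum interp_num_def qpochs_inf_def list.map prod_list.Cons prod_list.Nil qpochs_Cons qpochs_Nil
    using inf by (intro tendsto_intros dbl qpoch_LIMSEQ q2) auto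
  then have eq: "(\<Sum>k. g k * c)
    = qpochs_inf [a*d*y, a*d*q/y, a*y*q/d, q^2*a/(d*y)] (q^2) / (qpoch_inf (y*q) q * qpoch_inf (q^2/y) q)"
    by (rule LIMSEQ_unique[OF tannery])
  have sg: "summable (\<lambda>k. norm (g k))"
  proof (rule summable_comparison_test')
    show "summable (\<lambda>k. K * norm a ^ k)" using a by (intro summable_mult summable_geometric) simp
  qed (use K in auto)
  have fg: "f k = g k * (1/(1-q))" for k by (simp add: f_def g_def)
  show "summable (\<lambda>k. norm (f k))" unfolding fg norm_mult by (rule summable_mult2[OF sg])
  have "(\<Sum>k. f k) = (\<Sum>k. g k) / (1-q)"
    unfolding fg using suminf_mult2[OF summable_norm_cancel[OF sg], of "1/(1-q)"] by simp
  also have "(\<Sum>k. g k) = qpochs_inf [a*d*y, a*d*q/y, a*y*q/d, q^2*a/(d*y)] (q^2)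
    / (qpoch_inf (y*q) q * qpoch_inf (q^2/y) q) / c"
  proof -
    have "c \<noteq> 0" using inf qq by (simp add: c_def)
    moreover have "(\<Sum>k. g k * c) = (\<Sum>k. g k) * c"
      using suminf_mult2[OF summable_norm_cancel[OF sg], of c] by simp
    ultimately show ?thesis unfolding eq[symmetric] by simp
  qed
  also have "\<dots> / (1-q) = qpochs_inf [q, q^2] q * qpochs_inf [a*d*y, a*d*q/y, a*y*q/d, q^2*a/(d*y)] (q^2)
           / qpochs_inf [a*d, a*q/d, y*q, q^2/y] q"
  proof -
    \<comment> \<open>The factor \<open>1/(1-q)\<close> of \<open>f\<close> turns one of the two
      copies of \<open>(q; q)_infinity\<close> from \<open>1/c\<close> into
      \<open>(q^2; q)_infinity\<close>.\<close>
    have "qpoch_inf (q^2) q = qpoch_inf q q / (1-q)"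
      using qpoch_inf_shift[OF q(2), of q] q1 by (simp add: power2_eq_square)
    then have "qpochs_inf [q, q^2] q = qpoch_inf q q * qpoch_inf q q / (1-q)" by (simp add: qpochs_inf_def)
    moreover have "qpochs_inf [a*d, a*q/d, y*q, q^2/y] q
      = qpoch_inf (a*d) q * qpoch_inf (a*q/d) q * qpoch_inf (y*q) q * qpoch_inf (q^2/y) q"
      by (simp add: qpochs_inf_def mult_ac)
    ultimately show ?thesis unfolding c_def by (simp add: divide_inverse mult_ac)
  qed
  finally show "(\<Sum>k. f k) = qpochs_inf [q, q^2] q
    * qpochs_inf [a*d*y, a*d*q/y, a*y*q/d, q^2*a/(d*y)] (q^2)
           / qpochs_inf [a*d, a*q/d, y*q, q^2/y] q" .
qed

lemma suminf_even_odd: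
  fixes f :: "nat \<Rightarrow> complex"
  assumes "summable (\<lambda>n. norm (f n))"
  shows "(\<Sum>n. f n) = (\<Sum>n. f (2*n)) + (\<Sum>n. f (2*n+1))"
proof -
  have s: "summable (\<lambda>n. f (2*n))" "summable (\<lambda>n. f (2*n+1))"
    using summable_reindex[OF assms, of "\<lambda>n. 2*n"] summable_reindex[OF assms, of "\<lambda>n. 2*n+1"]
    by (auto intro!: summable_norm_cancel simp: inj_on_def o_def)
  have "(\<lambda>n. \<Sum>k\<in>{n*2..<n*2+2}. f k) sums (\<Sum>n. f n)"
    by (rule sums_group[OF summable_sums[OF summable_norm_cancel[OF assms]]]) simp
  moreover have "(\<Sum>k\<in>{n*2..<n*2+2}. f k) = f (2*n) + f (2*n+1)" for n
    by (simp add: numeral_2_eq_2 mult.commute)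
  ultimately have "(\<lambda>n. f (2*n) + f (2*n+1)) sums (\<Sum>n. f n)" by simp
  then show ?thesis using suminf_add[OF s] by (simp add: sums_iff)
qed

text \<open>Some upper parameter may by accident be a nonpositive power of the base; the terms cut
  off by \<open>phi\<close> then vanish, so the infinite series is correct in every case.\<close>

lemma phi_suminf:
  assumes "t \<noteq> 0"
  shows "phi as bs t x = (\<Sum>n. phi_term as bs t x n)"
proof (cases "\<exists>M::nat. t powi (- int M) \<in> set as")
  case True
  then obtain M :: nat where M: "t powi (- int M) \<in> set as" by blast
  show ?thesis unfolding phi_terminating[OF assms M]
    by (rule suminf_finite[symmetric]) (use phi_term_beyond[OF assms M] in auto)
qed (simp add: phi_def)

lemma nonterminating_summation:
  fixes q a d y :: complex and rt :: "complex \<Rightarrow> complex"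
  assumes rt: "\<forall>w. (rt w)^2 = w"
    and nz: "q \<noteq> 0" "a \<noteq> 0" "d \<noteq> 0" "y \<noteq> 0"
    and q: "norm q < 1" and a: "norm a < 1"
    and as1: "as1 = [(rt q)^5, - ((rt q)^5), y, q/y, q^2/(a*d), d*q/a, q^2]"
    and bs1: "bs1 = [rt q, - rt q, q^2*y, q^3/y, q*a*d, q^2*a/d]"
    and as2: "as2 = [(rt q)^7, - ((rt q)^7), y*q, q^2/y, q^3/(a*d), d*q^2/a, q^2]"
    and bs2: "bs2 = [(rt q)^3, - ((rt q)^3), q^3*y, q^4/y, q^2*a*d, q^3*a/d]"
    and den1: "phi_denoms_nonzero bs1 (q^2) UNIV"
    and den2: "phi_denoms_nonzero bs2 (q^2) UNIV"
    and inf: "qpochs_inf [a*d, a*q/d, y*q, q^2/y] q \<noteq> 0"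
  shows "phi as1 bs1 (q^2) (a^2)
         - a^2 * ((1 - d/a) * (1 - q/(a*d)) * (1 - q^3) * (1 - q/y) * (1 - y))
               / ((1 - a*d) * (1 - q) * (1 - a*q/d) * (1 - q^2/y) * (1 - q*y))
           * phi as2 bs2 (q^2) (a^2)
         = qpochs_inf [q, q^2] q * qpochs_inf [a*d*y, a*d*q/y, a*y*q/d, q^2*a/(d*y)] (q^2)
           / qpochs_inf [a*d, a*q/d, y*q, q^2/y] q"
proof -
  define r where "r = rt q"
  have r: "r^2 = q" using rt by (simp add: r_def)
  have r3: "(r^3)^2 = q^3" unfolding r[symmetric] by (simp flip: power_mult)
  \<comment> \<open>The upper half-integer powers are the lower ones times the base
    \<open>q^2\<close>, so \<open>qpoch_sqrt_pair\<close> applies.\<close>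
  have r5: "r^5 = r*q^2" "r^7 = r^3*q^2" unfolding r[symmetric]
    by (simp_all flip: power_mult power_add power_Suc)
  have q0: "q^2 \<noteq> 0" using nz by simp
  have q1: "q \<noteq> 1" "q^3 \<noteq> 1"
    using q power_less_one_iff[of "norm q" 3] by (auto simp flip: norm_power)
  have inf': "qpoch_inf (a*d) q \<noteq> 0" "qpoch_inf (a*q/d) q \<noteq> 0" "qpoch_inf (y*q) q \<noteq> 0"
    "qpoch_inf (q^2/y) q \<noteq> 0"
    using inf by (simp_all add: qpochs_inf_def)
  have dd: "qpoch (a*d) q n \<noteq> 0" "qpoch (a*q/d) q n \<noteq> 0" "qpoch (y*q) q n \<noteq> 0"
    "qpoch (q^2/y) q n \<noteq> 0" for n
    using inf' q by (auto simp: qpoch_inf_eq_0_iff)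
  define f where "f k = (1-q^(2*k+1)) / (1-q) * whipple_value a d q k * symmetric_quotient q y k" for k
  define c where "c = a^2 * ((1 - d/a) * (1 - q/(a*d)) * (1 - q^3) * (1 - q/y) * (1 - y))
               / ((1 - a*d) * (1 - q) * (1 - a*q/d) * (1 - q^2/y) * (1 - q*y))"
  have Q: "q * (q^2)^(2*n) = q^(2*(2*n)+1)" "q^3 * (q^2)^(2*n) = q^(2*(2*n+1)+1)" for n
    by (simp_all add: power_mult[symmetric] power_add power3_eq_cube)
  have t1: "phi_term as1 bs1 (q^2) (a^2) n = f (2*n)" for n
  proof -
    have D: "qpochs (q^2 # bs1) (q^2) n \<noteq> 0" using den1 by (simp add: phi_denoms_nonzero_def)
    then have nz2: "qpoch r (q^2) n * qpoch (-r) (q^2) n \<noteq> 0" "qpoch (q^2) (q^2) n \<noteq> 0"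
      by (simp_all add: bs1 r_def)
    have pair: "qpoch (r^5) (q^2) n * qpoch (-(r^5)) (q^2) n
      = (1 - q^(2*(2*n)+1)) / (1-q) * (qpoch r (q^2) n * qpoch (-r) (q^2) n)"
      using qpoch_sqrt_pair[of r "q^2" n] q1(1) unfolding r5 r Q by (simp add: field_simps)
    \<comment> \<open>Split into base \<open>q^2\<close>, the products at \<open>y*q\<close> and
      \<open>q^2/y\<close> cancel between numerator and denominator.\<close>
    have s: "symmetric_quotient q y (2*n)
      = qpoch y (q^2) n * qpoch (q/y) (q^2) n / (qpoch (q^2*y) (q^2) n * qpoch (q^3/y) (q^2) n)"
      using dd(3,4)[of "2*n"] unfolding symmetric_quotient_def qpoch_double
        by (simp add: power2_eq_square power3_eq_cube mult_ac)
    have "phi_term as1 bs1 (q^2) (a^2) n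
      = (qpoch (r^5) (q^2) n * qpoch (-(r^5)) (q^2) n) / (qpoch r (q^2) n * qpoch (-r) (q^2) n)
       * (a^(2*n) * qpoch (q^2/(a*d)) (q^2) n * qpoch (d*q/a) (q^2) n
         / (qpoch (a*d*q) (q^2) n * qpoch (a*q^2/d) (q^2) n)) * symmetric_quotient q y (2*n)"
      unfolding phi_term_def as1 bs1 qpochs_Cons qpochs_Nil s r_def[symmetric] using nz2(2)
        by (simp add: mult_ac flip: power_mult)
    also have "\<dots> = f (2*n)"
      unfolding pair f_def whipple_value_even[OF nz(2,3,1) dd(1,2)] using nz2(1) by simp
    finally show ?thesis .
  qed
  have t2: "c * phi_term as2 bs2 (q^2) (a^2) n = - f (2*n+1)" for n
  proof -
    have D: "qpochs (q^2 # bs2) (q^2) n \<noteq> 0" using den2 by (simp add: phi_denoms_nonzero_def)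
    then have nz2: "qpoch (r^3) (q^2) n * qpoch (-(r^3)) (q^2) n \<noteq> 0" "qpoch (q^2) (q^2) n \<noteq> 0"
      by (simp_all add: bs2 r_def)
    define u where "u = 1 - q^3"
    have u: "u \<noteq> 0" using q1 by (simp add: u_def)
    have pair: "qpoch (r^7) (q^2) n * qpoch (-(r^7)) (q^2) n
      = (1 - q^(2*(2*n+1)+1)) / u * (qpoch (r^3) (q^2) n * qpoch (-(r^3)) (q^2) n)"
      using qpoch_sqrt_pair[of "r^3" "q^2" n] u unfolding r5 r3 Q u_def by (simp add: field_simps)
    have s1: "qpoch x q (2*n+1) = (1-x) * (qpoch (x*q) (q^2) n * qpoch (x*q*q) (q^2) n)" for x
      using qpoch_Suc_left[of x q "2*n"] by (simp add: qpoch_double)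
    have s: "symmetric_quotient q y (2*n+1)
      = (1-y) * (1-q/y) / ((1-q*y) * (1-q^2/y)) * (qpoch (y*q) (q^2) n * qpoch (q^2/y) (q^2) n
        / (qpoch (q^3*y) (q^2) n * qpoch (q^4/y) (q^2) n))"
      using dd(3,4)[of "2*n+1"] unfolding symmetric_quotient_def s1
        by (simp add: power2_eq_square power3_eq_cube power4_eq_xxxx mult_ac)
    have "phi_term as2 bs2 (q^2) (a^2) n
      = (qpoch (r^7) (q^2) n * qpoch (-(r^7)) (q^2) n) / (qpoch (r^3) (q^2) n * qpoch (-(r^3)) (q^2) n)
       * (a^(2*n) * qpoch (q^3/(a*d)) (q^2) n * qpoch (d*q^2/a) (q^2) n
         / (qpoch (a*d*q^2) (q^2) n * qpoch (a*q^3/d) (q^2) n))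
       * (qpoch (y*q) (q^2) n * qpoch (q^2/y) (q^2) n / (qpoch (q^3*y) (q^2) n * qpoch (q^4/y) (q^2) n))"
      unfolding phi_term_def as2 bs2 qpochs_Cons qpochs_Nil r_def[symmetric] using nz2(2)
        by (simp add: mult_ac flip: power_mult)
    also have "(qpoch (r^7) (q^2) n * qpoch (-(r^7)) (q^2) n)
      / (qpoch (r^3) (q^2) n * qpoch (-(r^3)) (q^2) n) = (1 - q^(2*(2*n+1)+1)) / u"
      unfolding pair using nz2(1) by simp
    finally show ?thesis
      unfolding f_def whipple_value_odd[OF nz(2,3,1) dd(1,2)] s c_def u_def[symmetric] using u
        by (simp add: mult_ac)
  qed
  have sumf: "summable (\<lambda>k. norm (f k))"
    unfolding f_def using partial_fraction_expansion(1)[OF nz(1) q a nz(2-4) inf'] .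
  have c2: "c * (\<Sum>n. phi_term as2 bs2 (q^2) (a^2) n) = - (\<Sum>n. f (2*n+1))"
  proof -
    have s: "summable (\<lambda>n. f (2*n+1))"
      using summable_reindex[OF sumf, of "\<lambda>n. 2*n+1"]
        by (auto intro!: summable_norm_cancel simp: inj_on_def o_def)
    show ?thesis
    \<comment> \<open>\<open>t2\<close> determines the second series only for
      \<open>c \<noteq> 0\<close>. If \<open>c = 0\<close>, for instance for \<open>y = 1\<close> or
      \<open>d = a\<close>, it shows instead that all odd terms vanish.\<close>
    proof (cases "c = 0")
      case True
      then have "f (2*n+1) = 0" for n using t2[of n] by simp
      then show ?thesis using True by simp
    next
      case False
      then have "phi_term as2 bs2 (q^2) (a^2) n = - (1/c) * f (2*n+1)" for n
        using t2[of n] by (simp add: field_simps)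
      then show ?thesis using False suminf_mult[OF s, of "- (1/c)"] by simp
    qed
  qed
  have "phi as1 bs1 (q^2) (a^2) - c * phi as2 bs2 (q^2) (a^2) = (\<Sum>k. f k)"
    unfolding phi_suminf[OF q0] t1 c2 suminf_even_odd[OF sumf] by simp
  also have "\<dots> = qpochs_inf [q, q^2] q * qpochs_inf [a*d*y, a*d*q/y, a*y*q/d, q^2*a/(d*y)] (q^2)
           / qpochs_inf [a*d, a*q/d, y*q, q^2/y] q"
    unfolding f_def using partial_fraction_expansion(2)[OF nz(1) q a nz(2-4) inf'] .
  finally show ?thesis unfolding c_def .
qed

theorem corollary12:
  fixes q a d y z :: complex and rt :: "complex \<Rightarrow> complex"
  assumes rt: "\<forall>w. (rt w)^2 = w"
    and nonzero: "q \<noteq> 0" "a \<noteq> 0" "d \<noteq> 0" "y \<noteq> 0" "z \<noteq> 0"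
  shows
   "(\<forall>N::nat. \<forall>cs1 cs2 cs3.
       N > 0
     \<longrightarrow> cs1 = [y, y*q, z, z*q, q^2/(a*d), d*q/a, q^2, a*q^(N+2)/(y*z), a*q^(N+3)/(y*z),
                q powi (- int N), q powi (1 - int N)]
     \<longrightarrow> cs2 = [y*q, y*q^2, z*q, z*q^2, q^3/(a*d), d*q^2/a, q^2, a*q^(N+3)/(y*z), a*q^(N+4)/(y*z),
                q powi (1 - int N), q powi (2 - int N)]
     \<longrightarrow> cs3 = [y, z, d, q/d, - a, a*q^(N+2)/(y*z), q powi (- int N)]
     \<longrightarrow> phi_denoms_nonzero (W_lower rt q cs1 (q^2)) (q^2) {..N div 2}
     \<longrightarrow> phi_denoms_nonzero (W_lower rt (q^3) cs2 (q^2)) (q^2) {..(N - 1) div 2}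
     \<longrightarrow> phi_denoms_nonzero (W_lower rt a cs3 q) q {..N}
     \<longrightarrow> (1 - a*d) * (1 - q) * (1 - a*q/d) * (1 - q^(2+N)) * (1 - q^2/y) * (1 - q^2/z)
           * (1 - y*z*q powi (- int N)/a) \<noteq> 0
     \<longrightarrow> qpochs [q^2/y, q^2/z, a*q/(y*z), a*q] q N \<noteq> 0
     \<longrightarrow> W rt q cs1 (q^2) (q^2)
         - a*q * ((1 - d/a) * (1 - q/(a*d)) * (1 - q^3) * (1 - q powi (- int N)) * (1 - y)
                    * (1 - a*q^(2+N)/(y*z)) * (1 - z))
               / ((1 - a*d) * (1 - q) * (1 - a*q/d) * (1 - q^(2+N)) * (1 - q^2/y) * (1 - q^2/z)
                    * (1 - y*z*q powi (- int N)/a))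
           * W rt (q^3) cs2 (q^2) (q^2)
         = qpochs [q^2, q^2/(y*z), a*q/y, a*q/z] q N / qpochs [q^2/y, q^2/z, a*q/(y*z), a*q] q N
           * W rt a cs3 q (- a))
    \<and>
    (\<forall>as1 bs1 as2 bs2.
       norm q < 1 \<longrightarrow> norm a < 1
     \<longrightarrow> as1 = [(rt q)^5, - ((rt q)^5), y, q/y, q^2/(a*d), d*q/a, q^2]
     \<longrightarrow> bs1 = [rt q, - rt q, q^2*y, q^3/y, q*a*d, q^2*a/d]
     \<longrightarrow> as2 = [(rt q)^7, - ((rt q)^7), y*q, q^2/y, q^3/(a*d), d*q^2/a, q^2]
     \<longrightarrow> bs2 = [(rt q)^3, - ((rt q)^3), q^3*y, q^4/y, q^2*a*d, q^3*a/d]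
     \<longrightarrow> phi_denoms_nonzero bs1 (q^2) UNIV
     \<longrightarrow> phi_denoms_nonzero bs2 (q^2) UNIV
     \<longrightarrow> (1 - a*d) * (1 - q) * (1 - a*q/d) * (1 - q^2/y) * (1 - q*y) \<noteq> 0
     \<longrightarrow> qpochs_inf [a*d, a*q/d, y*q, q^2/y] q \<noteq> 0
     \<longrightarrow> phi as1 bs1 (q^2) (a^2)
         - a^2 * ((1 - d/a) * (1 - q/(a*d)) * (1 - q^3) * (1 - q/y) * (1 - y))
               / ((1 - a*d) * (1 - q) * (1 - a*q/d) * (1 - q^2/y) * (1 - q*y))
           * phi as2 bs2 (q^2) (a^2)
         = qpochs_inf [q, q^2] q * qpochs_inf [a*d*y, a*d*q/y, a*y*q/d, q^2*a/(d*y)] (q^2)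
           / qpochs_inf [a*d, a*q/d, y*q, q^2/y] q)"
proof (rule conjI, intro allI impI, goal_cases)
  case (1 N cs1 cs2 cs3)
  show ?case by (rule terminating_transformation[OF rt nonzero 1])
next
  case 2
  show ?case
    by (intro allI impI, rule nonterminating_summation[OF rt nonzero(1-4)])
qed

end
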